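(* Fix $n\in\mathbb{N}$. There exists a càdlàg Markov process $(\mathcal{M}_t)_{t\in[0,\infty)}$ on $\mathcal{S}_n$ which is a regular Mallows process. Moreover, such a process is unique: any two càdlàg Markov processes on $\mathcal{S}_n$ that are regular Mallows processes have the same law.
   Context: $\mathcal{S}_n$ is the set of permutations of $[n]=\{1,\dots,n\}$, written $\sigma=(\sigma(1),\dots,\sigma(n))$. For $\sigma\in\mathcal{S}_n$, $\mathrm{Inv}(\sigma)=|\{i<j:\sigma(i)>\sigma(j)\}|$ and, for $j\in[n]$, $\mathrm{Inv}_j(\sigma)=|\{i\in[j-1]:\sigma(i)>\sigma(j)\}|$, so $\mathrm{Inv}(\sigma)=\sum_j\mathrm{Inv}_j(\sigma)$ and $0\le \mathrm{Inv}_j(\sigma)\le j-1$. For $q\in[0,\infty)$ the Mallows distribution is $\pi_{n,q}(\sigma)=q^{\mathrm{Inv}(\sigma)}/Z_{n,q}$ with $Z_{n,q}=\prod_{k=1}^n\sum_{\ell=0}^{k-1}q^\ell$ (convention $0^0=1$). A Mallows process is an $\mathcal{S}_n$-valued càdlàg process $(\mathcal{M}_t)_{t\ge0}$ with $\mathcal{M}_t\sim\pi_{n,t}$ for every $t\ge0$. It is strongly monotone if for all $t<t'$ and all $j\in[n]$, $\mathrm{Inv}_j(\mathcal{M}_t)\le \mathrm{Inv}_j(\mathcal{M}_{t'})$ (hence also $\mathrm{Inv}(\mathcal{M}_t)\le\mathrm{Inv}(\mathcal{M}_{t'})$); smooth if it is strongly monotone and $\mathrm{Inv}(\mathcal{M}_t)\le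 \mathrm{Inv}(\mathcal{M}_{t-})+1$ for all $t$; it has independent inversions if the processes $(\mathrm{Inv}_j(\mathcal{M}_t))_{t\ge0}$, $j\in[n]$, are mutually independent; it is regular if it is smooth and has independent inversions. *)

theory Defs
  imports "HOL-Probability.Probability" "HOL-Combinatorics.Permutations"
begin

definition Sn :: "nat \<Rightarrow> (nat \<Rightarrow> nat) set" where
  "Sn n = {\<sigma>. \<sigma> permutes {1..n}}"

definition Inv :: "nat \<Rightarrow> (nat \<Rightarrow> nat) \<Rightarrow> nat" where
  "Inv n \<sigma> = card {(i, j). i \<in> {1..n} \<and> j \<in> {1..n} \<and> i < j \<and> \<sigma> i > \<sigma> j}"

definition Inv_j :: "(nat \<Rightarrow> nat) \<Rightarrow> nat \<Rightarrow> nat" where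
  "Inv_j \<sigma> j = card {i \<in> {1..<j}. \<sigma> i > \<sigma> j}"

text \<open>Normalising constant; real powers satisfy 0^0 = 1.\<close>
definition mallows_Z :: "nat \<Rightarrow> real \<Rightarrow> real" where
  "mallows_Z n q = (\<Prod>k = 1..n. \<Sum>l < k. q ^ l)"

definition mallows_prob :: "nat \<Rightarrow> real \<Rightarrow> (nat \<Rightarrow> nat) \<Rightarrow> real" where
  "mallows_prob n q \<sigma> = q ^ Inv n \<sigma> / mallows_Z n q"

definition perm_process :: "nat \<Rightarrow> 'a measure \<Rightarrow> (real \<Rightarrow> 'a \<Rightarrow> nat \<Rightarrow> nat) \<Rightarrow> bool" where
  "perm_process n M X \<longleftrightarrow> prob_space M \<and>
     (\<forall>t\<ge>0. X t \<in> measurable M (count_space (Sn n)))"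

definition cadlag_discrete :: "(real \<Rightarrow> 'b) \<Rightarrow> bool" where
  "cadlag_discrete f \<longleftrightarrow>
     (\<forall>t\<ge>0. \<exists>e>0. \<forall>s\<in>{t..<t+e}. f s = f t) \<and>
     (\<forall>t>0. \<exists>y. \<exists>e>0. \<forall>s\<in>{t-e<..<t}. f s = y)"

definition left_lim :: "(real \<Rightarrow> 'b) \<Rightarrow> real \<Rightarrow> 'b" where
  "left_lim f t = (THE y. \<exists>e>0. \<forall>s\<in>{t-e<..<t}. f s = y)"

definition cadlag_process :: "'a measure \<Rightarrow> (real \<Rightarrow> 'a \<Rightarrow> 'b) \<Rightarrow> bool" where
  "cadlag_process M X \<longleftrightarrow> (\<forall>\<omega>\<in>space M. cadlag_discrete (\<lambda>t. X t \<omega>))"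

text \<open>Markov property (w.r.t. the natural filtration) for a discrete-state process:
  for times 0 <= t_0 < ... < t_m < t_{m+1}, past and future are conditionally independent
  given the present:  P(A,B,C) P(B) = P(A,B) P(B,C).\<close>
definition markov_process :: "'a measure \<Rightarrow> (real \<Rightarrow> 'a \<Rightarrow> 'b) \<Rightarrow> bool" where
  "markov_process M X \<longleftrightarrow>
     (\<forall>(m::nat) (ts::nat \<Rightarrow> real) (xs::nat \<Rightarrow> 'b).
        0 \<le> ts 0 \<and> (\<forall>i\<le>m. ts i < ts (Suc i)) \<longrightarrow>
        measure M {\<omega>\<in>space M. \<forall>i\<le>Suc m. X (ts i) \<omega> = xs i}
          * measure M {\<omega>\<in>space M. X (ts m) \<omega> = xs m}
        = measure M {\<omega>\<in>space M. \<forall>i\<le>m. X (ts i) \<omega> = xs i}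
          * measure M {\<omega>\<in>space M. X (ts m) \<omega> = xs m \<and> X (ts (Suc m)) \<omega> = xs (Suc m)})"

definition mallows_process :: "nat \<Rightarrow> 'a measure \<Rightarrow> (real \<Rightarrow> 'a \<Rightarrow> nat \<Rightarrow> nat) \<Rightarrow> bool" where
  "mallows_process n M X \<longleftrightarrow>
     (\<forall>t\<ge>0. \<forall>\<sigma>\<in>Sn n. measure M {\<omega>\<in>space M. X t \<omega> = \<sigma>} = mallows_prob n t \<sigma>)"

definition strongly_monotone :: "nat \<Rightarrow> 'a measure \<Rightarrow> (real \<Rightarrow> 'a \<Rightarrow> nat \<Rightarrow> nat) \<Rightarrow> bool" where
  "strongly_monotone n M X \<longleftrightarrow>
     (\<forall>\<omega>\<in>space M. \<forall>t t'. 0 \<le> t \<and> t < t' \<longrightarrow>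
        (\<forall>j\<in>{1..n}. Inv_j (X t \<omega>) j \<le> Inv_j (X t' \<omega>) j))"

text \<open>Smooth; at t = 0 the convention M_{0-} = M_0 makes the jump condition trivial.\<close>
definition smooth_process :: "nat \<Rightarrow> 'a measure \<Rightarrow> (real \<Rightarrow> 'a \<Rightarrow> nat \<Rightarrow> nat) \<Rightarrow> bool" where
  "smooth_process n M X \<longleftrightarrow> strongly_monotone n M X \<and>
     (\<forall>\<omega>\<in>space M. \<forall>t>0. Inv n (X t \<omega>) \<le> Inv n (left_lim (\<lambda>s. X s \<omega>) t) + 1)"

definition independent_inversions :: "nat \<Rightarrow> 'a measure \<Rightarrow> (real \<Rightarrow> 'a \<Rightarrow> nat \<Rightarrow> nat) \<Rightarrow> bool" where
  "independent_inversions n M X \<longleftrightarrow>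
     prob_space.indep_vars M (\<lambda>_. PiM {0::real..} (\<lambda>_. count_space (UNIV :: nat set)))
       (\<lambda>j \<omega>. restrict (\<lambda>t. Inv_j (X t \<omega>) j) {0..}) {1..n}"

definition regular_process :: "nat \<Rightarrow> 'a measure \<Rightarrow> (real \<Rightarrow> 'a \<Rightarrow> nat \<Rightarrow> nat) \<Rightarrow> bool" where
  "regular_process n M X \<longleftrightarrow> smooth_process n M X \<and> independent_inversions n M X"

definition regular_mallows_markov :: "nat \<Rightarrow> 'a measure \<Rightarrow> (real \<Rightarrow> 'a \<Rightarrow> nat \<Rightarrow> nat) \<Rightarrow> bool" where
  "regular_mallows_markov n M X \<longleftrightarrow> perm_process n M X \<and> cadlag_process M X \<and>
     markov_process M X \<and> mallows_process n M X \<and> regular_process n M X"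

definition process_law :: "nat \<Rightarrow> 'a measure \<Rightarrow> (real \<Rightarrow> 'a \<Rightarrow> nat \<Rightarrow> nat)
    \<Rightarrow> (real \<Rightarrow> nat \<Rightarrow> nat) measure" where
  "process_law n M X = distr M (PiM {0::real..} (\<lambda>_. count_space (Sn n)))
     (\<lambda>\<omega>. restrict (\<lambda>t. X t \<omega>) {0..})"

end

theory Submission
  imports Defs
begin

text \<open>
  A permutation is encoded by its inversion counts (its Lehmer code), so a regular Mallows process
  is a vector of independent nondecreasing processes moving by unit jumps.

  Uniqueness: for one coordinate \<open>I\<close> and a short interval \<open>[s, t]\<close>, the flow
  \<open>P(I\<^sub>s \<le> a) - P(I\<^sub>t \<le> a)\<close>, a function of the marginals, is the probability of moving from \<open>a\<close> to
  \<open>a + 1\<close> up to the probability of jumping at least twice. Summed over the cells of a partition the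
  latter tends to \<open>0\<close> with the mesh, because jumps are isolated and of size one. By independence and
  the Chapman--Kolmogorov equation the two-time laws, and then by the Markov property all
  finite-dimensional laws, are determined.

  Existence: a birth chain on \<open>{0..d}\<close> with rates \<open>\<rho>\<^sub>k\<close> has jump times whose joint law is the product
  of the densities \<open>\<rho>\<^sub>k exp (H\<^sub>k\<^sub>+\<^sub>1 - H\<^sub>k)\<close>, \<open>H\<^sub>k\<close> an antiderivative of \<open>\<rho>\<^sub>k\<close>, restricted to increasing
  sequences. Being in state \<open>k\<close> at time \<open>s\<close> separates the first \<open>k\<close> factors from the others, whence
  the Markov property and the marginals.
\<close>

section \<open>Lehmer codes\<close>

text \<open>Nothing is assumed about rates or about regularity of transition probabilities, so
  uniqueness compares two processes directly instead of solving a forward equation. The Markov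
  property is given only for the whole permutation, whereas the flow argument concerns one
  coordinate; one-step errors are therefore carried from the coordinates to \<open>Sn n\<close> by
  independence before the cells are composed. Composition divides by the mass of the intermediate
  state, which is possible at positive times only: at time 0 all mass sits on the identity.

  For existence, smoothness is demanded at every sample point, while simultaneous jumps of two
  coordinates are excluded only almost surely; hence the process is moved to a space of good paths.
  The rates stay finite at time 0 although a state \<open>k > 0\<close> has mass zero there, because
  the flow out of \<open>{..k}\<close> vanishes to order \<open>k\<close> as well.\<close>

lemma Inv_eq_sum_Inv_j: "Inv n \<sigma> = (\<Sum>j\<in>{1..n}. Inv_j \<sigma> j)"
proof -
  have eq: "{(i, j). i \<in> {1..n} \<and> j \<in> {1..n} \<and> i < j \<and> \<sigma> i > \<sigma> j}
      = prod.swap ` (SIGMA j:{1..n}. {i \<in> {1..<j}. \<sigma> i > \<sigma> j})"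
    by (auto simp: image_def)
  show ?thesis
    unfolding Inv_def Inv_j_def eq
    by (subst card_image) (auto intro: inj_onI)
qed

lemma Inv_j_less: "1 \<le> j \<Longrightarrow> Inv_j \<sigma> j < j"
proof -
  assume j: "1 \<le> j"
  have "card {i \<in> {1..<j}. \<sigma> i > \<sigma> j} \<le> card {1..<j}"
    by (rule card_mono) auto
  with j show ?thesis by (simp add: Inv_j_def)
qed

text \<open>The factors are the weights of truncated geometric laws on \<open>{..<j}\<close>. Under
  the Mallows law the inversion counts are thus independent, and it is enough to realise each factor
  by a one-dimensional chain.\<close>

lemma mallows_prob_eq_prod:
  "mallows_prob n q \<sigma> = (\<Prod>j\<in>{1..n}. q ^ Inv_j \<sigma> j / (\<Sum>l<j. q ^ l))"
  by (simp add: mallows_prob_def mallows_Z_def Inv_eq_sum_Inv_j power_sum prod_dividef)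

lemma sum_powers_pos:
  fixes q :: real
  assumes "0 \<le> q" "1 \<le> j"
  shows "0 < (\<Sum>l<j. q ^ l)"
proof -
  have "q ^ 0 \<le> (\<Sum>l<j. q ^ l)"
    by (rule member_le_sum) (use assms in auto)
  then show ?thesis by simp
qed

text \<open>Strict positivity of \<open>q\<close> matters: at \<open>q = 0\<close> only permutations
  without inversions carry mass. This bound is what permits dividing by a state probability at
  positive times.\<close>

lemma mallows_prob_pos: "0 < q \<Longrightarrow> 0 < mallows_prob n q \<sigma>"
  unfolding mallows_prob_eq_prod
  by (intro prod_pos divide_pos_pos sum_powers_pos) auto

lemma finite_Sn: "finite (Sn n)"
  by (simp add: Sn_def finite_permutations)

text \<open>Induction on the length of the prefix. The count at \<open>Suc m\<close> tells how many
  earlier values lie above the new one, which fixes its place in the order of the prefix.\<close>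

lemma Inv_j_determines_order:
  assumes inj: "inj_on \<sigma> {1..n}" "inj_on \<tau> {1..n}"
    and eq: "\<And>j. j \<in> {1..n} \<Longrightarrow> Inv_j \<sigma> j = Inv_j \<tau> j"
  shows "m \<le> n \<Longrightarrow> \<forall>i\<in>{1..m}. \<forall>k\<in>{1..m}. \<sigma> i < \<sigma> k \<longleftrightarrow> \<tau> i < \<tau> k"
proof (induction m)
  case (Suc m)
  have IH: "\<sigma> i < \<sigma> k \<longleftrightarrow> \<tau> i < \<tau> k" if "i \<in> {1..m}" "k \<in> {1..m}" for i k
    using Suc that by auto
  let ?A = "{i \<in> {1..<Suc m}. \<sigma> i > \<sigma> (Suc m)}"
  let ?B = "{i \<in> {1..<Suc m}. \<tau> i > \<tau> (Suc m)}"
  have card: "card ?A = card ?B"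
    using eq[of "Suc m"] Suc.prems by (simp add: Inv_j_def)
  \<comment> \<open>Both sets are up-sets of the same linear order on \<open>{1..m}\<close>, and they have the same size.\<close>
  have AB: "?A = ?B"
  proof (rule ccontr)
    assume "?A \<noteq> ?B"
    moreover have "finite ?A" "finite ?B" by auto
    ultimately obtain a b where ab: "a \<in> ?A" "a \<notin> ?B" "b \<in> ?B" "b \<notin> ?A"
      using card by (metis (no_types, lifting) card_subset_eq subsetI)
    have "\<sigma> b < \<sigma> a" using ab by auto
    moreover have "\<tau> a < \<tau> b" using ab by auto
    ultimately show False using IH[of b a] ab by auto
  qed
  have last: "\<sigma> (Suc m) < \<sigma> i \<longleftrightarrow> \<tau> (Suc m) < \<tau> i" if "i \<in> {1..m}" for i
  proof -
    have "i \<in> ?A \<longleftrightarrow> i \<in> ?B" by (simp only: AB)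
    then show ?thesis using that by simp
  qed
  have last': "\<sigma> i < \<sigma> (Suc m) \<longleftrightarrow> \<tau> i < \<tau> (Suc m)" if "i \<in> {1..m}" for i
  proof -
    have "\<sigma> i \<noteq> \<sigma> (Suc m)" "\<tau> i \<noteq> \<tau> (Suc m)"
      using inj that Suc.prems by (auto dest: inj_onD[of _ _ i "Suc m"])
    then show ?thesis using last[OF that] by linarith
  qed
  show ?case
  proof (intro ballI)
    fix i k assume "i \<in> {1..Suc m}" "k \<in> {1..Suc m}"
    then consider "i \<in> {1..m}" "k \<in> {1..m}" | "i = Suc m" "k \<in> {1..m}" | "i \<in> {1..m}" "k = Suc m"
      | "i = Suc m" "k = Suc m" by fastforce
    then show "\<sigma> i < \<sigma> k \<longleftrightarrow> \<tau> i < \<tau> k"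
      by cases (use IH last last' in simp_all)
  qed
qed auto

lemma Inv_j_inject:
  assumes "\<sigma> \<in> Sn n" "\<tau> \<in> Sn n" "\<And>j. j \<in> {1..n} \<Longrightarrow> Inv_j \<sigma> j = Inv_j \<tau> j"
  shows "\<sigma> = \<tau>"
proof
  fix i
  have perm: "\<sigma> permutes {1..n}" "\<tau> permutes {1..n}" using assms by (auto simp: Sn_def)
  have inj: "inj_on \<sigma> {1..n}" "inj_on \<tau> {1..n}"
    using perm by (auto intro: permutes_inj_on)
  have order: "\<sigma> a < \<sigma> b \<longleftrightarrow> \<tau> a < \<tau> b" if "a \<in> {1..n}" "b \<in> {1..n}" for a b
    using Inv_j_determines_order[OF inj assms(3), of n] that by blast
  \<comment> \<open>A permutation of \<open>{1..n}\<close> takes every smaller value exactly once,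
    so the relative order alone recovers each value.\<close>
  have count: "\<rho> a = Suc (card {k\<in>{1..n}. \<rho> k < \<rho> a})" if "\<rho> permutes {1..n}" "a \<in> {1..n}" for \<rho> a
  proof -
    have le: "\<rho> a \<le> n" using permutes_in_image[OF that(1)] that(2) by auto
    have "\<rho> ` {k\<in>{1..n}. \<rho> k < \<rho> a} = \<rho> ` {1..n} \<inter> {..<\<rho> a}" by blast
    also have "\<dots> = {1..<\<rho> a}" using permutes_image[OF that(1)] le by auto
    finally have "\<rho> ` {k\<in>{1..n}. \<rho> k < \<rho> a} = {1..<\<rho> a}" .
    moreover have "inj_on \<rho> {k\<in>{1..n}. \<rho> k < \<rho> a}"
      using permutes_inj_on[OF that(1)] by (rule inj_on_subset) auto
    ultimately have "card {k\<in>{1..n}. \<rho> k < \<rho> a} = card {1..<\<rho> a}"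
      by (metis card_image)
    moreover have "1 \<le> \<rho> a" using permutes_in_image[OF that(1)] that(2) by auto
    ultimately show ?thesis by simp
  qed
  show "\<sigma> i = \<tau> i"
  proof (cases "i \<in> {1..n}")
    case True
    have "{k\<in>{1..n}. \<sigma> k < \<sigma> i} = {k\<in>{1..n}. \<tau> k < \<tau> i}"
      using order True by blast
    then show ?thesis using count[OF perm(1) True] count[OF perm(2) True] by simp
  next
    case False
    then show ?thesis using perm by (simp add: permutes_not_in)
  qed
qed

text \<open>Surjectivity by counting: the code is injective, and there are \<open>fact n\<close>
  permutations as well as \<open>fact n\<close> admissible codes.\<close>

lemma ex_Inv_j:
  assumes "\<And>j. j \<in> {1..n} \<Longrightarrow> c j < j"
  shows "\<exists>\<sigma>\<in>Sn n. \<forall>j\<in>{1..n}. Inv_j \<sigma> j = c j"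
proof -
  let ?code = "\<lambda>\<sigma>. restrict (Inv_j \<sigma>) {1..n}"
  let ?C = "PiE {1..n} (\<lambda>j. {..<j})"
  have inj: "inj_on ?code (Sn n)"
    by (rule inj_onI, rule Inv_j_inject) (auto simp: fun_eq_iff restrict_def split: if_splits)
  have "?code ` Sn n = ?C"
  proof (rule card_subset_eq)
    show "finite ?C" by (intro finite_PiE) auto
    show "?code ` Sn n \<subseteq> ?C" using Inv_j_less by auto
    have "card (?code ` Sn n) = card (Sn n)" by (rule card_image[OF inj])
    also have "\<dots> = fact n" unfolding Sn_def by (subst card_permutations[OF refl]) auto
    also have "\<dots> = card ?C" by (simp add: card_PiE fact_prod)
    finally show "card (?code ` Sn n) = card ?C" .
  qed
  moreover have "restrict c {1..n} \<in> ?C" using assms by auto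
  ultimately have "restrict c {1..n} \<in> ?code ` Sn n" by (simp only:)
  then obtain \<sigma> where \<sigma>: "\<sigma> \<in> Sn n" "restrict c {1..n} = ?code \<sigma>" by (elim imageE)
  have "Inv_j \<sigma> j = c j" if "j \<in> {1..n}" for j
    using fun_cong[OF \<sigma>(2), of j] that by simp
  with \<sigma>(1) show ?thesis by blast
qed

section \<open>Uniqueness\<close>

lemma left_lim_eqI:
  assumes "0 < e" "\<And>s. s \<in> {t - e<..<t} \<Longrightarrow> f s = y"
  shows "left_lim f t = y"
  unfolding left_lim_def
proof (rule the_equality)
  show "\<exists>e>0. \<forall>s\<in>{t - e<..<t}. f s = y" using assms by blast
next
  fix z assume "\<exists>e>0. \<forall>s\<in>{t - e<..<t}. f s = z"
  then obtain d where d: "0 < d" "\<forall>s\<in>{t - d<..<t}. f s = z" by blast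
  define u where "u = t - min d e / 2"
  have "u \<in> {t - d<..<t}" "u \<in> {t - e<..<t}"
    using d(1) assms(1) by (auto simp: u_def min_def field_simps)
  then show "z = y" using d(2) assms(2) by metis
qed

text \<open>Near \<open>r\<close> the path takes at most two values, the left limit before
  \<open>r\<close> and \<open>f r\<close> from \<open>r\<close> on, so a pair \<open>u < v\<close>
  sees at most the one jump at \<open>r\<close>. At \<open>r = 0\<close> the constraint
  \<open>0 \<le> u\<close> leaves only the right neighbourhood.\<close>

lemma cadlag_unit_jumps_local:
  fixes f :: "real \<Rightarrow> 'b" and h :: "'b \<Rightarrow> nat"
  assumes cadlag: "cadlag_discrete f" and jumps: "\<And>t. 0 < t \<Longrightarrow> h (f t) \<le> h (left_lim f t) + 1"
    and r: "0 \<le> r"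
  shows "\<exists>e>0. \<forall>u v. 0 \<le> u \<and> u < v \<and> u \<in> ball r e \<and> v \<in> ball r e \<longrightarrow> h (f v) \<le> h (f u) + 1"
proof -
  obtain e where e: "0 < e" "\<And>s. s \<in> {r..<r+e} \<Longrightarrow> f s = f r"
    using cadlag r unfolding cadlag_discrete_def by blast
  show ?thesis
  proof (cases "r = 0")
    case True
    show ?thesis
    proof (intro exI[of _ e] conjI allI impI e(1))
      fix u v assume uv: "0 \<le> u \<and> u < v \<and> u \<in> ball r e \<and> v \<in> ball r e"
      then have "f u = f r" "f v = f r"
        using True by (intro e(2); simp add: dist_real_def)+
      then show "h (f v) \<le> h (f u) + 1" by simp
    qed
  next
    case False
    then have "0 < r" using r by simp
    then have "\<exists>y. \<exists>d>0. \<forall>s\<in>{r - d<..<r}. f s = y"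
      using cadlag by (simp add: cadlag_discrete_def)
    then obtain y d where d: "0 < d" "\<And>s. s \<in> {r - d<..<r} \<Longrightarrow> f s = y"
      by blast
    have jump: "h (f r) \<le> h y + 1"
      using jumps[OF \<open>0 < r\<close>] left_lim_eqI[OF d] by simp
    show ?thesis
    proof (intro exI[of _ "min d e"] conjI allI impI)
      show "0 < min d e" using d e by simp
      fix u v assume uv: "0 \<le> u \<and> u < v \<and> u \<in> ball r (min d e) \<and> v \<in> ball r (min d e)"
      have l: "f w = y" if "w < r" "w \<in> ball r (min d e)" for w
        using that by (intro d(2)) (simp add: dist_real_def)
      have g: "f w = f r" if "r \<le> w" "w \<in> ball r (min d e)" for w
        using that by (intro e(2)) (simp add: dist_real_def)
      show "h (f v) \<le> h (f u) + 1"
        using l[of u] l[of v] g[of u] g[of v] uv jump by (cases "u < r"; cases "v < r") auto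
    qed
  qed
qed

text \<open>Compactness: \<open>Heine_Borel_lemma\<close> supplies a Lebesgue number for the cover
  of \<open>{s..t}\<close> by the balls of the local statement, and two times closer than that lie
  in a common ball. The number depends on the path.\<close>

lemma cadlag_unit_jumps_uniform:
  fixes f :: "real \<Rightarrow> 'b" and h :: "'b \<Rightarrow> nat"
  assumes cadlag: "cadlag_discrete f" and jumps: "\<And>t. 0 < t \<Longrightarrow> h (f t) \<le> h (left_lim f t) + 1"
    and s: "0 \<le> s"
  shows "\<exists>\<delta>>0. \<forall>u v. s \<le> u \<and> u < v \<and> v \<le> t \<and> v - u < \<delta> \<longrightarrow> h (f v) \<le> h (f u) + 1"
proof -
  have "\<forall>r\<in>{s..t}. \<exists>e>0. \<forall>u v. 0 \<le> u \<and> u < v \<and> u \<in> ball r e \<and> v \<in> ball r e \<longrightarrow> h (f v) \<le> h (f u) + 1"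
    using cadlag_unit_jumps_local[OF cadlag jumps] s by auto
  then obtain e where e: "\<And>r. r \<in> {s..t} \<Longrightarrow> 0 < e r"
    "\<And>r u v. \<lbrakk>r \<in> {s..t}; 0 \<le> u; u < v; u \<in> ball r (e r); v \<in> ball r (e r)\<rbrakk> \<Longrightarrow> h (f v) \<le> h (f u) + 1"
    by metis
  obtain \<delta> where \<delta>: "0 < \<delta>" "\<And>x. x \<in> {s..t} \<Longrightarrow> \<exists>G\<in>(\<lambda>r. ball r (e r)) ` {s..t}. ball x \<delta> \<subseteq> G"
  proof (rule Heine_Borel_lemma[of "{s..t}" "(\<lambda>r. ball r (e r)) ` {s..t}"])
    show "{s..t} \<subseteq> \<Union> ((\<lambda>r. ball r (e r)) ` {s..t})" using e(1) by force
  qed auto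
  show ?thesis
  proof (intro exI[of _ \<delta>] conjI allI impI \<delta>(1))
    fix u v assume uv: "s \<le> u \<and> u < v \<and> v \<le> t \<and> v - u < \<delta>"
    then obtain r where r: "r \<in> {s..t}" "ball u \<delta> \<subseteq> ball r (e r)" using \<delta>(2)[of u] by auto
    have "u \<in> ball r (e r)" "v \<in> ball r (e r)"
      using uv \<delta>(1) by (intro subsetD[OF r(2)]; simp add: dist_real_def)+
    then show "h (f v) \<le> h (f u) + 1" using e(2)[of r u v] r(1) uv s by simp
  qed
qed

section \<open>Two-time laws of a single regular process\<close>

locale regular_mallows =
  fixes n :: nat and M :: "'a measure" and X :: "real \<Rightarrow> 'a \<Rightarrow> nat \<Rightarrow> nat"
  assumes regular: "regular_mallows_markov n M X"
begin

sublocale prob_space M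
  using regular by (simp add: regular_mallows_markov_def perm_process_def)

lemma X_measurable: "0 \<le> t \<Longrightarrow> X t \<in> measurable M (count_space (Sn n))"
  using regular by (simp add: regular_mallows_markov_def perm_process_def)

lemma X_in_Sn: "0 \<le> t \<Longrightarrow> \<omega> \<in> space M \<Longrightarrow> X t \<omega> \<in> Sn n"
  using measurable_space[OF X_measurable] by simp

lemma X_measurable_UNIV[measurable]: "0 \<le> t \<Longrightarrow> X t \<in> measurable M (count_space UNIV)"
  using measurable_compose[OF X_measurable, of t "\<lambda>x. x" "count_space UNIV"] by simp

lemma Inv_mono:
  assumes "0 \<le> s" "s < t" "\<omega> \<in> space M"
  shows "j \<in> {1..n} \<Longrightarrow> Inv_j (X s \<omega>) j \<le> Inv_j (X t \<omega>) j"
    and "Inv n (X s \<omega>) \<le> Inv n (X t \<omega>)"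
proof -
  show *: "Inv_j (X s \<omega>) j \<le> Inv_j (X t \<omega>) j" if "j \<in> {1..n}" for j
    using regular assms that
    by (auto simp: regular_mallows_markov_def regular_process_def smooth_process_def strongly_monotone_def)
  show "Inv n (X s \<omega>) \<le> Inv n (X t \<omega>)"
    unfolding Inv_eq_sum_Inv_j by (rule sum_mono) (rule *)
qed

text \<open>The other coordinates do not decrease, so a coordinate grows at most as much as the
  total. Smoothness, which speaks of the total only, thereby controls every single
  coordinate.\<close>

lemma Inv_jump:
  assumes "0 \<le> s" "s < t" "\<omega> \<in> space M" "j \<in> {1..n}"
  shows "Inv_j (X t \<omega>) j + Inv n (X s \<omega>) \<le> Inv_j (X s \<omega>) j + Inv n (X t \<omega>)"
proof -
  have "(\<Sum>i\<in>{1..n}-{j}. Inv_j (X s \<omega>) i) \<le> (\<Sum>i\<in>{1..n}-{j}. Inv_j (X t \<omega>) i)"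
    by (rule sum_mono) (use Inv_mono(1)[OF assms(1-3)] in auto)
  then show ?thesis
    unfolding Inv_eq_sum_Inv_j using assms(4) by (simp add: sum.remove[of _ j])
qed

lemma events_two_times:
  assumes "0 \<le> s" "0 \<le> t"
  shows "{\<omega>\<in>space M. P (X s \<omega>) (X t \<omega>)} \<in> events"
proof -
  have "{\<omega>\<in>space M. P (X s \<omega>) (X t \<omega>)}
      = (\<Union>x\<in>Sn n. \<Union>y\<in>{y\<in>Sn n. P x y}. {\<omega>\<in>space M. X s \<omega> = x \<and> X t \<omega> = y})"
    using X_in_Sn assms by auto
  also have "\<dots> \<in> events"
    using finite_Sn assms by (intro sets.finite_UN) auto
  finally show ?thesis .
qed

lemma prob_one_time:
  assumes "0 \<le> t"
  shows "prob {\<omega>\<in>space M. P (X t \<omega>)} = (\<Sum>\<sigma>\<in>{\<sigma>\<in>Sn n. P \<sigma>}. mallows_prob n t \<sigma>)"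
proof -
  have "{\<omega>\<in>space M. P (X t \<omega>)} = (\<Union>\<sigma>\<in>{\<sigma>\<in>Sn n. P \<sigma>}. {\<omega>\<in>space M. X t \<omega> = \<sigma>})"
    using X_in_Sn[OF assms] by auto
  also have "prob \<dots> = (\<Sum>\<sigma>\<in>{\<sigma>\<in>Sn n. P \<sigma>}. prob {\<omega>\<in>space M. X t \<omega> = \<sigma>})"
    using finite_Sn assms by (intro finite_measure_finite_Union) (auto simp: disjoint_family_on_def)
  also have "\<dots> = (\<Sum>\<sigma>\<in>{\<sigma>\<in>Sn n. P \<sigma>}. mallows_prob n t \<sigma>)"
    using regular assms by (intro sum.cong) (auto simp: regular_mallows_markov_def mallows_process_def)
  finally show ?thesis .
qed

definition two_time :: "real \<Rightarrow> real \<Rightarrow> (nat \<Rightarrow> nat) \<Rightarrow> (nat \<Rightarrow> nat) \<Rightarrow> real" where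
  "two_time s t x y = prob {\<omega>\<in>space M. X s \<omega> = x \<and> X t \<omega> = y}"

definition two_time_j :: "nat \<Rightarrow> real \<Rightarrow> real \<Rightarrow> nat \<Rightarrow> nat \<Rightarrow> real" where
  "two_time_j j s t a b = prob {\<omega>\<in>space M. Inv_j (X s \<omega>) j = a \<and> Inv_j (X t \<omega>) j = b}"

definition multi_jump :: "real \<Rightarrow> real \<Rightarrow> real" where
  "multi_jump s t = prob {\<omega>\<in>space M. Inv n (X s \<omega>) + 2 \<le> Inv n (X t \<omega>)}"

text \<open>This is the bridge between the flow estimate, which concerns single coordinates, and the
  Chapman--Kolmogorov equation, which lives on \<open>Sn n\<close>.\<close>

lemma two_time_eq_prod:
  assumes st: "0 \<le> s" "0 \<le> t" and xy: "x \<in> Sn n" "y \<in> Sn n"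
  shows "two_time s t x y = (\<Prod>j\<in>{1..n}. two_time_j j s t (Inv_j x j) (Inv_j y j))"
proof (cases "n = 0")
  \<comment> \<open>Without coordinates the intersection over \<open>{1..n}\<close> would be the
    whole universe; here \<open>Sn n\<close> has a single element instead.\<close>
  case True
  then have "X s \<omega> = x \<and> X t \<omega> = y" if "\<omega> \<in> space M" for \<omega>
    using X_in_Sn[OF st(1) that] X_in_Sn[OF st(2) that] xy by (simp add: Sn_def)
  then have "{\<omega>\<in>space M. X s \<omega> = x \<and> X t \<omega> = y} = space M" by auto
  then show ?thesis using True by (simp add: two_time_def prob_space)
next
  case False
  let ?M = "PiM {0::real..} (\<lambda>_. count_space (UNIV :: nat set))"
  let ?Y = "\<lambda>j \<omega>. restrict (\<lambda>t. Inv_j (X t \<omega>) j) {0..}"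
  let ?A = "\<lambda>j. {f \<in> space ?M. f s = Inv_j x j \<and> f t = Inv_j y j}"
  have indep: "indep_vars (\<lambda>_. ?M) ?Y {1..n}"
    using regular by (simp add: regular_mallows_markov_def regular_process_def independent_inversions_def)
  have A: "?A j \<in> sets ?M" for j
  proof -
    have [measurable]: "(\<lambda>f. f s) \<in> measurable ?M (count_space UNIV)" "(\<lambda>f. f t) \<in> measurable ?M (count_space UNIV)"
      using st by (auto intro!: measurable_component_singleton)
    show ?thesis by measurable
  qed
  have pre: "?Y j -` ?A j \<inter> space M = {\<omega>\<in>space M. Inv_j (X s \<omega>) j = Inv_j x j \<and> Inv_j (X t \<omega>) j = Inv_j y j}" for j
    using st by (auto simp: space_PiM)
  have "{\<omega>\<in>space M. X s \<omega> = x \<and> X t \<omega> = y} = (\<Inter>j\<in>{1..n}. ?Y j -` ?A j \<inter> space M)"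
    unfolding pre
  proof (intro set_eqI iffI)
    fix \<omega> assume "\<omega> \<in> (\<Inter>j\<in>{1..n}. {\<omega>\<in>space M. Inv_j (X s \<omega>) j = Inv_j x j \<and> Inv_j (X t \<omega>) j = Inv_j y j})"
    then have \<omega>: "\<omega> \<in> space M" "\<And>j. j \<in> {1..n} \<Longrightarrow> Inv_j (X s \<omega>) j = Inv_j x j"
      "\<And>j. j \<in> {1..n} \<Longrightarrow> Inv_j (X t \<omega>) j = Inv_j y j"
      using False by force+
    have "X s \<omega> = x" "X t \<omega> = y"
      using Inv_j_inject[OF X_in_Sn[OF st(1) \<omega>(1)] xy(1) \<omega>(2)] Inv_j_inject[OF X_in_Sn[OF st(2) \<omega>(1)] xy(2) \<omega>(3)]
      by auto
    with \<omega> show "\<omega> \<in> {\<omega>\<in>space M. X s \<omega> = x \<and> X t \<omega> = y}" by simp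
  qed auto
  moreover have "prob (\<Inter>j\<in>{1..n}. ?Y j -` ?A j \<inter> space M) = (\<Prod>j\<in>{1..n}. prob (?Y j -` ?A j \<inter> space M))"
    using A False by (intro indep_varsD[OF indep]) auto
  ultimately show ?thesis
    unfolding two_time_def two_time_j_def pre by simp
qed

lemma prob_split:
  assumes "{\<omega>\<in>space M. P \<omega>} \<in> events" "{\<omega>\<in>space M. Q \<omega>} \<in> events"
  shows "prob {\<omega>\<in>space M. P \<omega>} = prob {\<omega>\<in>space M. P \<omega> \<and> Q \<omega>} + prob {\<omega>\<in>space M. P \<omega> \<and> \<not> Q \<omega>}"
proof -
  have "{\<omega>\<in>space M. P \<omega>} = {\<omega>\<in>space M. P \<omega> \<and> Q \<omega>} \<union> {\<omega>\<in>space M. P \<omega> \<and> \<not> Q \<omega>}" by auto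
  moreover have "{\<omega>\<in>space M. P \<omega> \<and> Q \<omega>} \<in> events" "{\<omega>\<in>space M. P \<omega> \<and> \<not> Q \<omega>} \<in> events"
    using assms by (auto intro: sets.sets_Collect)
  ultimately show ?thesis by (metis (no_types, lifting) finite_measure_Union disjoint_iff mem_Collect_eq)
qed

text \<open>Here \<open>f\<close> is the flow out of \<open>{..a}\<close>. The body mentions neither
  \<open>M\<close> nor \<open>X\<close>, so two processes are compared with one and the same
  number.\<close>

definition two_time_approx :: "nat \<Rightarrow> real \<Rightarrow> real \<Rightarrow> nat \<Rightarrow> nat \<Rightarrow> real" where
  "two_time_approx j s t a b =
    (let p = (\<lambda>u P. \<Sum>\<sigma>\<in>{\<sigma>\<in>Sn n. P (Inv_j \<sigma> j)}. mallows_prob n u \<sigma>);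
         f = p s (\<lambda>c. c \<le> a) - p t (\<lambda>c. c \<le> a)
     in if b = a then p s (\<lambda>c. c = a) - f else if b = Suc a then f else 0)"

text \<open>By monotonicity the flow \<open>P(I\<^sub>s \<le> a) - P(I\<^sub>t \<le> a)\<close> out of \<open>{..a}\<close>
  is \<open>P(I\<^sub>s \<le> a < I\<^sub>t)\<close>; up to multiple jumps it is the mass moving from \<open>a\<close> to \<open>a + 1\<close>.\<close>
lemma two_time_j_approx:
  assumes st: "0 \<le> s" "s < t" and j: "j \<in> {1..n}"
  shows "\<bar>two_time_j j s t a b - two_time_approx j s t a b\<bar> \<le> 2 * multi_jump s t"
proof -
  have t: "0 \<le> t" using st by simp
  define I where "I u \<omega> = Inv_j (X u \<omega>) j" for u \<omega>
  note [simp] = st(1) t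
  have [measurable]: "I s \<in> measurable M (count_space UNIV)" "I t \<in> measurable M (count_space UNIV)"
    unfolding I_def by (rule measurable_compose[OF X_measurable_UNIV, where g="\<lambda>x. Inv_j x j"]; simp)+
  have mono: "I s \<omega> \<le> I t \<omega>" if "\<omega> \<in> space M" for \<omega>
    using Inv_mono(1)[OF st that j] by (simp add: I_def)
  have jump: "prob {\<omega>\<in>space M. Q (I s \<omega>) (I t \<omega>)} \<le> multi_jump s t"
    if "\<And>c d. Q c d \<Longrightarrow> c + 2 \<le> d" for Q
    unfolding multi_jump_def
  proof (rule finite_measure_mono)
    show "{\<omega>\<in>space M. Q (I s \<omega>) (I t \<omega>)} \<subseteq> {\<omega>\<in>space M. Inv n (X s \<omega>) + 2 \<le> Inv n (X t \<omega>)}"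
    proof safe
      fix \<omega> assume "\<omega> \<in> space M" "Q (I s \<omega>) (I t \<omega>)"
      then show "Inv n (X s \<omega>) + 2 \<le> Inv n (X t \<omega>)"
        using that[of "I s \<omega>" "I t \<omega>"] Inv_jump[OF st _ j, of \<omega>] by (simp add: I_def)
    qed
    show "{\<omega>\<in>space M. Inv n (X s \<omega>) + 2 \<le> Inv n (X t \<omega>)} \<in> events"
      by (rule events_two_times) simp_all
  qed
  have nonneg: "0 \<le> multi_jump s t" by (simp add: multi_jump_def)
  define p where "p u P = (\<Sum>\<sigma>\<in>{\<sigma>\<in>Sn n. P (Inv_j \<sigma> j)}. mallows_prob n u \<sigma>)" for u P
  have p: "p s P = prob {\<omega>\<in>space M. P (I s \<omega>)}" "p t P = prob {\<omega>\<in>space M. P (I t \<omega>)}" for P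
    using prob_one_time[of s "\<lambda>\<sigma>. P (Inv_j \<sigma> j)"] prob_one_time[of t "\<lambda>\<sigma>. P (Inv_j \<sigma> j)"]
    by (simp_all add: I_def p_def)
  define f where "f = p s (\<lambda>c. c \<le> a) - p t (\<lambda>c. c \<le> a)"
  \<comment> \<open>The two error terms: crossings of \<open>a\<close> that start strictly below it,
    and departures from \<open>a\<close> that skip \<open>Suc a\<close>. Both need an increase of at
    least two. The flow counts both in addition to the unit step, whence the factor 2.\<close>
  define d1 where "d1 = prob {\<omega>\<in>space M. I s \<omega> < a \<and> a < I t \<omega>}"
  define d2 where "d2 = prob {\<omega>\<in>space M. I s \<omega> = a \<and> Suc a < I t \<omega>}"
  have d1: "0 \<le> d1" "d1 \<le> multi_jump s t" unfolding d1_def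
    by simp (rule jump[of "\<lambda>c d. c < a \<and> a < d"], simp)
  have d2: "0 \<le> d2" "d2 \<le> multi_jump s t" unfolding d2_def
    by simp (rule jump[of "\<lambda>c d. c = a \<and> Suc a < d"], simp)
  have stay: "two_time_j j s t a a = p s (\<lambda>c. c = a) - f + d1"
  proof -
    have "p s (\<lambda>c. c = a) = two_time_j j s t a a + prob {\<omega>\<in>space M. I s \<omega> = a \<and> I t \<omega> \<noteq> a}"
      unfolding p two_time_j_def I_def[symmetric] by (rule prob_split) measurable
    also have "{\<omega>\<in>space M. I s \<omega> = a \<and> I t \<omega> \<noteq> a} = {\<omega>\<in>space M. (I s \<omega> \<le> a \<and> a < I t \<omega>) \<and> \<not> I s \<omega> < a}"
      using mono by fastforce
    also have "prob {\<omega>\<in>space M. (I s \<omega> \<le> a \<and> a < I t \<omega>) \<and> \<not> I s \<omega> < a}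
        = prob {\<omega>\<in>space M. I s \<omega> \<le> a \<and> a < I t \<omega>} - prob {\<omega>\<in>space M. (I s \<omega> \<le> a \<and> a < I t \<omega>) \<and> I s \<omega> < a}"
      by (subst prob_split[of "\<lambda>\<omega>. I s \<omega> \<le> a \<and> a < I t \<omega>" "\<lambda>\<omega>. I s \<omega> < a"]) auto
    also have "{\<omega>\<in>space M. (I s \<omega> \<le> a \<and> a < I t \<omega>) \<and> I s \<omega> < a} = {\<omega>\<in>space M. I s \<omega> < a \<and> a < I t \<omega>}" by auto
    also have "prob {\<omega>\<in>space M. I s \<omega> \<le> a \<and> a < I t \<omega>} = f"
    proof -
      have "p s (\<lambda>c. c \<le> a) = prob {\<omega>\<in>space M. I s \<omega> \<le> a \<and> I t \<omega> \<le> a} + prob {\<omega>\<in>space M. I s \<omega> \<le> a \<and> \<not> I t \<omega> \<le> a}"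
        unfolding p by (rule prob_split) measurable
      also have "{\<omega>\<in>space M. I s \<omega> \<le> a \<and> I t \<omega> \<le> a} = {\<omega>\<in>space M. I t \<omega> \<le> a}"
        using mono order_trans by blast
      finally show ?thesis by (simp add: f_def p not_le)
    qed
    finally show ?thesis by (simp add: d1_def)
  qed
  have step: "two_time_j j s t a (Suc a) = f - d1 - d2"
  proof -
    have "p s (\<lambda>c. c = a) = two_time_j j s t a a + prob {\<omega>\<in>space M. I s \<omega> = a \<and> I t \<omega> \<noteq> a}"
      unfolding p two_time_j_def I_def[symmetric] by (rule prob_split) measurable
    also have "prob {\<omega>\<in>space M. I s \<omega> = a \<and> I t \<omega> \<noteq> a} = prob {\<omega>\<in>space M. (I s \<omega> = a \<and> I t \<omega> \<noteq> a) \<and> I t \<omega> = Suc a}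
        + prob {\<omega>\<in>space M. (I s \<omega> = a \<and> I t \<omega> \<noteq> a) \<and> I t \<omega> \<noteq> Suc a}"
      by (rule prob_split) measurable
    also have "{\<omega>\<in>space M. (I s \<omega> = a \<and> I t \<omega> \<noteq> a) \<and> I t \<omega> = Suc a} = {\<omega>\<in>space M. I s \<omega> = a \<and> I t \<omega> = Suc a}"
      by auto
    also have "{\<omega>\<in>space M. (I s \<omega> = a \<and> I t \<omega> \<noteq> a) \<and> I t \<omega> \<noteq> Suc a} = {\<omega>\<in>space M. I s \<omega> = a \<and> Suc a < I t \<omega>}"
      using mono by fastforce
    finally show ?thesis
      using stay unfolding d2_def two_time_j_def I_def[symmetric] by simp
  qed
  have approx: "two_time_approx j s t a b = (if b = a then p s (\<lambda>c. c = a) - f else if b = Suc a then f else 0)"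
    by (simp add: two_time_approx_def p_def f_def Let_def)
  consider "b = a" | "b = Suc a" | "b < a" | "Suc a < b" by linarith
  then show ?thesis
  proof cases
    case 1
    then show ?thesis unfolding approx using stay d1 by simp
  next
    case 2
    then show ?thesis unfolding approx using step d1 d2 by simp
  next
    case 3
    then have "{\<omega>\<in>space M. I s \<omega> = a \<and> I t \<omega> = b} = {}" using mono by fastforce
    then have "two_time_j j s t a b = 0"
      unfolding two_time_j_def I_def[symmetric] by (simp only: measure_empty)
    with 3 nonneg show ?thesis unfolding approx by simp
  next
    case 4
    then have "two_time_j j s t a b \<le> multi_jump s t"
      unfolding two_time_j_def I_def[symmetric] by (intro jump) auto
    moreover have "0 \<le> two_time_j j s t a b" by (simp add: two_time_j_def)
    ultimately show ?thesis using 4 nonneg unfolding approx by simp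
  qed
qed

text \<open>The sum is the expectation of \<open>Z N\<close>, the number of cells on which the
  inversion number grows by at least two. For each path \<open>Z N\<close> is eventually 0, but from
  an index that depends on the path. Telescoping bounds \<open>Z N\<close> by the maximal inversion
  number \<open>K\<close>, so dominated convergence applies.\<close>

lemma multi_jump_sum_tendsto_0:
  assumes st: "0 \<le> s" "s < t"
  defines "u \<equiv> \<lambda>N k. s + (t - s) * real k / real (Suc N)"
  shows "(\<lambda>N. \<Sum>k<Suc N. multi_jump (u N k) (u N (Suc k))) \<longlonglongrightarrow> 0"
proof -
  have u_nonneg: "0 \<le> u N k" for N k using st by (simp add: u_def)
  have u_less: "u N k < u N (Suc k)" for N k
    unfolding u_def using st by (intro add_strict_left_mono divide_strict_right_mono mult_strict_left_mono) auto
  have u_diff: "u N (Suc k) - u N k = (t - s) / real (Suc N)" for N k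
    by (simp add: u_def diff_divide_distrib[symmetric] algebra_simps)
  have u_ge: "s \<le> u N k" for N k using st by (simp add: u_def)
  have u_end: "u N 0 = s" "u N (Suc N) = t" for N by (simp_all add: u_def)
  have u_le: "u N k \<le> t" if "k \<le> Suc N" for N k
  proof -
    have "(t - s) * real k / real (Suc N) \<le> (t - s) * real (Suc N) / real (Suc N)"
      using st that by (intro divide_right_mono mult_left_mono) auto
    then show ?thesis by (simp add: u_def)
  qed
  define A where "A N k = {\<omega>\<in>space M. Inv n (X (u N k) \<omega>) + 2 \<le> Inv n (X (u N (Suc k)) \<omega>)}" for N k
  have [measurable]: "A N k \<in> events" for N k
    unfolding A_def by (intro events_two_times u_nonneg)
  define Z where "Z N \<omega> = (\<Sum>k<Suc N. indicator (A N k) \<omega> :: real)" for N \<omega>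
  define K where "K = Max (Inv n ` Sn n)"
  have Z_le: "Z N \<omega> \<le> real K" if "\<omega> \<in> space M" for N \<omega>
  proof -
    have "Z N \<omega> \<le> (\<Sum>k<Suc N. real (Inv n (X (u N (Suc k)) \<omega>)) - real (Inv n (X (u N k) \<omega>)))"
      unfolding Z_def
    proof (rule sum_mono)
      fix k
      show "indicator (A N k) \<omega> \<le> real (Inv n (X (u N (Suc k)) \<omega>)) - real (Inv n (X (u N k) \<omega>))"
        using Inv_mono(2)[OF u_nonneg u_less that, of N k] by (cases "\<omega> \<in> A N k") (simp_all add: A_def)
    qed
    also have "\<dots> = real (Inv n (X (u N (Suc N)) \<omega>)) - real (Inv n (X (u N 0) \<omega>))"
      by (rule sum_lessThan_telescope)
    also have "\<dots> \<le> real (Inv n (X t \<omega>))" by (simp add: u_end)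
    also have "\<dots> \<le> real K"
      unfolding K_def using X_in_Sn[of t \<omega>] st that finite_Sn by (intro of_nat_mono Max_ge) auto
    finally show ?thesis .
  qed
  have Z_nonneg: "0 \<le> Z N \<omega>" for N \<omega> by (simp add: Z_def sum_nonneg)
  have Z_lim: "(\<lambda>N. Z N \<omega>) \<longlonglongrightarrow> 0" if \<omega>: "\<omega> \<in> space M" for \<omega>
  proof -
    have "cadlag_discrete (\<lambda>t. X t \<omega>)"
      using regular \<omega> by (auto simp: regular_mallows_markov_def cadlag_process_def)
    moreover have "Inv n (X r \<omega>) \<le> Inv n (left_lim (\<lambda>t. X t \<omega>) r) + 1" if "0 < r" for r
      using regular \<omega> that by (auto simp: regular_mallows_markov_def regular_process_def smooth_process_def)
    ultimately obtain \<delta> where \<delta>: "0 < \<delta>"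
      "\<And>v w. s \<le> v \<Longrightarrow> v < w \<Longrightarrow> w \<le> t \<Longrightarrow> w - v < \<delta> \<Longrightarrow> Inv n (X w \<omega>) \<le> Inv n (X v \<omega>) + 1"
      using cadlag_unit_jumps_uniform[of "\<lambda>t. X t \<omega>" "Inv n" s t] st(1) by metis
    have "(\<lambda>N. (t - s) / real (Suc N)) \<longlonglongrightarrow> 0"
      by (intro tendsto_divide_0[OF tendsto_const] filterlim_compose[OF filterlim_at_top_imp_at_infinity filterlim_ident]
          filterlim_compose[OF filterlim_real_sequentially filterlim_Suc])
    then have "eventually (\<lambda>N. (t - s) / real (Suc N) < \<delta>) sequentially"
      using \<delta>(1) by (rule order_tendstoD)
    then have "eventually (\<lambda>N. Z N \<omega> = 0) sequentially"
    proof eventually_elim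
      case (elim N)
      have "\<omega> \<notin> A N k" if "k < Suc N" for k
        using \<delta>(2)[OF u_ge u_less u_le[of "Suc k" N]] elim that u_diff[of N k] by (auto simp: A_def)
      then show ?case by (auto simp: Z_def)
    qed
    then show ?thesis by (rule tendsto_eventually)
  qed
  have Z_meas[measurable]: "Z N \<in> borel_measurable M" for N unfolding Z_def by measurable
  have "(\<lambda>N. integral\<^sup>L M (Z N)) \<longlonglongrightarrow> integral\<^sup>L M (\<lambda>_. 0 :: real)"
    by (rule integral_dominated_convergence[where w="\<lambda>_. real K"])
      (use Z_lim Z_le Z_nonneg in auto)
  moreover have "integral\<^sup>L M (Z N) = (\<Sum>k<Suc N. multi_jump (u N k) (u N (Suc k)))" for N
    unfolding Z_def multi_jump_def A_def[symmetric] by (subst Bochner_Integration.integral_sum) (auto simp: less_top[symmetric])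
  ultimately show ?thesis by simp
qed

lemma two_time_nonneg: "0 \<le> two_time s t x y"
  by (simp add: two_time_def)

lemma two_time_le:
  assumes "0 \<le> s" "0 \<le> t" "y \<in> Sn n"
  shows "two_time s t x y \<le> mallows_prob n t y"
proof -
  have "two_time s t x y \<le> prob {\<omega>\<in>space M. X t \<omega> = y}"
    unfolding two_time_def using assms by (intro finite_measure_mono) auto
  also have "\<dots> = mallows_prob n t y"
    using regular assms by (auto simp: regular_mallows_markov_def mallows_process_def)
  finally show ?thesis .
qed

lemma sum_two_time:
  assumes "0 \<le> s" "0 \<le> t"
  shows "(\<Sum>y\<in>Sn n. two_time s t x y) = prob {\<omega>\<in>space M. X s \<omega> = x}"
proof -
  have "{\<omega>\<in>space M. X s \<omega> = x} = (\<Union>y\<in>Sn n. {\<omega>\<in>space M. X s \<omega> = x \<and> X t \<omega> = y})"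
    using X_in_Sn[OF assms(2)] by auto
  also have "prob \<dots> = (\<Sum>y\<in>Sn n. two_time s t x y)"
    unfolding two_time_def using finite_Sn assms
    by (intro finite_measure_finite_Union) (auto simp: disjoint_family_on_def)
  finally show ?thesis by simp
qed

lemma prob_eq_mallows:
  assumes "0 \<le> t"
  shows "prob {\<omega>\<in>space M. X t \<omega> = x} = (if x \<in> Sn n then mallows_prob n t x else 0)"
proof (cases "x \<in> Sn n")
  case True
  then show ?thesis
    using regular assms by (auto simp: regular_mallows_markov_def mallows_process_def)
next
  case False
  then have "{\<omega>\<in>space M. X t \<omega> = x} = {}" using X_in_Sn[OF assms] by auto
  then show ?thesis using False by (simp only: measure_empty if_False)
qed

lemma markov_step:
  assumes "0 \<le> ts 0" "\<And>i. i \<le> m \<Longrightarrow> ts i < ts (Suc i)"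
  shows "prob {\<omega>\<in>space M. \<forall>i\<le>Suc m. X (ts i) \<omega> = xs i} * prob {\<omega>\<in>space M. X (ts m) \<omega> = xs m}
    = prob {\<omega>\<in>space M. \<forall>i\<le>m. X (ts i) \<omega> = xs i} * two_time (ts m) (ts (Suc m)) (xs m) (xs (Suc m))"
proof -
  have "markov_process M X" using regular by (simp add: regular_mallows_markov_def)
  then show ?thesis
    unfolding markov_process_def two_time_def using assms by blast
qed

text \<open>The Markov property is a product identity for joint probabilities; solving it for the
  three-time probability divides by the mass at the middle time \<open>r\<close>. That mass is
  positive because \<open>s < r\<close>, even when \<open>s = 0\<close>.\<close>

lemma Chapman_Kolmogorov:
  assumes srt: "0 \<le> s" "s < r" "r < t"
  shows "two_time s t x z = (\<Sum>y\<in>Sn n. two_time s r x y * two_time r t y z / mallows_prob n r y)"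
proof -
  have rt: "0 < r" "0 \<le> r" "0 \<le> t" using srt by auto
  \<comment> \<open>The Markov property takes a sequence of times; with \<open>m = 1\<close> it
    reads the entries 0, 1 and 2 only.\<close>
  define ts where "ts i = (if i = 0 then s else if i = 1 then r else t)" for i :: nat
  have ex: "(\<forall>i\<le>Suc (Suc 0). P i) \<longleftrightarrow> P 0 \<and> P 1 \<and> P 2" "(\<forall>i\<le>Suc 0. P i) \<longleftrightarrow> P 0 \<and> P 1" for P :: "nat \<Rightarrow> bool"
    by (auto simp: le_Suc_eq numeral_2_eq_2)
  have "two_time s t x z = prob (\<Union>y\<in>Sn n. {\<omega>\<in>space M. X s \<omega> = x \<and> X r \<omega> = y \<and> X t \<omega> = z})"
    unfolding two_time_def using X_in_Sn[OF rt(2)] by (intro arg_cong[of _ _ prob]) auto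
  also have "\<dots> = (\<Sum>y\<in>Sn n. prob {\<omega>\<in>space M. X s \<omega> = x \<and> X r \<omega> = y \<and> X t \<omega> = z})"
    using finite_Sn srt rt by (intro finite_measure_finite_Union) (auto simp: disjoint_family_on_def)
  also have "\<dots> = (\<Sum>y\<in>Sn n. two_time s r x y * two_time r t y z / mallows_prob n r y)"
  proof (rule sum.cong[OF refl])
    fix y assume y: "y \<in> Sn n"
    have "prob {\<omega>\<in>space M. X s \<omega> = x \<and> X r \<omega> = y \<and> X t \<omega> = z} * mallows_prob n r y
        = two_time s r x y * two_time r t y z"
    proof -
      have "ts i < ts (Suc i)" if "i \<le> 1" for i
        using that srt by (auto simp: ts_def le_Suc_eq)
      then show ?thesis
        using markov_step[of ts 1 "\<lambda>i. if i = 0 then x else if i = 1 then y else z"] srt rt y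
        by (simp add: ex ts_def prob_eq_mallows two_time_def)
    qed
    then show "prob {\<omega>\<in>space M. X s \<omega> = x \<and> X r \<omega> = y \<and> X t \<omega> = z}
        = two_time s r x y * two_time r t y z / mallows_prob n r y"
      using mallows_prob_pos[OF rt(1), of n y] by (simp add: field_simps)
  qed
  finally show ?thesis .
qed

end

section \<open>Comparison of two regular processes\<close>

locale two_regular_mallows =
  A: regular_mallows n M X + B: regular_mallows n M' X'
  for n :: nat and M :: "'a measure" and X and M' :: "'b measure" and X'
begin

text \<open>Factors of modulus at most 1 make the difference of the products at most the sum of the
  differences. In each coordinate both processes lie close to the common
  \<open>two_time_approx\<close>.\<close>

lemma two_time_diff_le:
  assumes st: "0 \<le> s" "s < t" and xy: "x \<in> Sn n" "y \<in> Sn n"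
  shows "\<bar>A.two_time s t x y - B.two_time s t x y\<bar> \<le> 2 * real n * (A.multi_jump s t + B.multi_jump s t)"
proof -
  have "0 \<le> t" using st by simp
  have le1: "norm (A.two_time_j j s t a b) \<le> 1" "norm (B.two_time_j j s t a b) \<le> 1" for j a b
    by (simp_all add: A.two_time_j_def B.two_time_j_def)
  have "\<bar>A.two_time s t x y - B.two_time s t x y\<bar> \<le>
      (\<Sum>j\<in>{1..n}. norm (A.two_time_j j s t (Inv_j x j) (Inv_j y j) - B.two_time_j j s t (Inv_j x j) (Inv_j y j)))"
    unfolding A.two_time_eq_prod[OF st(1) \<open>0 \<le> t\<close> xy] B.two_time_eq_prod[OF st(1) \<open>0 \<le> t\<close> xy] real_norm_def[symmetric]
    by (rule norm_prod_diff) (rule le1)+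
  also have "\<dots> \<le> (\<Sum>j\<in>{1..n}. 2 * (A.multi_jump s t + B.multi_jump s t))"
  proof (rule sum_mono)
    fix j assume "j \<in> {1..n}"
    then show "norm (A.two_time_j j s t (Inv_j x j) (Inv_j y j) - B.two_time_j j s t (Inv_j x j) (Inv_j y j))
        \<le> 2 * (A.multi_jump s t + B.multi_jump s t)"
      using A.two_time_j_approx[OF st, of j "Inv_j x j" "Inv_j y j"] B.two_time_j_approx[OF st, of j "Inv_j x j" "Inv_j y j"]
      by (simp add: abs_le_iff)
  qed
  also have "\<dots> = 2 * real n * (A.multi_jump s t + B.multi_jump s t)" by simp
  finally show ?thesis .
qed

abbreviation dist_two_time :: "real \<Rightarrow> real \<Rightarrow> real" where
  "dist_two_time s t \<equiv> (\<Sum>x\<in>Sn n. \<Sum>y\<in>Sn n. \<bar>A.two_time s t x y - B.two_time s t x y\<bar>)"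

text \<open>Errors add and are not amplified. By \<open>alg\<close> the difference splits into the
  error before \<open>r\<close> times a transition probability, which sums to 1 over
  \<open>z\<close>, and a conditional probability, at most 1, times the error after
  \<open>r\<close>.\<close>

lemma two_time_diff_add:
  assumes srt: "0 \<le> s" "s < r" "r < t" and x: "x \<in> Sn n"
  shows "(\<Sum>z\<in>Sn n. \<bar>A.two_time s t x z - B.two_time s t x z\<bar>)
    \<le> (\<Sum>y\<in>Sn n. \<bar>A.two_time s r x y - B.two_time s r x y\<bar>) + dist_two_time r t"
proof -
  have rt: "0 < r" "0 \<le> r" "0 \<le> t" using srt by auto
  let ?d = "\<lambda>y. \<bar>A.two_time s r x y - B.two_time s r x y\<bar>"
  have pos: "0 < mallows_prob n r y" for y using rt(1) by (rule mallows_prob_pos)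
  have "\<bar>A.two_time s t x z - B.two_time s t x z\<bar>
      \<le> (\<Sum>y\<in>Sn n. ?d y * (A.two_time r t y z / mallows_prob n r y) + \<bar>A.two_time r t y z - B.two_time r t y z\<bar>)" for z
  proof -
    have alg: "a * k / m - b * l / m = (a - b) * (k / m) + b / m * (k - l)" for a b k l m :: real
      by (simp add: diff_divide_distrib algebra_simps)
    have eq: "A.two_time s t x z - B.two_time s t x z =
        (\<Sum>y\<in>Sn n. (A.two_time s r x y - B.two_time s r x y) * (A.two_time r t y z / mallows_prob n r y)
          + B.two_time s r x y / mallows_prob n r y * (A.two_time r t y z - B.two_time r t y z))"
      unfolding A.Chapman_Kolmogorov[OF srt] B.Chapman_Kolmogorov[OF srt] sum_subtractf[symmetric]
      by (intro sum.cong refl alg)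
    have "\<bar>A.two_time s t x z - B.two_time s t x z\<bar> \<le> (\<Sum>y\<in>Sn n. \<bar>(A.two_time s r x y - B.two_time s r x y) * (A.two_time r t y z / mallows_prob n r y)
          + B.two_time s r x y / mallows_prob n r y * (A.two_time r t y z - B.two_time r t y z)\<bar>)"
      unfolding eq by (rule sum_abs)
    also have "\<dots> \<le> (\<Sum>y\<in>Sn n. ?d y * (A.two_time r t y z / mallows_prob n r y) + \<bar>A.two_time r t y z - B.two_time r t y z\<bar>)"
    proof (rule sum_mono)
      fix y assume y: "y \<in> Sn n"
      define p q where "p = A.two_time r t y z / mallows_prob n r y" and "q = B.two_time s r x y / mallows_prob n r y"
      have p: "0 \<le> p" unfolding p_def by (rule divide_nonneg_pos[OF A.two_time_nonneg pos])
      have q: "0 \<le> q" "q \<le> 1"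
        using pos[of y] B.two_time_le[OF srt(1) rt(2) y, of x] B.two_time_nonneg[of s r x y] by (simp_all add: q_def)
      have "\<bar>(A.two_time s r x y - B.two_time s r x y) * p + q * (A.two_time r t y z - B.two_time r t y z)\<bar>
          \<le> \<bar>(A.two_time s r x y - B.two_time s r x y) * p\<bar> + \<bar>q * (A.two_time r t y z - B.two_time r t y z)\<bar>"
        by (rule abs_triangle_ineq)
      also have "\<dots> = ?d y * p + q * \<bar>A.two_time r t y z - B.two_time r t y z\<bar>"
        using p q by (simp only: abs_mult abs_of_nonneg)
      also have "\<dots> \<le> ?d y * p + \<bar>A.two_time r t y z - B.two_time r t y z\<bar>"
        using q by (intro add_left_mono mult_left_le_one_le) auto
      finally show "\<bar>(A.two_time s r x y - B.two_time s r x y) * (A.two_time r t y z / mallows_prob n r y)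
          + B.two_time s r x y / mallows_prob n r y * (A.two_time r t y z - B.two_time r t y z)\<bar>
          \<le> ?d y * (A.two_time r t y z / mallows_prob n r y) + \<bar>A.two_time r t y z - B.two_time r t y z\<bar>"
        by (simp only: p_def q_def)
    qed
    finally show ?thesis .
  qed
  then have "(\<Sum>z\<in>Sn n. \<bar>A.two_time s t x z - B.two_time s t x z\<bar>)
      \<le> (\<Sum>z\<in>Sn n. \<Sum>y\<in>Sn n. ?d y * (A.two_time r t y z / mallows_prob n r y) + \<bar>A.two_time r t y z - B.two_time r t y z\<bar>)"
    by (rule sum_mono)
  also have "\<dots> = (\<Sum>y\<in>Sn n. ?d y * ((\<Sum>z\<in>Sn n. A.two_time r t y z) / mallows_prob n r y)
      + (\<Sum>z\<in>Sn n. \<bar>A.two_time r t y z - B.two_time r t y z\<bar>))"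
    by (subst sum.swap) (simp add: sum.distrib sum_distrib_left sum_divide_distrib)
  also have "\<dots> = (\<Sum>y\<in>Sn n. ?d y + (\<Sum>z\<in>Sn n. \<bar>A.two_time r t y z - B.two_time r t y z\<bar>))"
    using pos by (intro sum.cong refl) (simp add: A.sum_two_time[OF rt(2,3)] A.prob_eq_mallows[OF rt(2)] less_imp_neq[symmetric])
  also have "\<dots> = (\<Sum>y\<in>Sn n. ?d y) + dist_two_time r t" by (rule sum.distrib)
  finally show ?thesis .
qed

text \<open>The left side does not depend on the partition, while the accumulated error is a
  constant times the sum of the multiple-jump probabilities and vanishes in the limit.\<close>

lemma two_time_eq:
  assumes st: "0 \<le> s" "s < t" and xy: "x \<in> Sn n" "y \<in> Sn n"
  shows "A.two_time s t x y = B.two_time s t x y"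
proof -
  define u where "u N k = s + (t - s) * real k / real (Suc N)" for N k :: nat
  have u_nonneg: "0 \<le> u N k" for N k using st by (simp add: u_def)
  have u_less: "u N k < u N (Suc k)" for N k
    unfolding u_def using st by (intro add_strict_left_mono divide_strict_right_mono mult_strict_left_mono) auto
  have u_gt: "s < u N (Suc k)" for N k using st by (simp add: u_def)
  have u_end: "u N 0 = s" "u N (Suc N) = t" for N by (simp_all add: u_def)
  \<comment> \<open>One factor \<open>card (Sn n)\<close> for each of the two states summed over in
    \<open>dist_two_time\<close>; \<open>2 * real n\<close> comes from
    \<open>two_time_diff_le\<close>.\<close>
  define C where "C = real (card (Sn n)) * (real (card (Sn n)) * (2 * real n))"
  let ?e = "\<lambda>N k. A.multi_jump (u N k) (u N (Suc k)) + B.multi_jump (u N k) (u N (Suc k))"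
  have chain: "(\<Sum>z\<in>Sn n. \<bar>A.two_time s (u N (Suc k)) x z - B.two_time s (u N (Suc k)) x z\<bar>)
      \<le> (\<Sum>i<Suc k. dist_two_time (u N i) (u N (Suc i)))" for N k
  proof (induction k)
    case 0
    have "(\<Sum>z\<in>Sn n. \<bar>A.two_time s (u N (Suc 0)) x z - B.two_time s (u N (Suc 0)) x z\<bar>) \<le> dist_two_time s (u N (Suc 0))"
      using finite_Sn xy(1)
      by (intro member_le_sum[of x "Sn n" "\<lambda>x. \<Sum>z\<in>Sn n. \<bar>A.two_time s (u N (Suc 0)) x z - B.two_time s (u N (Suc 0)) x z\<bar>"])
        (auto intro: sum_nonneg)
    then show ?case by (simp add: u_end)
  next
    case (Suc k)
    then show ?case
      using two_time_diff_add[OF st(1) u_gt u_less xy(1), of N k] by simp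
  qed
  have "\<bar>A.two_time s t x y - B.two_time s t x y\<bar> \<le> C * (\<Sum>i<Suc N. ?e N i)" for N
  proof -
    have "\<bar>A.two_time s t x y - B.two_time s t x y\<bar> \<le> (\<Sum>z\<in>Sn n. \<bar>A.two_time s t x z - B.two_time s t x z\<bar>)"
      using finite_Sn xy(2) by (intro member_le_sum[of y "Sn n" "\<lambda>z. \<bar>A.two_time s t x z - B.two_time s t x z\<bar>"]) auto
    also have "\<dots> \<le> (\<Sum>i<Suc N. dist_two_time (u N i) (u N (Suc i)))"
      using chain[of N N] by (simp add: u_end)
    also have "\<dots> \<le> (\<Sum>i<Suc N. C * ?e N i)"
    proof (rule sum_mono)
      fix i
      have "dist_two_time (u N i) (u N (Suc i)) \<le> (\<Sum>x\<in>Sn n. \<Sum>y\<in>Sn n. 2 * real n * ?e N i)"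
        by (intro sum_mono two_time_diff_le u_nonneg u_less)
      then show "dist_two_time (u N i) (u N (Suc i)) \<le> C * ?e N i"
        by (simp add: C_def mult.assoc)
    qed
    finally show ?thesis by (simp only: sum_distrib_left)
  qed
  moreover have "(\<lambda>N. C * (\<Sum>i<Suc N. ?e N i)) \<longlonglongrightarrow> C * (0 + 0)"
    unfolding sum.distrib u_def
    by (intro tendsto_mult tendsto_add tendsto_const A.multi_jump_sum_tendsto_0 B.multi_jump_sum_tendsto_0 st)
  ultimately have "\<bar>A.two_time s t x y - B.two_time s t x y\<bar> \<le> C * (0 + 0)"
    by (intro LIMSEQ_le_const) auto
  then show ?thesis by simp
qed

text \<open>Each further time multiplies by a two-time probability and divides by the mass of the
  present state, and both are already known to agree.\<close>

lemma finite_dimensional_eq: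
  assumes "0 \<le> ts 0" "\<And>i. i < m \<Longrightarrow> ts i < ts (Suc i)"
  shows "A.prob {\<omega>\<in>space M. \<forall>i\<le>m. X (ts i) \<omega> = xs i} = B.prob {\<omega>\<in>space M'. \<forall>i\<le>m. X' (ts i) \<omega> = xs i}"
  using assms
proof (induction m)
  case 0
  then show ?case by (simp add: A.prob_eq_mallows B.prob_eq_mallows)
next
  case (Suc m)
  have IH: "A.prob {\<omega>\<in>space M. \<forall>i\<le>m. X (ts i) \<omega> = xs i} = B.prob {\<omega>\<in>space M'. \<forall>i\<le>m. X' (ts i) \<omega> = xs i}"
    using Suc by simp
  have nonneg: "0 \<le> ts i" "0 < i \<Longrightarrow> 0 < ts i" if "i \<le> Suc m" for i
  proof -
    have "0 \<le> ts i \<and> (0 < i \<longrightarrow> 0 < ts i)" using that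
    proof (induction i)
      case (Suc i)
      then show ?case using Suc.prems \<open>\<And>i. i < Suc m \<Longrightarrow> ts i < ts (Suc i)\<close>[of i] by auto
    qed (use Suc.prems in simp)
    then show "0 \<le> ts i" "0 < i \<Longrightarrow> 0 < ts i" by auto
  qed
  show ?case
  proof (cases "xs m \<in> Sn n \<and> xs (Suc m) \<in> Sn n")
    case False
    have "{\<omega>\<in>space M. \<forall>i\<le>Suc m. X (ts i) \<omega> = xs i} = {}"
      using False A.X_in_Sn[OF nonneg(1), of m] A.X_in_Sn[OF nonneg(1), of "Suc m"] by fastforce
    moreover have "{\<omega>\<in>space M'. \<forall>i\<le>Suc m. X' (ts i) \<omega> = xs i} = {}"
      using False B.X_in_Sn[OF nonneg(1), of m] B.X_in_Sn[OF nonneg(1), of "Suc m"] by fastforce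
    ultimately show ?thesis by (simp only: measure_empty)
  next
    case True
    have eq: "A.two_time (ts m) (ts (Suc m)) (xs m) (xs (Suc m)) = B.two_time (ts m) (ts (Suc m)) (xs m) (xs (Suc m))"
      using True Suc.prems nonneg by (intro two_time_eq) auto
    show ?thesis
    proof (cases "m = 0")
      \<comment> \<open>The present time may be 0, where the state \<open>xs 0\<close> can have mass
        zero. No division is made: the event is itself a two-time event.\<close>
      case True
      have "(\<forall>i\<le>Suc 0. P i) \<longleftrightarrow> P 0 \<and> P (Suc 0)" for P :: "nat \<Rightarrow> bool" by (auto simp: le_Suc_eq)
      then show ?thesis using eq True by (simp add: A.two_time_def B.two_time_def)
    next
      case False
      have "0 < mallows_prob n (ts m) (xs m)" using False nonneg by (intro mallows_prob_pos) auto
      moreover have "A.prob {\<omega>\<in>space M. \<forall>i\<le>Suc m. X (ts i) \<omega> = xs i} * mallows_prob n (ts m) (xs m)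
          = B.prob {\<omega>\<in>space M'. \<forall>i\<le>Suc m. X' (ts i) \<omega> = xs i} * mallows_prob n (ts m) (xs m)"
        using A.markov_step[of ts m xs] B.markov_step[of ts m xs] Suc.prems eq IH True nonneg(1)[of m]
        by (simp add: A.prob_eq_mallows B.prob_eq_mallows)
      ultimately show ?thesis by (simp only: mult_cancel_right) simp
    qed
  qed
qed

lemma finite_times_eq:
  assumes J: "finite J" "J \<subseteq> {0..}" "J \<noteq> {}"
  shows "A.prob {\<omega>\<in>space M. \<forall>t\<in>J. X t \<omega> = x t} = B.prob {\<omega>\<in>space M'. \<forall>t\<in>J. X' t \<omega> = x t}"
proof -
  define L where "L = sorted_list_of_set J"
  have L: "set L = J" "sorted_wrt (<) L" using J(1) by (simp_all add: L_def)
  define m where "m = length L - 1"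
  have len: "length L = Suc m" using L(1) J(3) by (cases L) (auto simp: m_def)
  have all: "(\<forall>t\<in>J. P t) \<longleftrightarrow> (\<forall>i\<le>m. P (L ! i))" for P
    unfolding L(1)[symmetric] all_set_conv_all_nth len by auto
  show ?thesis
    unfolding all
  proof (rule finite_dimensional_eq)
    show "0 \<le> L ! 0" using J(2) L(1) len nth_mem[of 0 L] by auto
    show "L ! i < L ! Suc i" if "i < m" for i
      using that L(2) len by (simp add: sorted_wrt_nth_less)
  qed
qed

text \<open>Cylinders over finite time sets determine the law. As \<open>Sn n\<close> is finite,
  each of them is a finite disjoint union of events that prescribe the state at every time of
  \<open>J\<close>.\<close>

lemma process_law_eq: "process_law n M X = process_law n M' X'"
  unfolding process_law_def
proof (rule measure_eqI_PiM_infinite)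
  let ?P = "PiM {0::real..} (\<lambda>_. count_space (Sn n))"
  have meas: "(\<lambda>\<omega>. restrict (\<lambda>t. X t \<omega>) {0..}) \<in> measurable M ?P"
      "(\<lambda>\<omega>. restrict (\<lambda>t. X' t \<omega>) {0..}) \<in> measurable M' ?P"
    by (auto intro!: measurable_restrict A.X_measurable B.X_measurable)
  show "finite_measure (distr M ?P (\<lambda>\<omega>. restrict (\<lambda>t. X t \<omega>) {0..}))"
    using A.prob_space_distr[OF meas(1)] by (simp add: prob_space_def)
  fix A J assume J: "finite J" "J \<subseteq> {0::real..}" and A: "\<And>t. t \<in> J \<Longrightarrow> A t \<in> sets (count_space (Sn n))"
  let ?E = "prod_emb {0..} (\<lambda>_. count_space (Sn n)) J (Pi\<^sub>E J A)"
  have E: "?E \<in> sets ?P" using J A by (intro sets_PiM_I) auto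
  have fin: "finite (PiE J A)"
    using J(1) A finite_Sn by (intro finite_PiE) (auto intro: finite_subset)
  have pre: "(\<lambda>\<omega>. restrict (\<lambda>t. Y t \<omega>) {0..}) -` ?E \<inter> space N = (\<Union>x\<in>PiE J A. {\<omega>\<in>space N. \<forall>t\<in>J. Y t \<omega> = x t})"
    if "\<And>t \<omega>. 0 \<le> t \<Longrightarrow> \<omega> \<in> space N \<Longrightarrow> Y t \<omega> \<in> Sn n" for N :: "'c measure" and Y
  proof -
    have "(\<lambda>\<omega>. restrict (\<lambda>t. Y t \<omega>) {0..}) -` ?E \<inter> space N = {\<omega>\<in>space N. \<forall>t\<in>J. Y t \<omega> \<in> A t}"
      using that J by (auto simp: prod_emb_def space_PiM PiE_iff restrict_def subset_iff extensional_def)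
    also have "\<dots> = (\<Union>x\<in>PiE J A. {\<omega>\<in>space N. \<forall>t\<in>J. Y t \<omega> = x t})"
    proof (intro set_eqI iffI)
      fix \<omega> assume "\<omega> \<in> {\<omega>\<in>space N. \<forall>t\<in>J. Y t \<omega> \<in> A t}"
      then show "\<omega> \<in> (\<Union>x\<in>PiE J A. {\<omega>\<in>space N. \<forall>t\<in>J. Y t \<omega> = x t})"
        by (intro UN_I[of "restrict (\<lambda>t. Y t \<omega>) J"]) auto
    qed (auto simp: PiE_iff)
    finally show ?thesis .
  qed
  have disj: "disjoint_family_on (\<lambda>x. {\<omega>\<in>space N. \<forall>t\<in>J. Y t \<omega> = x t}) (PiE J A)" for N :: "'c measure" and Y :: "real \<Rightarrow> 'c \<Rightarrow> nat \<Rightarrow> nat"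
  proof -
    have "x = y" if "x \<in> PiE J A" "y \<in> PiE J A" "\<forall>t\<in>J. Y t \<omega> = x t" "\<forall>t\<in>J. Y t \<omega> = y t" for x y \<omega>
      using that by (intro PiE_ext[OF that(1,2)]) auto
    then show ?thesis unfolding disjoint_family_on_def by blast
  qed
  show "emeasure (distr M ?P (\<lambda>\<omega>. restrict (\<lambda>t. X t \<omega>) {0..})) ?E
      = emeasure (distr M' ?P (\<lambda>\<omega>. restrict (\<lambda>t. X' t \<omega>) {0..})) ?E"
  proof (cases "J = {}")
    case True
    then have "?E = space ?P" by (auto simp: prod_emb_def space_PiM)
    then show ?thesis
      using prob_space.emeasure_space_1[OF A.prob_space_distr[OF meas(1)]]
        prob_space.emeasure_space_1[OF B.prob_space_distr[OF meas(2)]] by simp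
  next
    case False
    have meas': "{\<omega>\<in>space M. \<forall>t\<in>J. X t \<omega> = x t} \<in> A.events" "{\<omega>\<in>space M'. \<forall>t\<in>J. X' t \<omega> = x t} \<in> B.events" for x
      using J False by (auto intro!: sets.sets_Collect_finite_All' simp: subset_iff)
    have "A.prob (\<Union>x\<in>PiE J A. {\<omega>\<in>space M. \<forall>t\<in>J. X t \<omega> = x t}) = (\<Sum>x\<in>PiE J A. A.prob {\<omega>\<in>space M. \<forall>t\<in>J. X t \<omega> = x t})"
      by (intro A.finite_measure_finite_Union disj fin) (use meas' in blast)
    also have "\<dots> = (\<Sum>x\<in>PiE J A. B.prob {\<omega>\<in>space M'. \<forall>t\<in>J. X' t \<omega> = x t})"
      by (intro sum.cong refl finite_times_eq J False)
    also have "\<dots> = B.prob (\<Union>x\<in>PiE J A. {\<omega>\<in>space M'. \<forall>t\<in>J. X' t \<omega> = x t})"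
      by (intro B.finite_measure_finite_Union[symmetric] disj fin) (use meas' in blast)
    finally show ?thesis
      by (simp add: emeasure_distr[OF meas(1) E] emeasure_distr[OF meas(2) E] pre A.X_in_Sn B.X_in_Sn
          A.emeasure_eq_measure B.emeasure_eq_measure)
  qed
qed auto

end

section \<open>Birth chains with jump times of product form\<close>

text \<open>For sorted \<open>x\<close> the indices with \<open>x i \<le> s\<close> form an initial
  segment, so their number determines the set. This turns the state of the counting process into
  conditions on separate jump times.\<close>

lemma card_le_eq_iff_sorted:
  fixes x :: "nat \<Rightarrow> real"
  assumes sorted: "\<forall>i<d. \<forall>j<i. x j \<le> x i" and k: "k \<le> d"
  shows "card {i\<in>{..<d}. x i \<le> s} = k \<longleftrightarrow> (\<forall>i<k. x i \<le> s) \<and> (\<forall>i\<in>{k..<d}. s < x i)"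
proof -
  let ?D = "{i\<in>{..<d}. x i \<le> s}"
  have "?D \<subseteq> {..<card ?D}"
  proof
    fix i assume i: "i \<in> ?D"
    have "x j \<le> s" if "j \<le> i" for j
    proof (cases "j = i")
      case False
      then have "x j \<le> x i" using sorted i that by simp
      then show ?thesis using i by simp
    qed (use i in simp)
    then have "{..i} \<subseteq> ?D" using i by auto
    then have "card {..i} \<le> card ?D" by (intro card_mono) auto
    then show "i \<in> {..<card ?D}" by simp
  qed
  then have D: "?D = {..<card ?D}" by (intro card_subset_eq) auto
  have "card ?D = k \<longleftrightarrow> ?D = {..<k}"
  proof
    assume "card ?D = k"
    with D show "?D = {..<k}" by (simp only:)
  qed (simp only: card_lessThan)
  also have "\<dots> \<longleftrightarrow> (\<forall>i<k. x i \<le> s) \<and> (\<forall>i\<in>{k..<d}. s < x i)"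
  proof
    assume "?D = {..<k}"
    then have iff: "i < d \<and> x i \<le> s \<longleftrightarrow> i < k" for i by (auto simp: set_eq_iff)
    show "(\<forall>i<k. x i \<le> s) \<and> (\<forall>i\<in>{k..<d}. s < x i)"
    proof (intro conjI allI impI ballI)
      show "x i \<le> s" if "i < k" for i using iff[of i] that by simp
      show "s < x i" if "i \<in> {k..<d}" for i using iff[of i] that by auto
    qed
  next
    assume "(\<forall>i<k. x i \<le> s) \<and> (\<forall>i\<in>{k..<d}. s < x i)"
    then have "i \<in> ?D \<longleftrightarrow> i \<in> {..<k}" for i
      using k by (cases "i < k") (auto simp: not_le[symmetric])
    then show "?D = {..<k}" by blast
  qed
  finally show ?thesis .
qed

text \<open>Tonelli with coordinate \<open>i\<close> integrated innermost. It excludes ties both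
  between jump times of one chain and between different chains.\<close>

lemma (in product_sigma_finite) AE_PiM_coordinate:
  assumes I: "finite I" "i \<in> I"
    and P: "{\<omega>\<in>space (PiM I M). P \<omega>} \<in> sets (PiM I M)"
    and AE: "\<And>x. x \<in> space (PiM (I - {i}) M) \<Longrightarrow> AE y in M i. P (x(i := y))"
  shows "AE \<omega> in PiM I M. P \<omega>"
proof -
  let ?B = "{\<omega>\<in>space (PiM I M). \<not> P \<omega>}"
  have B: "?B \<in> sets (PiM I M)"
    using sets.compl_sets[OF P] by (rule back_subst[of "\<lambda>A. A \<in> _"]) auto
  have ins: "insert i (I - {i}) = I" using I by auto
  have "(\<integral>\<^sup>+\<omega>. indicator ?B \<omega> \<partial>PiM I M)
      = (\<integral>\<^sup>+x. (\<integral>\<^sup>+y. indicator ?B (x(i := y)) \<partial>M i) \<partial>PiM (I - {i}) M)"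
    using product_nn_integral_insert[of "I - {i}" i "indicator ?B"] I B unfolding ins by auto
  also have "\<dots> = (\<integral>\<^sup>+x. 0 \<partial>PiM (I - {i}) M)"
  proof (rule nn_integral_cong)
    fix x assume x: "x \<in> space (PiM (I - {i}) M)"
    have "AE y in M i. indicator ?B (x(i := y)) = (0 :: ennreal)"
      using AE[OF x] by eventually_elim auto
    then show "(\<integral>\<^sup>+y. indicator ?B (x(i := y)) \<partial>M i) = 0"
      by (subst nn_integral_cong_AE[where v="\<lambda>_. 0"]) auto
  qed
  finally have "emeasure (PiM I M) ?B = 0" using B by simp
  with B show ?thesis by (subst AE_iff_measurable[OF _ refl]) auto
qed

text \<open>The jump times of a birth chain on \<open>{0..d}\<close> have a joint density of product form
  \<open>g 0 x\<^sub>0 \<cdots> g (d-1) x\<^sub>d\<^sub>-\<^sub>1\<close> on increasing sequences; \<open>\<alpha> k s\<close> is the mass of the first \<open>k\<close> jumps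
  happening before \<open>s\<close>, and \<open>\<beta> k s\<close> the mass of the remaining ones happening after \<open>s\<close>.\<close>
locale birth_density =
  fixes d :: nat and g \<alpha> \<beta> :: "nat \<Rightarrow> real \<Rightarrow> real"
  assumes measurable_g[measurable]: "\<And>l. g l \<in> borel_measurable borel"
    and measurable_\<alpha>[measurable]: "\<And>l. \<alpha> l \<in> borel_measurable borel"
    and measurable_\<beta>[measurable]: "\<And>l. \<beta> l \<in> borel_measurable borel"
    and g_nonneg: "\<And>l s. 0 \<le> s \<Longrightarrow> 0 \<le> g l s"
    and \<alpha>_nonneg: "\<And>l s. 0 \<le> s \<Longrightarrow> 0 \<le> \<alpha> l s"
    and \<beta>_nonneg: "\<And>l s. 0 \<le> s \<Longrightarrow> 0 \<le> \<beta> l s"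
    and \<alpha>_0: "\<And>s. 0 \<le> s \<Longrightarrow> \<alpha> 0 s = 1" and \<beta>_d: "\<And>s. 0 \<le> s \<Longrightarrow> \<beta> d s = 1"
    and \<alpha>_Suc: "\<And>l s. l < d \<Longrightarrow> 0 \<le> s \<Longrightarrow>
      (\<integral>\<^sup>+x. ennreal (g l x * \<alpha> l x) * indicator {0..s} x \<partial>lborel) = ennreal (\<alpha> (Suc l) s)"
    and \<beta>_eq: "\<And>l s. l < d \<Longrightarrow> 0 \<le> s \<Longrightarrow>
      (\<integral>\<^sup>+x. ennreal (g l x * \<beta> (Suc l) x) * indicator {s..} x \<partial>lborel) = ennreal (\<beta> l s)"
    and \<beta>_0_0: "\<beta> 0 0 = 1"
begin

text \<open>Leaving out the point 0 makes the jump times positive almost everywhere and does not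
  change integrals. Only sigma-finiteness of these measures is used; total mass 1 is obtained after
  restriction to increasing sequences.\<close>

definition \<mu> :: "nat \<Rightarrow> real measure" where
  "\<mu> l = density lborel (\<lambda>x. ennreal (g l x) * indicator {0<..} x)"

lemma sets_\<mu>[measurable_cong, simp]: "sets (\<mu> l) = sets borel"
  by (simp add: \<mu>_def)

lemma space_\<mu>[simp]: "space (\<mu> l) = UNIV"
  by (simp add: \<mu>_def)

sublocale product_sigma_finite \<mu>
proof (rule product_sigma_finite.intro)
  fix l
  have "sigma_finite_measure (density lborel (\<lambda>x. ennreal (g l x) * indicator {0<..} x))"
    by (subst sigma_finite_measure.sigma_finite_iff_density_finite[OF sigma_finite_lborel]) (auto simp: ennreal_mult_eq_top_iff indicator_def)
  then show "sigma_finite_measure (\<mu> l)" by (simp add: \<mu>_def)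
qed

lemma AE_\<mu>_pos: "AE x in \<mu> l. 0 < x"
  unfolding \<mu>_def by (subst AE_density) (auto simp: indicator_def)

lemma AE_\<mu>_neq: "AE x in \<mu> l. x \<noteq> c"
  unfolding \<mu>_def by (subst AE_density) (use AE_lborel_singleton[of c] in auto)

text \<open>Outside \<open>I\<close> the coordinate is the constant \<open>undefined\<close> on the
  space. Covering every \<open>i\<close> spares the measurability proofs below a membership
  condition.\<close>

lemma measurable_coordinate: "(\<lambda>x. x i) \<in> borel_measurable (PiM I \<mu>)"
proof (cases "i \<in> I")
  case True
  have "(\<lambda>x. x i) \<in> measurable (PiM I \<mu>) (\<mu> i)" by (rule measurable_component_singleton[OF True])
  then show ?thesis by (simp cong: measurable_cong_sets)
next
  case False
  have "(\<lambda>x. undefined :: real) \<in> borel_measurable (PiM I \<mu>)" by simp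
  moreover have "(\<lambda>x. x i) \<in> borel_measurable (PiM I \<mu>) \<longleftrightarrow> (\<lambda>x. undefined :: real) \<in> borel_measurable (PiM I \<mu>)"
    by (intro measurable_cong) (use False in \<open>auto simp: space_PiM PiE_def extensional_def\<close>)
  ultimately show ?thesis by simp
qed

lemma pred_coordinate[measurable]:
  "Measurable.pred (PiM I \<mu>) (\<lambda>x. x i \<le> x j)" "Measurable.pred (PiM I \<mu>) (\<lambda>x. x i \<le> c)"
  "Measurable.pred (PiM I \<mu>) (\<lambda>x. c \<le> x i)" "Measurable.pred (PiM I \<mu>) (\<lambda>x. c < x i)"
  unfolding pred_def
  by (rule borel_measurable_le borel_measurable_less; rule measurable_coordinate borel_measurable_const)+

lemma nn_integral_\<mu>:
  assumes [measurable]: "f \<in> borel_measurable borel"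
  shows "(\<integral>\<^sup>+x. f x \<partial>\<mu> l) = (\<integral>\<^sup>+x. ennreal (g l x) * indicator {0..} x * f x \<partial>lborel)"
proof -
  have "(\<integral>\<^sup>+x. f x \<partial>\<mu> l) = (\<integral>\<^sup>+x. ennreal (g l x) * indicator {0<..} x * f x \<partial>lborel)"
    unfolding \<mu>_def by (rule nn_integral_density) measurable
  also have "\<dots> = (\<integral>\<^sup>+x. ennreal (g l x) * indicator {0..} x * f x \<partial>lborel)"
  proof (rule nn_integral_cong_AE)
    show "AE x in lborel. ennreal (g l x) * indicator {0<..} x * f x = ennreal (g l x) * indicator {0..} x * f x"
      using AE_lborel_singleton[of 0] by eventually_elim (simp add: indicator_def)
  qed
  finally show ?thesis .
qed

text \<open>Integrate out the last jump time \<open>y\<close>. The earlier ones are then ordered and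
  bounded by \<open>y\<close>, with mass \<open>\<alpha> k y\<close>, and what remains is the
  recursion \<open>\<alpha>_Suc\<close>.\<close>

lemma mass_before:
  "k \<le> d \<Longrightarrow> 0 \<le> s \<Longrightarrow>
    emeasure (PiM {..<k} \<mu>) {x\<in>space (PiM {..<k} \<mu>). (\<forall>i<k. \<forall>j<i. x j \<le> x i) \<and> (\<forall>i<k. x i \<le> s)} = ennreal (\<alpha> k s)"
proof (induction k arbitrary: s)
  case 0
  then show ?case by (simp add: \<alpha>_0 space_PiM)
next
  case (Suc k)
  let ?E = "{x\<in>space (PiM {..<Suc k} \<mu>). (\<forall>i<Suc k. \<forall>j<i. x j \<le> x i) \<and> (\<forall>i<Suc k. x i \<le> s)}"
  let ?A = "\<lambda>y. {x\<in>space (PiM {..<k} \<mu>). (\<forall>i<k. \<forall>j<i. x j \<le> x i) \<and> (\<forall>i<k. x i \<le> y)}"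
  have ins: "{..<Suc k} = insert k {..<k}" by auto
  have [measurable]: "?E \<in> sets (PiM {..<Suc k} \<mu>)" by measurable
  have A[measurable]: "?A y \<in> sets (PiM {..<k} \<mu>)" for y by measurable
  have "emeasure (PiM {..<Suc k} \<mu>) ?E = (\<integral>\<^sup>+x. indicator ?E x \<partial>PiM {..<Suc k} \<mu>)" by simp
  also have "\<dots> = (\<integral>\<^sup>+y. (\<integral>\<^sup>+x. indicator ?E (x(k := y)) \<partial>PiM {..<k} \<mu>) \<partial>\<mu> k)"
    unfolding ins by (rule product_nn_integral_insert_rev) (auto simp: ins[symmetric])
  also have "\<dots> = (\<integral>\<^sup>+y. ennreal (\<alpha> k y) * indicator {..s} y \<partial>\<mu> k)"
  proof (rule nn_integral_cong_AE)
    show "AE y in \<mu> k. (\<integral>\<^sup>+x. indicator ?E (x(k := y)) \<partial>PiM {..<k} \<mu>) = ennreal (\<alpha> k y) * indicator {..s} y"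
      using AE_\<mu>_pos
    proof eventually_elim
      case (elim y)
      have "(\<integral>\<^sup>+x. indicator ?E (x(k := y)) \<partial>PiM {..<k} \<mu>)
          = (\<integral>\<^sup>+x. indicator {..s} y * indicator (?A y) x \<partial>PiM {..<k} \<mu>)"
      proof (rule nn_integral_cong)
        fix x assume x: "x \<in> space (PiM {..<k} \<mu>)"
        have "x(k := y) \<in> space (PiM {..<Suc k} \<mu>)"
          using x by (auto simp: space_PiM PiE_def extensional_def)
        then have "x(k := y) \<in> ?E \<longleftrightarrow> y \<le> s \<and> x \<in> ?A y"
        proof (intro iffI)
          assume E: "x(k := y) \<in> ?E"
          have le: "(x(k := y)) j \<le> (x(k := y)) i" if "i < Suc k" "j < i" for i j using E that by blast
          have "x j \<le> x i" if "i < k" "j < i" for i j using le[of i j] that by simp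
          moreover have "x j \<le> y" if "j < k" for j using le[of k j] that by simp
          moreover have "(x(k := y)) k \<le> s" using E by blast
          ultimately show "y \<le> s \<and> x \<in> ?A y" using x by simp
        next
          assume *: "y \<le> s \<and> x \<in> ?A y"
          have "(x(k := y)) j \<le> (x(k := y)) i" if "i < Suc k" "j < i" for i j
            using * that by (cases "i = k") auto
          moreover have "(x(k := y)) i \<le> s" if "i < Suc k" for i
            using * that by (cases "i = k") (auto intro: order_trans[of "x i" y s])
          ultimately show "x(k := y) \<in> ?E" using \<open>x(k := y) \<in> space _\<close> by blast
        qed
        then show "indicator ?E (x(k := y)) = (indicator {..s} y * indicator (?A y) x :: ennreal)"
          by (simp add: indicator_def)
      qed
      also have "\<dots> = indicator {..s} y * emeasure (PiM {..<k} \<mu>) (?A y)"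
        by (subst nn_integral_cmult) auto
      also have "\<dots> = indicator {..s} y * ennreal (\<alpha> k y)"
        using Suc elim by simp
      finally show ?case by (simp add: mult.commute)
    qed
  qed
  also have "\<dots> = (\<integral>\<^sup>+x. ennreal (g k x * \<alpha> k x) * indicator {0..s} x \<partial>lborel)"
  proof (subst nn_integral_\<mu>)
    show "(\<integral>\<^sup>+x. ennreal (g k x) * indicator {0..} x * (ennreal (\<alpha> k x) * indicator {..s} x) \<partial>lborel)
        = (\<integral>\<^sup>+x. ennreal (g k x * \<alpha> k x) * indicator {0..s} x \<partial>lborel)"
      by (rule nn_integral_cong) (simp add: indicator_def ennreal_mult g_nonneg \<alpha>_nonneg)
  qed measurable
  also have "\<dots> = ennreal (\<alpha> (Suc k) s)" using Suc.prems by (intro \<alpha>_Suc) auto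
  finally show ?case .
qed

text \<open>The weak version \<open>s \<le> x i\<close> is carried along as induction hypothesis since the next jump
  time only enters the ordering weakly.\<close>
lemma mass_after_aux:
  "k \<le> d \<Longrightarrow> 0 \<le> s \<Longrightarrow>
    emeasure (PiM {k..<d} \<mu>) {x\<in>space (PiM {k..<d} \<mu>). (\<forall>i\<in>{k..<d}. \<forall>j\<in>{k..<i}. x j \<le> x i) \<and> (\<forall>i\<in>{k..<d}. s \<le> x i)} = ennreal (\<beta> k s) \<and>
    emeasure (PiM {k..<d} \<mu>) {x\<in>space (PiM {k..<d} \<mu>). (\<forall>i\<in>{k..<d}. \<forall>j\<in>{k..<i}. x j \<le> x i) \<and> (\<forall>i\<in>{k..<d}. s < x i)} = ennreal (\<beta> k s)"
proof (induction k arbitrary: s rule: inc_induct)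
  case base
  then show ?case by (simp add: \<beta>_d space_PiM)
next
  case (step k)
  let ?B = "\<lambda>y. {x\<in>space (PiM {Suc k..<d} \<mu>). (\<forall>i\<in>{Suc k..<d}. \<forall>j\<in>{Suc k..<i}. x j \<le> x i) \<and> (\<forall>i\<in>{Suc k..<d}. y \<le> x i)}"
  have B[measurable]: "?B y \<in> sets (PiM {Suc k..<d} \<mu>)" for y by measurable
  have ins: "{k..<d} = insert k {Suc k..<d}" using step by auto
  \<comment> \<open>The earliest jump time \<open>y\<close> is integrated out. The later ones must
    be at least \<open>y\<close>, hence lie in the up-set \<open>T\<close> by themselves; this
    treats the closed and the open half-line together.\<close>
  have main: "emeasure (PiM {k..<d} \<mu>) {x\<in>space (PiM {k..<d} \<mu>). (\<forall>i\<in>{k..<d}. \<forall>j\<in>{k..<i}. x j \<le> x i) \<and> (\<forall>i\<in>{k..<d}. x i \<in> T)}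
      = ennreal (\<beta> k s)" (is "emeasure _ ?E = _") if T: "T = {s..} \<or> T = {s<..}" for T
  proof -
    have [measurable]: "T \<in> sets borel" "Measurable.pred (PiM I \<mu>) (\<lambda>x. x i \<in> T)" for I i
      using T by auto
    have T_up: "y \<in> T \<Longrightarrow> y \<le> z \<Longrightarrow> z \<in> T" for y z using T by auto
    have [measurable]: "?E \<in> sets (PiM {k..<d} \<mu>)" by measurable
    have "emeasure (PiM {k..<d} \<mu>) ?E = (\<integral>\<^sup>+x. indicator ?E x \<partial>PiM {k..<d} \<mu>)" by simp
    also have "\<dots> = (\<integral>\<^sup>+y. (\<integral>\<^sup>+x. indicator ?E (x(k := y)) \<partial>PiM {Suc k..<d} \<mu>) \<partial>\<mu> k)"
      unfolding ins by (rule product_nn_integral_insert_rev) (auto simp: ins[symmetric])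
    also have "\<dots> = (\<integral>\<^sup>+y. ennreal (\<beta> (Suc k) y) * indicator T y \<partial>\<mu> k)"
    proof (rule nn_integral_cong_AE)
      show "AE y in \<mu> k. (\<integral>\<^sup>+x. indicator ?E (x(k := y)) \<partial>PiM {Suc k..<d} \<mu>) = ennreal (\<beta> (Suc k) y) * indicator T y"
        using AE_\<mu>_pos
      proof eventually_elim
        case (elim y)
        have "(\<integral>\<^sup>+x. indicator ?E (x(k := y)) \<partial>PiM {Suc k..<d} \<mu>)
            = (\<integral>\<^sup>+x. indicator T y * indicator (?B y) x \<partial>PiM {Suc k..<d} \<mu>)"
        proof (rule nn_integral_cong)
          fix x assume x: "x \<in> space (PiM {Suc k..<d} \<mu>)"
          have sp: "x(k := y) \<in> space (PiM {k..<d} \<mu>)"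
            using x step by (auto simp: space_PiM PiE_def extensional_def)
          have "x(k := y) \<in> ?E \<longleftrightarrow> y \<in> T \<and> x \<in> ?B y"
          proof
            assume E: "x(k := y) \<in> ?E"
            have "y \<in> T" proof -
              have "k \<in> {k..<d}" using step by simp
              then have "(x(k := y)) k \<in> T" using E by blast
              then show ?thesis by simp
            qed
            moreover have "x j \<le> x i" if "i \<in> {Suc k..<d}" "j \<in> {Suc k..<i}" for i j
            proof -
              have "i \<in> {k..<d}" "j \<in> {k..<i}" using that by auto
              then have "(x(k := y)) j \<le> (x(k := y)) i" using E by blast
              then show ?thesis using that by (simp split: if_splits)
            qed
            moreover have "y \<le> x i" if "i \<in> {Suc k..<d}" for i
            proof -
              have "i \<in> {k..<d}" "k \<in> {k..<i}" using that by auto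
              then have "(x(k := y)) k \<le> (x(k := y)) i" using E by blast
              then show ?thesis using that by (simp split: if_splits)
            qed
            ultimately show "y \<in> T \<and> x \<in> ?B y" using x by auto
          next
            assume *: "y \<in> T \<and> x \<in> ?B y"
            have "(x(k := y)) j \<le> (x(k := y)) i" if "i \<in> {k..<d}" "j \<in> {k..<i}" for i j
            proof (cases "j = k")
              case True
              then show ?thesis using * that by simp
            next
              case False
              then have "i \<in> {Suc k..<d}" "j \<in> {Suc k..<i}" using that by auto
              then have "x j \<le> x i" using * by blast
              then show ?thesis using that False by simp
            qed
            moreover have "(x(k := y)) i \<in> T" if "i \<in> {k..<d}" for i
            proof (cases "i = k")
              case False
              then have "i \<in> {Suc k..<d}" using that by auto
              then have "y \<le> x i" using * by blast
              then have "x i \<in> T" using * T_up by blast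
              then show ?thesis using False by simp
            qed (use * in simp)
            ultimately show "x(k := y) \<in> ?E" using sp by blast
          qed
          then show "indicator ?E (x(k := y)) = (indicator T y * indicator (?B y) x :: ennreal)"
            by (simp add: indicator_def)
        qed
        also have "\<dots> = indicator T y * emeasure (PiM {Suc k..<d} \<mu>) (?B y)"
          by (subst nn_integral_cmult) auto
        also have "\<dots> = indicator T y * ennreal (\<beta> (Suc k) y)"
          using step.IH elim by simp
        finally show ?case by (simp add: mult.commute)
      qed
    qed
    also have "\<dots> = (\<integral>\<^sup>+x. ennreal (g k x * \<beta> (Suc k) x) * indicator {s..} x \<partial>lborel)"
    proof (subst nn_integral_\<mu>)
      \<comment> \<open>The two choices of \<open>T\<close> differ only at \<open>s\<close>, a
        Lebesgue null set, so both lead to the integral in \<open>\<beta>_eq\<close>.\<close>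
      have "indicator {0..} x * indicator T x = (indicator {s..} x :: ennreal)" if "x \<noteq> s" for x
        using T that step.prems by (auto simp: indicator_def)
      note T_ind = this
      have ind: "ennreal (g k x) * indicator {0..} x * (ennreal (\<beta> (Suc k) x) * indicator T x)
          = ennreal (g k x) * ennreal (\<beta> (Suc k) x) * indicator {s..} x" if "x \<noteq> s" for x
      proof -
        have "ennreal (g k x) * indicator {0..} x * (ennreal (\<beta> (Suc k) x) * indicator T x)
            = ennreal (g k x) * ennreal (\<beta> (Suc k) x) * (indicator {0..} x * indicator T x)"
          by (simp only: ac_simps)
        then show ?thesis by (simp only: T_ind[OF that])
      qed
      show "(\<integral>\<^sup>+x. ennreal (g k x) * indicator {0..} x * (ennreal (\<beta> (Suc k) x) * indicator T x) \<partial>lborel)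
          = (\<integral>\<^sup>+x. ennreal (g k x * \<beta> (Suc k) x) * indicator {s..} x \<partial>lborel)"
      proof (rule nn_integral_cong_AE)
        show "AE x in lborel. ennreal (g k x) * indicator {0..} x * (ennreal (\<beta> (Suc k) x) * indicator T x)
            = ennreal (g k x * \<beta> (Suc k) x) * indicator {s..} x"
          using AE_lborel_singleton[of s]
        proof eventually_elim
          case (elim x)
          show ?case
            unfolding ind[OF elim] using step.prems
            by (cases "s \<le> x") (simp_all add: ennreal_mult g_nonneg \<beta>_nonneg)
        qed
      qed
    qed measurable
    also have "\<dots> = ennreal (\<beta> k s)" using step by (intro \<beta>_eq) auto
    finally show ?thesis .
  qed
  show ?case using main[of "{s..}"] main[of "{s<..}"] by simp
qed

lemmas mass_after = mass_after_aux[THEN conjunct2]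

lemma emeasure_split:
  assumes k: "k \<le> d"
    and P: "{x\<in>space (PiM {..<d} \<mu>). P x} \<in> sets (PiM {..<d} \<mu>)"
    and P1: "{x\<in>space (PiM {..<k} \<mu>). P1 x} \<in> sets (PiM {..<k} \<mu>)"
    and P2: "{x\<in>space (PiM {k..<d} \<mu>). P2 x} \<in> sets (PiM {k..<d} \<mu>)"
    and eq: "\<And>x y. x \<in> space (PiM {..<k} \<mu>) \<Longrightarrow> y \<in> space (PiM {k..<d} \<mu>) \<Longrightarrow>
      P (merge {..<k} {k..<d} (x, y)) \<longleftrightarrow> P1 x \<and> P2 y"
  shows "emeasure (PiM {..<d} \<mu>) {x\<in>space (PiM {..<d} \<mu>). P x}
    = emeasure (PiM {..<k} \<mu>) {x\<in>space (PiM {..<k} \<mu>). P1 x} * emeasure (PiM {k..<d} \<mu>) {x\<in>space (PiM {k..<d} \<mu>). P2 x}"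
proof -
  interpret J: finite_product_sigma_finite \<mu> "{k..<d}" by standard simp
  have un: "{..<d} = {..<k} \<union> {k..<d}" using k by auto
  have dj: "{..<k} \<inter> {k..<d} = {}" by auto
  let ?E = "{x\<in>space (PiM {..<d} \<mu>). P x}"
  let ?m = "merge {..<k} {k..<d} :: (nat \<Rightarrow> real) \<times> (nat \<Rightarrow> real) \<Rightarrow> _"
  have m: "?m \<in> measurable (PiM {..<k} \<mu> \<Otimes>\<^sub>M PiM {k..<d} \<mu>) (PiM {..<d} \<mu>)"
    unfolding un by (rule measurable_merge)
  have "PiM {..<d} \<mu> = distr (PiM {..<k} \<mu> \<Otimes>\<^sub>M PiM {k..<d} \<mu>) (PiM {..<d} \<mu>) ?m"
    unfolding un by (rule distr_merge[symmetric, OF dj]) auto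
  then have "emeasure (PiM {..<d} \<mu>) ?E = emeasure (distr (PiM {..<k} \<mu> \<Otimes>\<^sub>M PiM {k..<d} \<mu>) (PiM {..<d} \<mu>) ?m) ?E"
    by simp
  also have "\<dots> = emeasure (PiM {..<k} \<mu> \<Otimes>\<^sub>M PiM {k..<d} \<mu>) (?m -` ?E \<inter> space (PiM {..<k} \<mu> \<Otimes>\<^sub>M PiM {k..<d} \<mu>))"
    by (rule emeasure_distr[OF m P])
  also have "?m -` ?E \<inter> space (PiM {..<k} \<mu> \<Otimes>\<^sub>M PiM {k..<d} \<mu>)
      = {x\<in>space (PiM {..<k} \<mu>). P1 x} \<times> {x\<in>space (PiM {k..<d} \<mu>). P2 x}"
    using measurable_space[OF m] eq by (auto simp: space_pair_measure)
  also have "emeasure (PiM {..<k} \<mu> \<Otimes>\<^sub>M PiM {k..<d} \<mu>) \<dots>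
      = emeasure (PiM {..<k} \<mu>) {x\<in>space (PiM {..<k} \<mu>). P1 x} * emeasure (PiM {k..<d} \<mu>) {x\<in>space (PiM {k..<d} \<mu>). P2 x}"
    by (rule J.emeasure_pair_measure_Times[OF P1 P2])
  finally show ?thesis .
qed

section \<open>The jump-time measure and its counting process\<close>

abbreviation increasing :: "(nat \<Rightarrow> real) \<Rightarrow> bool" where
  "increasing x \<equiv> \<forall>i<d. \<forall>j<i. x j \<le> x i"

text \<open>No normalising factor: the total mass is \<open>\<beta> 0 0\<close>, which the locale
  sets to 1. The order is weak here; strictness holds almost everywhere because the coordinates have
  no atoms.\<close>

definition N :: "(nat \<Rightarrow> real) measure" where
  "N = density (PiM {..<d} \<mu>) (indicator {x\<in>space (PiM {..<d} \<mu>). increasing x})"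

definition count :: "real \<Rightarrow> (nat \<Rightarrow> real) \<Rightarrow> nat" where
  "count t x = card {i\<in>{..<d}. x i \<le> t}"

lemma sets_increasing: "{x\<in>space (PiM {..<d} \<mu>). increasing x} \<in> sets (PiM {..<d} \<mu>)"
  by measurable

lemma emeasure_N:
  assumes "{x\<in>space (PiM {..<d} \<mu>). P x} \<in> sets (PiM {..<d} \<mu>)"
  shows "emeasure N {x\<in>space N. P x} = emeasure (PiM {..<d} \<mu>) {x\<in>space (PiM {..<d} \<mu>). increasing x \<and> P x}"
  unfolding N_def using assms sets_increasing
  by (simp add: emeasure_restricted) (auto intro!: arg_cong[of _ _ "emeasure _"])

lemma AE_N_I: "AE x in PiM {..<d} \<mu>. P x \<Longrightarrow> AE x in N. increasing x \<and> P x"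
  unfolding N_def using sets_increasing
  by (subst AE_density) (auto simp: indicator_def)

lemma AE_PiM_coordinate_neq:
  assumes "i < d"
  shows "AE x in PiM {..<d} \<mu>. x i \<noteq> c"
proof (rule AE_PiM_coordinate[of _ i])
  show "{\<omega> \<in> space (PiM {..<d} \<mu>). \<omega> i \<noteq> c} \<in> sets (PiM {..<d} \<mu>)"
    using borel_measurable_eq[OF measurable_coordinate borel_measurable_const, of "{..<d}" i c]
    by (auto intro: sets.sets_Collect_neg)
qed (use assms AE_\<mu>_neq in auto)

lemma AE_PiM_pos: "AE x in PiM {..<d} \<mu>. \<forall>i<d. 0 < x i"
proof -
  have "AE x in PiM {..<d} \<mu>. 0 < x i" if "i < d" for i
  proof (rule AE_PiM_coordinate[of _ i])
    show "{\<omega> \<in> space (PiM {..<d} \<mu>). 0 < \<omega> i} \<in> sets (PiM {..<d} \<mu>)" by measurable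
  qed (use that AE_\<mu>_pos in auto)
  then have "AE x in PiM {..<d} \<mu>. \<forall>i\<in>{..<d}. 0 < x i" by (intro AE_finite_allI) auto
  then show ?thesis by eventually_elim auto
qed

lemma AE_PiM_distinct: "AE x in PiM {..<d} \<mu>. \<forall>i<d. \<forall>j<i. x j \<noteq> x i"
proof -
  have "AE x in PiM {..<d} \<mu>. j < i \<longrightarrow> x j \<noteq> x i" if "i < d" for i j
  proof (rule AE_PiM_coordinate[of _ i])
    show "{\<omega> \<in> space (PiM {..<d} \<mu>). j < i \<longrightarrow> \<omega> j \<noteq> \<omega> i} \<in> sets (PiM {..<d} \<mu>)"
      using borel_measurable_eq[OF measurable_coordinate measurable_coordinate, of "{..<d}" j i]
      by (intro sets.sets_Collect_imp sets.sets_Collect_neg) auto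
    show "AE y in \<mu> i. j < i \<longrightarrow> (x(i := y)) j \<noteq> (x(i := y)) i" for x :: "nat \<Rightarrow> real"
      using AE_\<mu>_neq[where l=i and c="x j"] by eventually_elim auto
  qed (use that in auto)
  then have "AE x in PiM {..<d} \<mu>. \<forall>i\<in>{..<d}. \<forall>j\<in>{..<d}. j < i \<longrightarrow> x j \<noteq> x i"
    by (intro AE_finite_allI) auto
  then show ?thesis by eventually_elim auto
qed

lemma AE_N_strict: "AE x in N. \<forall>i<d. \<forall>j<i. x j < x i"
  using AE_N_I[OF AE_PiM_distinct] by eventually_elim (auto simp: less_le)

lemma AE_N_neq: "i < d \<Longrightarrow> AE x in N. x i \<noteq> c"
  by (drule AE_N_I[OF AE_PiM_coordinate_neq[where c=c]]) (auto elim: eventually_mono)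

lemma prob_space_N: "prob_space N"
proof
  have "emeasure N (space N) = emeasure (PiM {..<d} \<mu>) {x\<in>space (PiM {..<d} \<mu>). increasing x}"
    using emeasure_N[of "\<lambda>_. True"] by simp
  \<comment> \<open>\<open>mass_after\<close> at \<open>s = 0\<close> speaks of strictly positive
    jump times, so positivity is inserted at the cost of a null set.\<close>
  also have "\<dots> = emeasure (PiM {..<d} \<mu>) {x\<in>space (PiM {..<d} \<mu>). increasing x \<and> (\<forall>i<d. 0 < x i)}"
    by (rule emeasure_eq_AE) (use AE_PiM_pos in \<open>eventually_elim, auto\<close>, measurable)
  also have "\<dots> = ennreal (\<beta> 0 0)"
    using mass_after[of 0 0] by (simp add: lessThan_atLeast0 Ball_def)
  finally show "emeasure N (space N) = 1" by (simp add: \<beta>_0_0)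
qed

lemma measurable_count: "count t \<in> measurable (PiM {..<d} \<mu>) (count_space UNIV)"
  unfolding count_def by measurable

text \<open>Conditioned on being in state \<open>k\<close> at time \<open>s\<close>, the first \<open>k\<close> and the remaining jump times are independent.\<close>
lemma emeasure_N_split:
  fixes T1 T2 :: "real set"
  assumes s: "0 \<le> s" and fin: "finite T1" "finite T2" and T: "\<And>t. t \<in> T1 \<Longrightarrow> t \<le> s" "\<And>t. t \<in> T2 \<Longrightarrow> s \<le> t" and k: "k \<le> d"
  shows "emeasure N {x\<in>space N. count s x = k \<and> (\<forall>t\<in>T1. count t x = y t) \<and> (\<forall>t\<in>T2. count t x = y t)} =
    emeasure (PiM {..<k} \<mu>) {x\<in>space (PiM {..<k} \<mu>). ((\<forall>i<k. \<forall>j<i. x j \<le> x i) \<and> (\<forall>i<k. x i \<le> s)) \<and>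
      (\<forall>t\<in>T1. card {i\<in>{..<k}. x i \<le> t} = y t)} *
    emeasure (PiM {k..<d} \<mu>) {x\<in>space (PiM {k..<d} \<mu>). ((\<forall>i\<in>{k..<d}. \<forall>j\<in>{k..<i}. x j \<le> x i) \<and> (\<forall>i\<in>{k..<d}. s < x i)) \<and>
      (\<forall>t\<in>T2. k + card {i\<in>{k..<d}. x i \<le> t} = y t)}"
proof -
  note measurable_count[measurable]
  have [measurable]: "(\<lambda>x. card {i\<in>{..<k}. x i \<le> t}) \<in> measurable (PiM {..<k} \<mu>) (count_space UNIV)"
    "(\<lambda>x. card {i\<in>{k..<d}. x i \<le> t}) \<in> measurable (PiM {k..<d} \<mu>) (count_space UNIV)" for t
    by measurable
  note [measurable] = pred_intros_finite(2)[OF fin(1)] pred_intros_finite(2)[OF fin(2)]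
  have "emeasure N {x\<in>space N. count s x = k \<and> (\<forall>t\<in>T1. count t x = y t) \<and> (\<forall>t\<in>T2. count t x = y t)}
      = emeasure (PiM {..<d} \<mu>) {x\<in>space (PiM {..<d} \<mu>). increasing x \<and> count s x = k \<and> (\<forall>t\<in>T1. count t x = y t) \<and> (\<forall>t\<in>T2. count t x = y t)}"
    by (rule emeasure_N) (use fin in measurable)
  also have "\<dots> = emeasure (PiM {..<k} \<mu>) {x\<in>space (PiM {..<k} \<mu>). ((\<forall>i<k. \<forall>j<i. x j \<le> x i) \<and> (\<forall>i<k. x i \<le> s)) \<and>
      (\<forall>t\<in>T1. card {i\<in>{..<k}. x i \<le> t} = y t)} *
    emeasure (PiM {k..<d} \<mu>) {x\<in>space (PiM {k..<d} \<mu>). ((\<forall>i\<in>{k..<d}. \<forall>j\<in>{k..<i}. x j \<le> x i) \<and> (\<forall>i\<in>{k..<d}. s < x i)) \<and>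
      (\<forall>t\<in>T2. k + card {i\<in>{k..<d}. x i \<le> t} = y t)}"
  proof (rule emeasure_split[OF k])
    fix x z :: "nat \<Rightarrow> real"
    let ?m = "merge {..<k} {k..<d} (x, z)"
    have m1: "?m i = x i" if "i < k" for i using that by (simp add: merge_def)
    have m2: "?m i = z i" if "k \<le> i" "i < d" for i using that by (simp add: merge_def)
    let ?P1 = "(\<forall>i<k. \<forall>j<i. x j \<le> x i) \<and> (\<forall>i<k. x i \<le> s)"
    let ?P2 = "(\<forall>i\<in>{k..<d}. \<forall>j\<in>{k..<i}. z j \<le> z i) \<and> (\<forall>i\<in>{k..<d}. s < z i)"
    \<comment> \<open>Once the first block lies at or below \<open>s\<close> and the second above
      it, the order between the blocks is automatic; only the order inside each block
      remains.\<close>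
    have base: "increasing ?m \<and> count s ?m = k \<longleftrightarrow> ?P1 \<and> ?P2"
    proof
      assume *: "increasing ?m \<and> count s ?m = k"
      then have **: "\<forall>i<k. ?m i \<le> s" "\<forall>i\<in>{k..<d}. s < ?m i"
        using card_le_eq_iff_sorted[of d ?m k s] k by (auto simp: count_def)
      have "x j \<le> x i" if "i < k" "j < i" for i j
      proof -
        have "?m j \<le> ?m i" using * that k by auto
        then show ?thesis using that by (simp add: m1)
      qed
      moreover have "z j \<le> z i" if "i \<in> {k..<d}" "j \<in> {k..<i}" for i j
      proof -
        have "?m j \<le> ?m i" using * that by auto
        then show ?thesis using that by (simp add: m2)
      qed
      moreover have "x i \<le> s" if "i < k" for i
      proof -
        have "?m i \<le> s" using **(1) that by blast
        then show ?thesis using that by (simp add: m1)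
      qed
      moreover have "s < z i" if "i \<in> {k..<d}" for i
      proof -
        have "s < ?m i" using **(2) that by blast
        then show ?thesis using that by (simp add: m2)
      qed
      ultimately show "?P1 \<and> ?P2" by blast
    next
      assume *: "?P1 \<and> ?P2"
      have inc: "?m j \<le> ?m i" if "i < d" "j < i" for i j
      proof -
        consider "i < k" | "j < k" "k \<le> i" | "k \<le> j" by linarith
        then show ?thesis
        proof cases
          case 1
          then show ?thesis using * that m1[of i] m1[of j] by simp
        next
          case 2
          then have "?m j \<le> s" "s < ?m i" using * that m1[of j] m2[of i] by auto
          then show ?thesis by simp
        next
          case 3
          then show ?thesis using * that m2[of i] m2[of j] by simp
        qed
      qed
      moreover have "count s ?m = k"
        unfolding count_def using inc * m1 m2 by (subst card_le_eq_iff_sorted[OF _ k]) auto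
      ultimately show "increasing ?m \<and> count s ?m = k" by blast
    qed
    \<comment> \<open>Up to time \<open>s\<close> the second block contributes no jump; from
      \<open>s\<close> on the first block contributes all its \<open>k\<close> jumps. This makes the
      past a condition on \<open>x\<close> alone and the future one on \<open>z\<close>
      alone.\<close>
    have c1: "count t ?m = card {i\<in>{..<k}. x i \<le> t}" if "?P1 \<and> ?P2" "t \<le> s" for t
    proof -
      have "{i\<in>{..<d}. ?m i \<le> t} = {i\<in>{..<k}. x i \<le> t}"
      proof (intro set_eqI iffI)
        fix i assume i: "i \<in> {i\<in>{..<d}. ?m i \<le> t}"
        have "i < k"
        proof (rule ccontr)
          assume "\<not> i < k"
          then have "s < ?m i" using that(1) i m2[of i] by auto
          then show False using i that(2) by simp
        qed
        then show "i \<in> {i\<in>{..<k}. x i \<le> t}" using i m1 by simp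
      qed (use m1 k in auto)
      then show ?thesis by (simp add: count_def)
    qed
    have c2: "count t ?m = k + card {i\<in>{k..<d}. z i \<le> t}" if "?P1 \<and> ?P2" "s \<le> t" for t
    proof -
      have "{i\<in>{..<d}. ?m i \<le> t} = {..<k} \<union> {i\<in>{k..<d}. z i \<le> t}"
      proof (intro set_eqI iffI)
        fix i assume i: "i \<in> {i\<in>{..<d}. ?m i \<le> t}"
        then show "i \<in> {..<k} \<union> {i\<in>{k..<d}. z i \<le> t}"
          using m2[of i] by (cases "i < k") auto
      next
        fix i assume i: "i \<in> {..<k} \<union> {i\<in>{k..<d}. z i \<le> t}"
        show "i \<in> {i\<in>{..<d}. ?m i \<le> t}"
        proof (cases "i < k")
          case True
          then have "?m i \<le> s" using that(1) m1[of i] by auto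
          then show ?thesis using True k that(2) by simp
        next
          case False
          then show ?thesis using i m2[of i] by auto
        qed
      qed
      also have "card \<dots> = k + card {i\<in>{k..<d}. z i \<le> t}"
        by (subst card_Un_disjoint) auto
      finally show ?thesis by (simp add: count_def)
    qed
    show "increasing ?m \<and> count s ?m = k \<and> (\<forall>t\<in>T1. count t ?m = y t) \<and> (\<forall>t\<in>T2. count t ?m = y t) \<longleftrightarrow>
      (?P1 \<and> (\<forall>t\<in>T1. card {i\<in>{..<k}. x i \<le> t} = y t)) \<and> (?P2 \<and> (\<forall>t\<in>T2. k + card {i\<in>{k..<d}. z i \<le> t} = y t))"
    proof (cases "?P1 \<and> ?P2")
      case True
      then have "(\<forall>t\<in>T1. count t ?m = y t) \<longleftrightarrow> (\<forall>t\<in>T1. card {i\<in>{..<k}. x i \<le> t} = y t)"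
        "(\<forall>t\<in>T2. count t ?m = y t) \<longleftrightarrow> (\<forall>t\<in>T2. k + card {i\<in>{k..<d}. z i \<le> t} = y t)"
        using c1 c2 T by auto
      with True base show ?thesis by blast
    next
      case False
      with base show ?thesis by blast
    qed
  qed (use fin in measurable)
  finally show ?thesis .
qed

lemma count_le: "count t x \<le> d"
  unfolding count_def by (rule order_trans[OF card_mono[of "{..<d}"]]) auto

lemma measure_count:
  assumes "0 \<le> s" "k \<le> d"
  shows "measure N {x\<in>space N. count s x = k} = \<alpha> k s * \<beta> k s"
  using emeasure_N_split[of s "{}" "{}" k "\<lambda>_. 0"] mass_before[of k s] mass_after[of k s] assms
  by (simp add: measure_def ennreal_mult[symmetric] \<alpha>_nonneg \<beta>_nonneg)

text \<open>By \<open>emeasure_N_split\<close> each of the four probabilities is a past factor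
  \<open>u\<close> times a future factor \<open>v\<close>. Both sides of the identity are the same
  product of two past and two future factors, in a different order.\<close>

lemma markov_count: "markov_process N count"
  unfolding markov_process_def
proof (intro allI impI)
  fix m :: nat and ts :: "nat \<Rightarrow> real" and xs :: "nat \<Rightarrow> nat"
  assume ts: "0 \<le> ts 0 \<and> (\<forall>i\<le>m. ts i < ts (Suc i))"
  have mono: "i \<le> j \<Longrightarrow> j \<le> m \<Longrightarrow> ts i \<le> ts j" for i j
  proof (induction j)
    case (Suc j)
    show ?case
    proof (cases "i = Suc j")
      case False
      then have "ts i \<le> ts j" using Suc by simp
      moreover have "ts j < ts (Suc j)" using ts Suc.prems by simp
      ultimately show ?thesis by simp
    qed simp
  qed simp
  have less: "ts i < ts j" if "i < j" "j \<le> m" for i j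
  proof -
    have "ts i < ts (Suc i)" using ts that by simp
    moreover have "ts (Suc i) \<le> ts j" using mono[of "Suc i" j] that by simp
    ultimately show ?thesis by simp
  qed
  have inj: "i = j" if "ts i = ts j" "i \<le> m" "j \<le> m" for i j
    using less[of i j] less[of j i] that by (cases i j rule: linorder_cases) auto
  let ?s = "ts m"
  let ?k = "xs m"
  have s: "0 \<le> ?s" using mono[of 0 m] ts by simp
  show "measure N {\<omega>\<in>space N. \<forall>i\<le>Suc m. count (ts i) \<omega> = xs i} * measure N {\<omega>\<in>space N. count ?s \<omega> = ?k}
    = measure N {\<omega>\<in>space N. \<forall>i\<le>m. count (ts i) \<omega> = xs i}
      * measure N {\<omega>\<in>space N. count ?s \<omega> = ?k \<and> count (ts (Suc m)) \<omega> = xs (Suc m)}"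
  proof (cases "?k \<le> d")
    case False
    then have "{\<omega>\<in>space N. count ?s \<omega> = ?k} = {}" "{\<omega>\<in>space N. count ?s \<omega> = ?k \<and> count (ts (Suc m)) \<omega> = xs (Suc m)} = {}"
      using count_le[of ?s] by (auto, metis+)
    then show ?thesis by (simp only: measure_empty)
  next
    case True
    \<comment> \<open>\<open>emeasure_N_split\<close> indexes the prescribed states by time, not by
      position, so \<open>ts\<close> is inverted; it is injective on \<open>{..m}\<close> because it
      increases strictly.\<close>
    define y where "y t = (if t = ts (Suc m) then xs (Suc m) else xs (inv_into {..m} ts t))" for t
    have y: "y (ts i) = xs i" if "i \<le> m" for i
    proof -
      have "inj_on ts {..m}" using inj by (auto intro: inj_onI)
      moreover have "ts i \<noteq> ts (Suc m)" using mono[OF that order_refl] ts by fastforce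
      ultimately show ?thesis using that by (simp add: y_def inv_into_f_f)
    qed
    have y': "y (ts (Suc m)) = xs (Suc m)" by (simp add: y_def)
    have ev: "(\<forall>i\<le>m. count (ts i) \<omega> = xs i) \<longleftrightarrow> count ?s \<omega> = ?k \<and> (\<forall>t\<in>ts ` {..m}. count t \<omega> = y t)" for \<omega>
      using y by auto
    have ev': "(\<forall>i\<le>Suc m. count (ts i) \<omega> = xs i) \<longleftrightarrow>
        count ?s \<omega> = ?k \<and> (\<forall>t\<in>ts ` {..m}. count t \<omega> = y t) \<and> (\<forall>t\<in>{ts (Suc m)}. count t \<omega> = y t)" for \<omega>
      using ev y' by (auto simp: le_Suc_eq)
    define u where "u T = emeasure (PiM {..<?k} \<mu>) {x\<in>space (PiM {..<?k} \<mu>). ((\<forall>i<?k. \<forall>j<i. x j \<le> x i) \<and> (\<forall>i<?k. x i \<le> ?s)) \<and>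
      (\<forall>t\<in>T. card {i\<in>{..<?k}. x i \<le> t} = y t)}" for T
    define v where "v T = emeasure (PiM {?k..<d} \<mu>) {x\<in>space (PiM {?k..<d} \<mu>). ((\<forall>i\<in>{?k..<d}. \<forall>j\<in>{?k..<i}. x j \<le> x i) \<and> (\<forall>i\<in>{?k..<d}. ?s < x i)) \<and>
      (\<forall>t\<in>T. ?k + card {i\<in>{?k..<d}. x i \<le> t} = y t)}" for T
    have split: "measure N {x\<in>space N. count ?s x = ?k \<and> (\<forall>t\<in>T1. count t x = y t) \<and> (\<forall>t\<in>T2. count t x = y t)}
        = enn2real (u T1) * enn2real (v T2)"
      if "T1 = {} \<or> T1 = ts ` {..m}" "T2 = {} \<or> T2 = {ts (Suc m)}" for T1 T2
      unfolding measure_def u_def v_def using that s True mono ts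
      by (subst emeasure_N_split) (auto simp: enn2real_mult intro: less_imp_le)
    have "measure N {\<omega>\<in>space N. count ?s \<omega> = ?k} = enn2real (u {}) * enn2real (v {})"
      using split[of "{}" "{}"] by simp
    moreover have "measure N {\<omega>\<in>space N. \<forall>i\<le>m. count (ts i) \<omega> = xs i} = enn2real (u (ts ` {..m})) * enn2real (v {})"
      using split[of "ts ` {..m}" "{}"] unfolding ev by simp
    moreover have "measure N {\<omega>\<in>space N. count ?s \<omega> = ?k \<and> count (ts (Suc m)) \<omega> = xs (Suc m)} = enn2real (u {}) * enn2real (v {ts (Suc m)})"
      using split[of "{}" "{ts (Suc m)}"] y' by simp
    moreover have "measure N {\<omega>\<in>space N. \<forall>i\<le>Suc m. count (ts i) \<omega> = xs i} = enn2real (u (ts ` {..m})) * enn2real (v {ts (Suc m)})"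
      using split[of "ts ` {..m}" "{ts (Suc m)}"] unfolding ev' by simp
    ultimately show ?thesis by (simp only: mult.assoc mult.commute mult.left_commute)
  qed
qed

end

section \<open>Birth chains with truncated geometric marginals\<close>

definition geom_cdf :: "nat \<Rightarrow> nat \<Rightarrow> real \<Rightarrow> real" where
  "geom_cdf d k t = (\<Sum>i\<le>k. t ^ i) / (\<Sum>i\<le>d. t ^ i)"

text \<open>The flow out of \<open>{..k}\<close>, that is minus the derivative of
  \<open>geom_cdf d k\<close>, divided by the mass \<open>t ^ k / (\<Sum>i\<le>d. t ^ i)\<close> of
  state \<open>k\<close>. The quotient rule gives terms \<open>(m - i) * t ^ (i + m - 1)\<close>
  with \<open>i \<le> k < m\<close>; the power \<open>t ^ k\<close> is already cancelled, so nothing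
  is singular at 0.\<close>

definition birth_rate :: "nat \<Rightarrow> nat \<Rightarrow> real \<Rightarrow> real" where
  "birth_rate d k t = (\<Sum>i\<le>k. \<Sum>m\<in>{Suc k..d}. (real m - real i) * t ^ (i + (m - Suc k))) / (\<Sum>i\<le>d. t ^ i)"

lemma sum_powers_atMost_pos: "0 \<le> (t::real) \<Longrightarrow> 0 < (\<Sum>i\<le>d. t ^ i)"
  using sum_powers_pos[of t "Suc d"] by (simp add: lessThan_Suc_atMost)

lemma birth_rate_nonneg: "0 \<le> t \<Longrightarrow> 0 \<le> birth_rate d k t"
  unfolding birth_rate_def
  by (intro divide_nonneg_nonneg sum_nonneg mult_nonneg_nonneg zero_le_power) auto

text \<open>The rates of a birth chain with marginals \<open>t ^ k / (\<Sum>i\<le>d. t ^ i)\<close> are forced by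
  Kolmogorov's forward equation.\<close>
lemma geom_cdf_deriv:
  assumes t: "0 \<le> t" and k: "k \<le> d"
  shows "(geom_cdf d k has_real_derivative - birth_rate d k t * (t ^ k / (\<Sum>i\<le>d. t ^ i))) (at t)"
proof -
  let ?A = "\<Sum>i\<le>k. t ^ i" and ?B = "\<Sum>m\<in>{Suc k..d}. t ^ m" and ?S = "\<Sum>i\<le>d. t ^ i"
  let ?A' = "\<Sum>i\<le>k. real i * t ^ (i - 1)" and ?B' = "\<Sum>m\<in>{Suc k..d}. real m * t ^ (m - 1)"
  let ?S' = "\<Sum>i\<le>d. real i * t ^ (i - 1)"
  have S: "0 < ?S" using t by (rule sum_powers_atMost_pos)
  have un: "{..d} = {..k} \<union> {Suc k..d}" "{..k} \<inter> {Suc k..d} = {}" using k by auto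
  have split: "?S = ?A + ?B" "?S' = ?A' + ?B'"
    unfolding un(1) by (intro sum.union_disjoint; use un(2) in simp)+
  have "?A' * ?S - ?A * ?S' = ?A' * ?B - ?A * ?B'"
    unfolding split by (simp add: algebra_simps)
  also have "\<dots> = (\<Sum>i\<le>k. \<Sum>m\<in>{Suc k..d}. real i * t ^ (i - 1) * t ^ m - t ^ i * (real m * t ^ (m - 1)))"
    by (simp add: sum_product sum_subtractf)
  also have "\<dots> = (\<Sum>i\<le>k. \<Sum>m\<in>{Suc k..d}. - ((real m - real i) * t ^ (i + (m - Suc k))) * t ^ k)"
  proof (intro sum.cong refl)
    fix i m assume "m \<in> {Suc k..d}"
    then have "m = Suc (k + (m - Suc k))" by simp
    then obtain r where m: "m = Suc (k + r)" ..
    show "real i * t ^ (i - 1) * t ^ m - t ^ i * (real m * t ^ (m - 1)) = - ((real m - real i) * t ^ (i + (m - Suc k))) * t ^ k"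
      unfolding m by (cases i) (simp_all add: power_add algebra_simps)
  qed
  also have "\<dots> = - (birth_rate d k t * ?S) * t ^ k"
  proof -
    have "birth_rate d k t * ?S = (\<Sum>i\<le>k. \<Sum>m\<in>{Suc k..d}. (real m - real i) * t ^ (i + (m - Suc k)))"
      using S by (simp add: birth_rate_def)
    then show ?thesis by (simp only: sum_distrib_right sum_negf mult_minus_left)
  qed
  finally have num: "?A' * ?S - ?A * ?S' = - (birth_rate d k t * ?S) * t ^ k" .
  have "((\<lambda>t. (\<Sum>i\<le>k. t ^ i) / (\<Sum>i\<le>d. t ^ i)) has_real_derivative (?A' * ?S - ?A * ?S') / (?S * ?S)) (at t)"
  proof -
    have "((\<lambda>t. \<Sum>i\<le>l. t ^ i) has_real_derivative (\<Sum>i\<le>l. real i * t ^ (i - 1))) (at t)" for l :: nat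
      by (intro DERIV_sum) (simp add: DERIV_pow)
    from DERIV_divide[OF this this, of d k] show ?thesis using S by simp
  qed
  moreover have "(?A' * ?S - ?A * ?S') / (?S * ?S) = - birth_rate d k t * (t ^ k / ?S)"
    unfolding num using S by (simp add: field_simps)
  ultimately show ?thesis by (simp add: geom_cdf_def[abs_def])
qed

text \<open>The difference of two consecutive distribution functions: state \<open>Suc k\<close>
  gains the flow out of \<open>{..k}\<close> and loses the flow out of
  \<open>{..Suc k}\<close>.\<close>

lemma geom_pmf_deriv:
  assumes t: "0 \<le> t" and k: "Suc k \<le> d"
  shows "((\<lambda>t. t ^ Suc k / (\<Sum>i\<le>d. t ^ i)) has_real_derivative
    birth_rate d k t * (t ^ k / (\<Sum>i\<le>d. t ^ i)) - birth_rate d (Suc k) t * (t ^ Suc k / (\<Sum>i\<le>d. t ^ i))) (at t)"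
proof -
  have "((\<lambda>t. geom_cdf d (Suc k) t - geom_cdf d k t) has_real_derivative
    birth_rate d k t * (t ^ k / (\<Sum>i\<le>d. t ^ i)) - birth_rate d (Suc k) t * (t ^ Suc k / (\<Sum>i\<le>d. t ^ i))) (at t)"
    by (rule DERIV_cong[OF DERIV_diff[OF geom_cdf_deriv[OF t, of "Suc k" d] geom_cdf_deriv[OF t, of k d]]])
      (use k in auto)
  moreover have "(\<lambda>t. geom_cdf d (Suc k) t - geom_cdf d k t) = (\<lambda>t. t ^ Suc k / (\<Sum>i\<le>d. t ^ i))"
    by (simp add: geom_cdf_def fun_eq_iff diff_divide_distrib[symmetric])
  ultimately show ?thesis by simp
qed

text \<open>A bound vanishing at infinity: a state below \<open>d\<close> is eventually left, which
  later makes the cumulative rate diverge.\<close>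

lemma geom_cdf_le: "k < d \<Longrightarrow> 1 \<le> t \<Longrightarrow> geom_cdf d k t \<le> real (Suc k) / t"
proof -
  assume k: "k < d" and t: "1 \<le> t"
  have "(\<Sum>i\<le>k. t ^ i) \<le> (\<Sum>i\<le>k. t ^ k)"
    using t by (intro sum_mono power_increasing) auto
  then have "(\<Sum>i\<le>k. t ^ i) \<le> real (Suc k) * t ^ k" by simp
  moreover have "t ^ Suc k \<le> (\<Sum>i\<le>d. t ^ i)"
    using k t by (intro member_le_sum) auto
  ultimately have "geom_cdf d k t \<le> real (Suc k) * t ^ k / t ^ Suc k"
    unfolding geom_cdf_def using t by (intro frac_le) auto
  then show ?thesis using t by simp
qed

text \<open>The constant extension to negative times by \<open>max 0 t\<close> gives an
  antiderivative on the whole line, with a two-sided derivative also at 0.\<close>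

lemma ex_cumulative_rate:
  "\<exists>H. H 0 = 0 \<and> (\<forall>t. (H has_real_derivative birth_rate d k (max 0 t)) (at t))"
proof -
  have "isCont (\<lambda>t. birth_rate d k (max 0 t)) t" for t
  proof -
    have "(\<Sum>i\<le>d. max 0 t ^ i) \<noteq> 0" using sum_powers_atMost_pos[of "max 0 t" d] by simp
    then show ?thesis unfolding birth_rate_def by (intro continuous_intros)
  qed
  then obtain F where "\<forall>t. (F has_vector_derivative birth_rate d k (max 0 t)) (at t)"
    using einterval_antiderivative[of "-\<infinity>" "\<infinity>" "\<lambda>t. birth_rate d k (max 0 t)"] by auto
  then have F: "\<And>t. (F has_real_derivative birth_rate d k (max 0 t)) (at t)"
    by (simp add: has_real_derivative_iff_has_vector_derivative)
  have "((\<lambda>t. F t - F 0) has_real_derivative birth_rate d k (max 0 t)) (at t)" for t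
    using DERIV_diff[OF F[of t] DERIV_const[of "F 0"]] by simp
  then show ?thesis by (intro exI[of _ "\<lambda>t. F t - F 0"]) simp
qed

lemma ex_birth_density:
  "\<exists>g \<alpha> \<beta>. birth_density d g \<alpha> \<beta> \<and> (\<forall>k\<le>d. \<forall>t\<ge>0. \<alpha> k t * \<beta> k t = t ^ k / (\<Sum>l<Suc d. t ^ l))"
proof -
  define \<rho> where "\<rho> k t = birth_rate d k (max 0 t)" for k t
  obtain H where H0: "\<And>k. H k 0 = 0" and H: "\<And>k t. (H k has_real_derivative \<rho> k t) (at t)"
    unfolding \<rho>_def using ex_cumulative_rate[of d] by metis
  have \<rho>_nonneg: "0 \<le> \<rho> k t" for k t by (simp add: \<rho>_def birth_rate_nonneg)
  have \<rho>_eq: "0 \<le> t \<Longrightarrow> \<rho> k t = birth_rate d k t" for k t by (simp add: \<rho>_def)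
  define p where "p k t = t ^ k / (\<Sum>i\<le>d. t ^ i)" for k :: nat and t :: real
  \<comment> \<open>With \<open>x_k\<close> the jump time out of state \<open>k\<close>, survival in
    state \<open>k\<close> contributes \<open>exp (H k x_{k-1} - H k x_k)\<close>. Collecting the
    factors by \<open>x_k\<close> gives \<open>g k\<close>. Then \<open>\<beta> k\<close> is the
    probability of no jump out of \<open>k\<close> up to time \<open>t\<close>, seen from time 0,
    and \<open>\<alpha> k\<close> is forced by \<open>\<alpha> k * \<beta> k = p k\<close>.\<close>
  define g where "g k t = \<rho> k t * exp (H (Suc k) t - H k t)" for k t
  define \<alpha> where "\<alpha> k t = p k t * exp (H k t)" for k t
  define \<beta> where "\<beta> k t = exp (- H k t)" for k t
  have [measurable]: "H k \<in> borel_measurable borel" for k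
    by (intro borel_measurable_continuous_onI DERIV_continuous_on[OF H[THEN has_field_derivative_at_within]])
  have [measurable]: "\<rho> k \<in> borel_measurable borel" for k
    unfolding \<rho>_def birth_rate_def by measurable
  have p_nonneg: "0 \<le> t \<Longrightarrow> 0 \<le> p k t" for k t
    using sum_powers_atMost_pos[of t d] by (simp add: p_def)
  have p_deriv_0: "(p 0 has_real_derivative - \<rho> 0 t * p 0 t) (at t)" if "0 \<le> t" for t
    using geom_cdf_deriv[OF that, of 0 d] \<rho>_eq[OF that, of 0] by (simp add: p_def[abs_def] geom_cdf_def[abs_def])
  have p_deriv: "(p (Suc k) has_real_derivative \<rho> k t * p k t - \<rho> (Suc k) t * p (Suc k) t) (at t)" if "0 \<le> t" "k < d" for k t
    using geom_pmf_deriv[OF that(1), of k d] that(2) \<rho>_eq[OF that(1)] by (simp add: p_def[abs_def])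
  have "birth_density d g \<alpha> \<beta>"
  proof
    show "g l \<in> borel_measurable borel" for l unfolding g_def by measurable
    show "\<alpha> l \<in> borel_measurable borel" for l unfolding \<alpha>_def p_def by measurable
    show "\<beta> l \<in> borel_measurable borel" for l unfolding \<beta>_def by measurable
    show "0 \<le> g l s" for l s unfolding g_def using \<rho>_nonneg by simp
    show "0 \<le> \<alpha> l s" if "0 \<le> s" for l s unfolding \<alpha>_def using p_nonneg[OF that] by simp
    show "0 \<le> \<beta> l s" for l s by (simp add: \<beta>_def)
    show "\<beta> 0 0 = 1" by (simp add: \<beta>_def H0)
    show "\<alpha> 0 s = 1" if "0 \<le> s" for s
    proof -
      \<comment> \<open>The forward equation for state 0 has no gain term, so
        \<open>exp (H 0)\<close> compensates the loss exactly.\<close>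
      have "(\<alpha> 0 has_real_derivative 0) (at t)" if "0 \<le> t" for t
        unfolding \<alpha>_def[abs_def]
        by (rule DERIV_cong[OF DERIV_mult[OF p_deriv_0[OF that] DERIV_chain2[OF DERIV_exp H]]])
          (simp add: algebra_simps)
      then obtain c where "\<forall>t\<in>{0..}. \<alpha> 0 t = c"
        using has_field_derivative_zero_constant[of "{0::real..}" "\<alpha> 0"]
        by (auto intro: has_field_derivative_at_within)
      then have "\<alpha> 0 s = \<alpha> 0 0" using that by simp
      then show ?thesis by (simp add: \<alpha>_def p_def H0 power_0_left)
    qed
    show "\<beta> d s = 1" if "0 \<le> s" for s
    proof -
      \<comment> \<open>State \<open>d\<close> is absorbing: its rate is a sum over the empty range
        \<open>{Suc d..d}\<close>.\<close>
      have "(H d has_real_derivative 0) (at t)" for t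
        using H[of d t] by (simp add: \<rho>_def birth_rate_def)
      then have "H d s = H d 0" by (intro DERIV_isconst_all) simp
      then show ?thesis by (simp add: \<beta>_def H0)
    qed
    show "(\<integral>\<^sup>+x. ennreal (g l x * \<alpha> l x) * indicator {0..s} x \<partial>lborel) = ennreal (\<alpha> (Suc l) s)"
      if "l < d" "0 \<le> s" for l s
    proof -
      have "(\<alpha> (Suc l) has_real_derivative g l x * \<alpha> l x) (at x)" if "0 \<le> x" for x
        unfolding \<alpha>_def[abs_def]
        by (rule DERIV_cong[OF DERIV_mult[OF p_deriv[OF that \<open>l < d\<close>] DERIV_chain2[OF DERIV_exp H]]])
          (simp add: g_def exp_diff algebra_simps)
      moreover have "(\<lambda>x. g l x * \<alpha> l x) \<in> borel_measurable borel"
        unfolding g_def \<alpha>_def p_def by measurable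
      moreover have "0 \<le> g l x * \<alpha> l x" if "0 \<le> x" for x
        unfolding g_def \<alpha>_def using \<rho>_nonneg[of l x] p_nonneg[OF that, of l] by simp
      ultimately have "(\<integral>\<^sup>+x. ennreal (g l x * \<alpha> l x) * indicator {0..s} x \<partial>lborel) = ennreal (\<alpha> (Suc l) s - \<alpha> (Suc l) 0)"
        using that(2) by (intro nn_integral_FTC_Icc) auto
      then show ?thesis by (simp add: \<alpha>_def p_def)
    qed
    show "(\<integral>\<^sup>+x. ennreal (g l x * \<beta> (Suc l) x) * indicator {s..} x \<partial>lborel) = ennreal (\<beta> l s)"
      if "l < d" "0 \<le> s" for l s
    proof -
      have eq: "g l x * \<beta> (Suc l) x = \<rho> l x * exp (- H l x)" for x
        by (simp add: g_def \<beta>_def exp_diff exp_minus field_simps)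
      \<comment> \<open>The product starts at 1 and does not decrease, since the mass of state
        \<open>l\<close> is at most that of \<open>{..l}\<close>. Hence \<open>exp (- H l)\<close>
        is dominated by \<open>geom_cdf d l\<close>, which tends to 0 because
        \<open>l < d\<close>.\<close>
      have mono: "1 \<le> geom_cdf d l t * exp (H l t)" if "0 \<le> t" for t
      proof -
        have "geom_cdf d l 0 * exp (H l 0) \<le> geom_cdf d l t * exp (H l t)"
        proof (rule DERIV_nonneg_imp_nondecreasing[OF that])
          fix x :: real assume x: "0 \<le> x"
          have "((\<lambda>x. geom_cdf d l x * exp (H l x)) has_real_derivative
              \<rho> l x * exp (H l x) * (geom_cdf d l x - p l x)) (at x)"
            by (rule DERIV_cong[OF DERIV_mult[OF geom_cdf_deriv[OF x] DERIV_chain2[OF DERIV_exp H]]])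
              (use \<open>l < d\<close> x in \<open>auto simp: \<rho>_eq p_def algebra_simps\<close>)
          moreover have "p l x \<le> geom_cdf d l x"
            unfolding p_def geom_cdf_def using x sum_powers_atMost_pos[OF x, of d]
            by (intro divide_right_mono member_le_sum) auto
          ultimately show "\<exists>y. ((\<lambda>x. geom_cdf d l x * exp (H l x)) has_real_derivative y) (at x) \<and> 0 \<le> y"
            using \<rho>_nonneg[of l x]
            by (intro exI[of _ "\<rho> l x * exp (H l x) * (geom_cdf d l x - p l x)"] conjI mult_nonneg_nonneg) auto
        qed
        then show ?thesis by (simp add: geom_cdf_def H0 power_0_left)
      qed
      have "((\<lambda>t. exp (- H l t)) \<longlongrightarrow> 0) at_top"
      proof (rule tendsto_sandwich[of "\<lambda>_. 0" _ _ "\<lambda>t. real (Suc l) / t"])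
        show "\<forall>\<^sub>F t in at_top. exp (- H l t) \<le> real (Suc l) / t"
          using eventually_ge_at_top[of 1]
        proof eventually_elim
          case (elim t)
          have "exp (- H l t) \<le> geom_cdf d l t"
            using mono[of t] elim by (simp add: exp_minus field_simps)
          then show ?case using geom_cdf_le[OF \<open>l < d\<close> elim] by simp
        qed
        show "((\<lambda>t. real (Suc l) / t) \<longlongrightarrow> 0) at_top"
          by (rule tendsto_divide_0[OF tendsto_const filterlim_at_top_imp_at_infinity[OF filterlim_ident]])
      qed auto
      then have lim: "((\<lambda>t. - exp (- H l t)) \<longlongrightarrow> - 0) at_top" by (rule tendsto_minus)
      have "(\<integral>\<^sup>+x. ennreal (\<rho> l x * exp (- H l x)) * indicator {s..} x \<partial>lborel) = ennreal (- 0 - (- exp (- H l s)))"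
      proof (rule nn_integral_FTC_atLeast[OF _ _ _ lim])
        show "((\<lambda>t. - exp (- H l t)) has_real_derivative \<rho> l x * exp (- H l x)) (at x)" for x
          by (rule DERIV_cong[OF DERIV_minus[OF DERIV_chain2[OF DERIV_exp DERIV_minus[OF H]]]]) simp
      qed (auto simp: \<rho>_nonneg)
      then show ?thesis unfolding eq by (simp add: \<beta>_def)
    qed
  qed
  moreover have "\<alpha> k t * \<beta> k t = t ^ k / (\<Sum>l<Suc d. t ^ l)" for k t
    by (simp add: \<alpha>_def \<beta>_def p_def exp_minus lessThan_Suc_atMost field_simps)
  ultimately show ?thesis by blast
qed

lemma ex_birth_chain:
  obtains N :: "(nat \<Rightarrow> real) measure" where
    "prob_space N" "\<And>i. (\<lambda>x. x i) \<in> borel_measurable N"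
    "AE x in N. \<forall>i<d. \<forall>j<i. x j < x i" "\<And>i c. i < d \<Longrightarrow> AE x in N. x i \<noteq> c"
    "\<And>t k. 0 \<le> t \<Longrightarrow> k \<le> d \<Longrightarrow>
      measure N {x\<in>space N. card {i\<in>{..<d}. x i \<le> t} = k} = t ^ k / (\<Sum>l<Suc d. t ^ l)"
    "markov_process N (\<lambda>t x. card {i\<in>{..<d}. x i \<le> t})"
proof -
  obtain g \<alpha> \<beta> where B: "birth_density d g \<alpha> \<beta>"
      and \<alpha>\<beta>: "\<And>k t. k \<le> d \<Longrightarrow> 0 \<le> t \<Longrightarrow> \<alpha> k t * \<beta> k t = t ^ k / (\<Sum>l<Suc d. t ^ l)"
    using ex_birth_density[of d] by blast
  interpret birth_density d g \<alpha> \<beta> by fact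
  show thesis
  proof (rule that[OF prob_space_N _ AE_N_strict AE_N_neq])
    show "(\<lambda>x. x i) \<in> borel_measurable N" for i
      using measurable_coordinate[of i "{..<d}"] by (simp add: N_def)
    show "measure N {x\<in>space N. card {i\<in>{..<d}. x i \<le> t} = k} = t ^ k / (\<Sum>l<Suc d. t ^ l)"
      if "0 \<le> t" "k \<le> d" for t k
      using measure_count[OF that] \<alpha>\<beta>[OF that(2,1)] by (simp add: count_def)
    show "markov_process N (\<lambda>t x. card {i\<in>{..<d}. x i \<le> t})"
      using markov_count by (simp add: count_def[abs_def])
  qed
qed

section \<open>Existence\<close>

text \<open>The requirements that the process definitions impose at every sample point, gathered so
  that the paths violating them can be removed at once.\<close>

definition good_path :: "nat \<Rightarrow> (real \<Rightarrow> nat \<Rightarrow> nat) \<Rightarrow> bool" where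
  "good_path n f \<longleftrightarrow> cadlag_discrete f \<and>
    (\<forall>t t'. 0 \<le> t \<and> t < t' \<longrightarrow> (\<forall>j\<in>{1..n}. Inv_j (f t) j \<le> Inv_j (f t') j)) \<and>
    (\<forall>t>0. Inv n (f t) \<le> Inv n (left_lim f t) + 1)"

lemma good_path_const: "good_path n (\<lambda>_. \<sigma>)"
proof -
  have "cadlag_discrete (\<lambda>_. \<sigma>)" unfolding cadlag_discrete_def by (auto intro: exI[of _ 1])
  moreover have "left_lim (\<lambda>_. \<sigma>) t = \<sigma>" for t by (rule left_lim_eqI[of 1]) auto
  ultimately show ?thesis by (simp add: good_path_def)
qed

text \<open>The canonical process on the space of good paths, which need not be a measurable subset.\<close>
lemma regular_mallows_markov_canonical:
  fixes N :: "'c measure" and X :: "real \<Rightarrow> 'c \<Rightarrow> nat \<Rightarrow> nat"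
  assumes N: "prob_space N"
    and X: "\<And>t. X t \<in> measurable N (count_space (Sn n))"
    and good: "AE \<omega> in N. good_path n (\<lambda>t. X t \<omega>)"
    and markov: "markov_process N X" and mallows: "mallows_process n N X"
    and indep: "independent_inversions n N X"
  shows "\<exists>(M :: (real \<Rightarrow> nat \<Rightarrow> nat) measure) X'. regular_mallows_markov n M X'"
proof -
  interpret N: prob_space N by fact
  obtain N0 where N0: "{\<omega>\<in>space N. \<not> good_path n (\<lambda>t. X t \<omega>)} \<subseteq> N0" "emeasure N N0 = 0" "N0 \<in> sets N"
    using good by (rule AE_E)
  define P where "P = PiM (UNIV :: real set) (\<lambda>_. count_space (Sn n))"
  define G where "G = Collect (good_path n)"
  \<comment> \<open>\<open>N0\<close> is a measurable null set containing all bad sample points;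
    there the path is replaced by the constant identity, which is good.\<close>
  define \<Phi> where "\<Phi> \<omega> = (if \<omega> \<in> N0 then (\<lambda>_. id) else (\<lambda>t. X t \<omega>))" for \<omega>
  define M where "M = distr N (restrict_space P G) \<Phi>"
  define X' where "X' t p = p t" for t and p :: "real \<Rightarrow> nat \<Rightarrow> nat"
  have \<Phi>_AE: "AE \<omega> in N. \<Phi> \<omega> = (\<lambda>t. X t \<omega>)"
  proof -
    have "AE \<omega> in N. \<omega> \<notin> N0" using N0 by (intro AE_not_in) (auto simp: null_sets_def)
    then show ?thesis by eventually_elim (simp add: \<Phi>_def)
  qed
  have id_Sn: "id \<in> Sn n" by (simp add: Sn_def permutes_id)
  have \<Phi>_P: "\<Phi> \<in> measurable N P"
    unfolding P_def
  proof (rule measurable_PiM_single')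
    fix t :: real
    have "(\<lambda>\<omega>. if \<omega> \<in> N0 then id else X t \<omega>) \<in> measurable N (count_space (Sn n))"
      using N0(3) X[of t] id_Sn by (intro measurable_If_set) auto
    then show "(\<lambda>\<omega>. \<Phi> \<omega> t) \<in> measurable N (count_space (Sn n))"
      by (rule back_subst[of "\<lambda>f. f \<in> _"]) (auto simp: \<Phi>_def)
  next
    show "\<Phi> \<in> space N \<rightarrow> UNIV \<rightarrow>\<^sub>E space (count_space (Sn n))"
      using id_Sn measurable_space[OF X] by (auto simp: \<Phi>_def)
  qed
  have \<Phi>_G: "\<Phi> \<omega> \<in> G" if "\<omega> \<in> space N" for \<omega>
    using that N0(1) good_path_const by (auto simp: \<Phi>_def G_def)
  have \<Phi>: "\<Phi> \<in> measurable N (restrict_space P G)"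
    using \<Phi>_G \<Phi>_P by (intro measurable_restrict_space2) auto
  interpret M: prob_space M unfolding M_def by (rule N.prob_space_distr[OF \<Phi>])
  have space_M: "space M = G \<inter> space P" by (simp add: M_def space_restrict_space)
  have X'_restrict: "X' t \<in> measurable (restrict_space P G) (count_space (Sn n))" for t
    unfolding P_def X'_def by (intro measurable_restrict_space1 measurable_component_singleton) auto
  then have X': "X' t \<in> measurable M (count_space (Sn n))" for t
    by (simp add: M_def)
  have X_UNIV: "X t \<in> measurable N (count_space UNIV)" for t
    using measurable_compose[OF X, of "\<lambda>x. x" "count_space UNIV"] by simp
  have X'_UNIV: "X' t \<in> measurable M (count_space UNIV)" for t
    using measurable_compose[OF X', of "\<lambda>x. x" "count_space UNIV"] by simp
  \<comment> \<open>Finite sets of time-state pairs cover every event in the Markov and the Mallows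
    property, so those two carry over by rewriting.\<close>
  have transfer: "measure M {p\<in>space M. \<forall>(t, x)\<in>F. X' t p = x} = measure N {\<omega>\<in>space N. \<forall>(t, x)\<in>F. X t \<omega> = x}"
    if F: "finite F" for F
  proof -
    have ev: "{\<omega>\<in>space K. \<forall>(t, x)\<in>F. Y t \<omega> = x} \<in> sets K"
      if "\<And>t. Y t \<in> measurable K (count_space UNIV)" for K :: "'x measure" and Y :: "real \<Rightarrow> 'x \<Rightarrow> nat \<Rightarrow> nat"
    proof -
      have "{\<omega>\<in>space K. Y t \<omega> = x} \<in> sets K" for t x
        using measurable_sets[OF that[of t], of "{x}"] by (simp add: vimage_def Int_def conj_commute)
      then show ?thesis using F by (intro sets.sets_Collect_finite_All) (auto split: prod.splits)
    qed
    have "measure M {p\<in>space M. \<forall>(t, x)\<in>F. X' t p = x}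
        = measure N (\<Phi> -` {p\<in>space M. \<forall>(t, x)\<in>F. X' t p = x} \<inter> space N)"
      using ev[OF X'_UNIV] unfolding M_def by (intro measure_distr[OF \<Phi>]) simp
    also have "\<dots> = measure N {\<omega>\<in>space N. \<forall>(t, x)\<in>F. X t \<omega> = x}"
    proof (rule measure_eq_AE)
      show "AE \<omega> in N. (\<omega> \<in> \<Phi> -` {p\<in>space M. \<forall>(t, x)\<in>F. X' t p = x} \<inter> space N)
          = (\<omega> \<in> {\<omega>\<in>space N. \<forall>(t, x)\<in>F. X t \<omega> = x})"
        using \<Phi>_AE AE_space
      proof eventually_elim
        case (elim \<omega>)
        have "\<Phi> \<omega> \<in> space M" using measurable_space[OF \<Phi> elim(2)] by (simp add: M_def)
        then show ?case using elim by (simp add: X'_def)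
      qed
      show "\<Phi> -` {p\<in>space M. \<forall>(t, x)\<in>F. X' t p = x} \<inter> space N \<in> sets N"
      proof (rule measurable_sets[OF \<Phi>])
        show "{p\<in>space M. \<forall>(t, x)\<in>F. X' t p = x} \<in> sets (restrict_space P G)"
          using ev[OF X'_UNIV] by (simp add: M_def)
      qed
    qed (rule ev[OF X_UNIV])
    finally show ?thesis .
  qed
  have fd: "measure M {p\<in>space M. \<forall>i\<le>m. X' (ts i) p = xs i} = measure N {\<omega>\<in>space N. \<forall>i\<le>m. X (ts i) \<omega> = xs i}"
    for m :: nat and ts xs
    using transfer[of "(\<lambda>i. (ts i, xs i)) ` {..m}"] by (simp add: atMost_iff[symmetric] Ball_def[symmetric] del: atMost_iff)
  have one: "measure M {p\<in>space M. X' t p = x} = measure N {\<omega>\<in>space N. X t \<omega> = x}" for t x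
    using transfer[of "{(t, x)}"] by simp
  have two: "measure M {p\<in>space M. X' t p = x \<and> X' s p = y} = measure N {\<omega>\<in>space N. X t \<omega> = x \<and> X s \<omega> = y}" for s t x y
    using transfer[of "{(t, x), (s, y)}"] by simp
  have paths: "good_path n (\<lambda>t. X' t p)" if "p \<in> space M" for p
    using that by (simp add: space_M G_def X'_def)
  have "perm_process n M X'"
    using X' by (simp add: perm_process_def M.prob_space_axioms)
  moreover have "cadlag_process M X'"
    using paths by (simp add: cadlag_process_def good_path_def)
  moreover have "markov_process M X'"
    using markov unfolding markov_process_def fd one two .
  moreover have "mallows_process n M X'"
    using mallows unfolding mallows_process_def one .
  moreover have "smooth_process n M X'"
    using paths by (simp add: smooth_process_def strongly_monotone_def good_path_def)
  moreover have "independent_inversions n M X'"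
  proof (cases "n = 0")
    case True
    then show ?thesis by (simp add: independent_inversions_def M.indep_vars_def M.indep_sets_def)
  next
    case False
    let ?Q = "PiM {0::real..} (\<lambda>_. count_space (UNIV :: nat set))"
    let ?Y' = "\<lambda>j p. restrict (\<lambda>t. Inv_j (X' t p) j) {0..}"
    let ?Y = "\<lambda>j \<omega>. restrict (\<lambda>t. Inv_j (X t \<omega>) j) {0..}"
    let ?I = "{1..n}"
    have Y': "?Y' j \<in> measurable (restrict_space P G) ?Q" for j
      by (intro measurable_restrict measurable_compose[OF X'_restrict]) simp
    have Y'M: "?Y' j \<in> measurable M ?Q" for j
      using Y' by (simp add: M_def)
    have Y: "?Y j \<in> measurable N ?Q" for j
      by (intro measurable_restrict measurable_compose[OF X]) simp
    \<comment> \<open>Independence is expressed as equality of the joint law with the product of the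
      marginal laws. Both sides are the same for \<open>M\<close> and \<open>N\<close>, because
      \<open>\<Phi>\<close> changes the process on a null set only.\<close>
    have "distr M (PiM ?I (\<lambda>_. ?Q)) (\<lambda>p. \<lambda>j\<in>?I. ?Y' j p) = distr N (PiM ?I (\<lambda>_. ?Q)) ((\<lambda>p. \<lambda>j\<in>?I. ?Y' j p) \<circ> \<Phi>)"
      unfolding M_def by (intro distr_distr \<Phi> measurable_restrict Y')
    also have "\<dots> = distr N (PiM ?I (\<lambda>_. ?Q)) (\<lambda>\<omega>. \<lambda>j\<in>?I. ?Y j \<omega>)"
    proof (rule distr_cong_AE)
      show "AE \<omega> in N. ((\<lambda>p. \<lambda>j\<in>?I. ?Y' j p) \<circ> \<Phi>) \<omega> = (\<lambda>j\<in>?I. ?Y j \<omega>)"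
        using \<Phi>_AE by eventually_elim (simp add: X'_def)
      show "(\<lambda>p. \<lambda>j\<in>?I. ?Y' j p) \<circ> \<Phi> \<in> measurable N (PiM ?I (\<lambda>_. ?Q))"
        by (intro measurable_comp[OF \<Phi>] measurable_restrict Y')
      show "(\<lambda>\<omega>. \<lambda>j\<in>?I. ?Y j \<omega>) \<in> measurable N (PiM ?I (\<lambda>_. ?Q))"
        by (intro measurable_restrict Y)
    qed auto
    also have "\<dots> = PiM ?I (\<lambda>j. distr N ?Q (?Y j))"
      using indep False Y unfolding independent_inversions_def
      by (subst N.indep_vars_iff_distr_eq_PiM'[symmetric]) auto
    also have "\<dots> = PiM ?I (\<lambda>j. distr M ?Q (?Y' j))"
    proof (rule PiM_cong[OF refl])
      fix j
      have "distr M ?Q (?Y' j) = distr N ?Q (?Y' j \<circ> \<Phi>)"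
        unfolding M_def by (intro distr_distr \<Phi> Y')
      also have "\<dots> = distr N ?Q (?Y j)"
      proof (rule distr_cong_AE)
        show "AE \<omega> in N. (?Y' j \<circ> \<Phi>) \<omega> = ?Y j \<omega>"
          using \<Phi>_AE by eventually_elim (simp add: X'_def)
        show "?Y' j \<circ> \<Phi> \<in> measurable N ?Q" by (intro measurable_comp[OF \<Phi>] Y')
      qed (auto intro: Y)
      finally show "distr N ?Q (?Y j) = distr M ?Q (?Y' j)" by simp
    qed
    finally show ?thesis
      using False Y'M unfolding independent_inversions_def
      by (subst M.indep_vars_iff_distr_eq_PiM') auto
  qed
  ultimately have "regular_mallows_markov n M X'"
    by (simp add: regular_mallows_markov_def regular_process_def)
  then show ?thesis by blast
qed

definition perm_of :: "nat \<Rightarrow> (nat \<Rightarrow> nat) \<Rightarrow> nat \<Rightarrow> nat" where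
  "perm_of n c = (SOME \<sigma>. \<sigma> \<in> Sn n \<and> (\<forall>j\<in>{1..n}. Inv_j \<sigma> j = c j))"

lemma perm_of:
  assumes "\<And>j. j \<in> {1..n} \<Longrightarrow> c j < j"
  shows "perm_of n c \<in> Sn n" "j \<in> {1..n} \<Longrightarrow> Inv_j (perm_of n c) j = c j"
proof -
  have "\<exists>\<sigma>. \<sigma> \<in> Sn n \<and> (\<forall>j\<in>{1..n}. Inv_j \<sigma> j = c j)"
    using ex_Inv_j[of n c] assms by blast
  then have "perm_of n c \<in> Sn n \<and> (\<forall>j\<in>{1..n}. Inv_j (perm_of n c) j = c j)"
    unfolding perm_of_def by (rule someI_ex)
  then show "perm_of n c \<in> Sn n" "j \<in> {1..n} \<Longrightarrow> Inv_j (perm_of n c) j = c j" by auto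
qed

section \<open>Permutation paths driven by finitely many jump times\<close>

lemma ex_gap_right:
  fixes \<tau> :: "'k \<Rightarrow> real"
  assumes "finite K"
  shows "\<exists>e>0. \<forall>s\<in>{t..<t+e}. {\<kappa>\<in>K. \<tau> \<kappa> \<le> s} = {\<kappa>\<in>K. \<tau> \<kappa> \<le> t}"
proof -
  have "\<forall>\<^sub>F s in at_right t. \<forall>\<kappa>\<in>K. \<tau> \<kappa> \<le> s \<longleftrightarrow> \<tau> \<kappa> \<le> t"
  proof (intro eventually_ball_finite assms ballI)
    fix \<kappa>
    show "\<forall>\<^sub>F s in at_right t. \<tau> \<kappa> \<le> s \<longleftrightarrow> \<tau> \<kappa> \<le> t"
    proof (cases "\<tau> \<kappa> \<le> t")
      case True
      then show ?thesis by (auto simp: eventually_at_right_field intro!: exI[of _ "t + 1"])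
    next
      case False
      then show ?thesis by (auto simp: eventually_at_right_field intro!: exI[of _ "\<tau> \<kappa>"])
    qed
  qed
  then obtain b where b: "b > t" "\<And>s. t < s \<Longrightarrow> s < b \<Longrightarrow> \<forall>\<kappa>\<in>K. \<tau> \<kappa> \<le> s \<longleftrightarrow> \<tau> \<kappa> \<le> t"
    by (auto simp: eventually_at_right_field)
  show ?thesis
  proof (intro exI[of _ "b - t"] conjI ballI)
    fix s assume "s \<in> {t..<t + (b - t)}"
    then show "{\<kappa>\<in>K. \<tau> \<kappa> \<le> s} = {\<kappa>\<in>K. \<tau> \<kappa> \<le> t}"
      using b(2)[of s] by (cases "s = t") auto
  qed (use b in simp)
qed

lemma ex_gap_left:
  fixes \<tau> :: "'k \<Rightarrow> real"
  assumes "finite K"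
  shows "\<exists>e>0. \<forall>s\<in>{t-e<..<t}. {\<kappa>\<in>K. \<tau> \<kappa> \<le> s} = {\<kappa>\<in>K. \<tau> \<kappa> < t}"
proof -
  have "\<forall>\<^sub>F s in at_left t. \<forall>\<kappa>\<in>K. \<tau> \<kappa> \<le> s \<longleftrightarrow> \<tau> \<kappa> < t"
  proof (intro eventually_ball_finite assms ballI)
    fix \<kappa>
    show "\<forall>\<^sub>F s in at_left t. \<tau> \<kappa> \<le> s \<longleftrightarrow> \<tau> \<kappa> < t"
    proof (cases "\<tau> \<kappa> < t")
      case True
      then show ?thesis by (auto simp: eventually_at_left_field intro!: exI[of _ "\<tau> \<kappa>"])
    next
      case False
      then show ?thesis by (auto simp: eventually_at_left_field intro!: exI[of _ "t - 1"])
    qed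
  qed
  then obtain b where b: "b < t" "\<And>s. b < s \<Longrightarrow> s < t \<Longrightarrow> \<forall>\<kappa>\<in>K. \<tau> \<kappa> \<le> s \<longleftrightarrow> \<tau> \<kappa> < t"
    by (auto simp: eventually_at_left_field)
  show ?thesis
  proof (intro exI[of _ "t - b"] conjI ballI)
    fix s assume "s \<in> {t - (t - b)<..<t}"
    then show "{\<kappa>\<in>K. \<tau> \<kappa> \<le> s} = {\<kappa>\<in>K. \<tau> \<kappa> < t}"
      using b(2)[of s] by auto
  qed (use b in simp)
qed

text \<open>The pair \<open>(j, i)\<close> stands for jump number \<open>i\<close>, counted from 0,
  of coordinate \<open>j\<close>, which climbs from 0 to \<open>j - 1\<close>.\<close>

definition jump_index :: "nat \<Rightarrow> (nat \<times> nat) set" where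
  "jump_index n = (SIGMA j:{1..n}. {..<j - 1})"

text \<open>\<open>A\<close> is the set of jumps already made. Only their number per coordinate
  enters, so every \<open>A\<close> yields an admissible code.\<close>

definition perm_of_jumps :: "nat \<Rightarrow> (nat \<times> nat) set \<Rightarrow> nat \<Rightarrow> nat" where
  "perm_of_jumps n A = perm_of n (\<lambda>j. card {i\<in>{..<j - 1}. (j, i) \<in> A})"

lemma finite_jump_index: "finite (jump_index n)"
  by (simp add: jump_index_def)

lemma perm_of_jumps:
  shows "perm_of_jumps n A \<in> Sn n"
    and "j \<in> {1..n} \<Longrightarrow> Inv_j (perm_of_jumps n A) j = card {i\<in>{..<j - 1}. (j, i) \<in> A}"
proof -
  have *: "card {i\<in>{..<j - 1}. (j, i) \<in> A} < j" if "j \<in> {1..n}" for j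
  proof -
    have "card {i\<in>{..<j - 1}. (j, i) \<in> A} \<le> card {..<j - 1}" by (intro card_mono) auto
    then show ?thesis using that by auto
  qed
  show "perm_of_jumps n A \<in> Sn n"
    "j \<in> {1..n} \<Longrightarrow> Inv_j (perm_of_jumps n A) j = card {i\<in>{..<j - 1}. (j, i) \<in> A}"
    unfolding perm_of_jumps_def using perm_of[of n "\<lambda>j. card {i\<in>{..<j - 1}. (j, i) \<in> A}"] * by blast+
qed

lemma Inv_perm_of_jumps:
  assumes "A \<subseteq> jump_index n"
  shows "Inv n (perm_of_jumps n A) = card A"
proof -
  have "A = (SIGMA j:{1..n}. {i\<in>{..<j - 1}. (j, i) \<in> A})"
    using assms by (auto simp: jump_index_def)
  then have "card A = card (SIGMA j:{1..n}. {i\<in>{..<j - 1}. (j, i) \<in> A})" by (rule arg_cong)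
  also have "\<dots> = (\<Sum>j\<in>{1..n}. card {i\<in>{..<j - 1}. (j, i) \<in> A})" by (rule card_SigmaI) auto
  finally show ?thesis by (simp add: Inv_eq_sum_Inv_j perm_of_jumps)
qed

text \<open>The inversion number at \<open>t\<close> counts the jump times up to \<open>t\<close>,
  its left limit those strictly before \<open>t\<close>. Injectivity of \<open>\<tau>\<close> leaves
  at most one jump time equal to \<open>t\<close>.\<close>

lemma good_path_perm_of_jumps:
  fixes \<tau> :: "nat \<times> nat \<Rightarrow> real"
  assumes inj: "inj_on \<tau> (jump_index n)"
  shows "good_path n (\<lambda>t. perm_of_jumps n {\<kappa>\<in>jump_index n. \<tau> \<kappa> \<le> t})" (is "good_path n ?f")
proof -
  let ?K = "jump_index n"
  have left: "\<exists>e>0. \<forall>s\<in>{t-e<..<t}. ?f s = perm_of_jumps n {\<kappa>\<in>?K. \<tau> \<kappa> < t}" for t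
  proof -
    obtain e where "0 < e" "\<forall>s\<in>{t-e<..<t}. {\<kappa>\<in>?K. \<tau> \<kappa> \<le> s} = {\<kappa>\<in>?K. \<tau> \<kappa> < t}"
      using ex_gap_left[OF finite_jump_index] by blast
    then show ?thesis by (intro exI[of _ e]) simp
  qed
  have "cadlag_discrete ?f"
    unfolding cadlag_discrete_def
  proof (intro conjI allI impI)
    show "\<exists>y. \<exists>e>0. \<forall>s\<in>{t-e<..<t}. ?f s = y" for t
      by (rule exI, rule left)
    fix t
    obtain e where e: "0 < e" "\<And>s. s \<in> {t..<t+e} \<Longrightarrow> {\<kappa>\<in>?K. \<tau> \<kappa> \<le> s} = {\<kappa>\<in>?K. \<tau> \<kappa> \<le> t}"
      using ex_gap_right[OF finite_jump_index] by blast
    show "\<exists>e>0. \<forall>s\<in>{t..<t+e}. ?f s = ?f t"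
    proof (intro exI[of _ e] conjI ballI e(1))
      show "?f s = ?f t" if "s \<in> {t..<t+e}" for s by (simp only: e(2)[OF that])
    qed
  qed
  moreover have "Inv_j (?f t) j \<le> Inv_j (?f t') j" if "t < t'" "j \<in> {1..n}" for t t' j
    using that by (auto simp: perm_of_jumps intro!: card_mono)
  moreover have "Inv n (?f t) \<le> Inv n (left_lim ?f t) + 1" for t
  proof -
    obtain e where "0 < e" "\<And>s. s \<in> {t-e<..<t} \<Longrightarrow> ?f s = perm_of_jumps n {\<kappa>\<in>?K. \<tau> \<kappa> < t}"
      using left[of t] by blast
    then have l: "left_lim ?f t = perm_of_jumps n {\<kappa>\<in>?K. \<tau> \<kappa> < t}" by (rule left_lim_eqI)
    have "{\<kappa>\<in>?K. \<tau> \<kappa> \<le> t} = {\<kappa>\<in>?K. \<tau> \<kappa> < t} \<union> {\<kappa>\<in>?K. \<tau> \<kappa> = t}" by auto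
    then have "card {\<kappa>\<in>?K. \<tau> \<kappa> \<le> t} \<le> card {\<kappa>\<in>?K. \<tau> \<kappa> < t} + card {\<kappa>\<in>?K. \<tau> \<kappa> = t}"
      by (simp add: card_Un_le)
    moreover have "card {\<kappa>\<in>?K. \<tau> \<kappa> = t} \<le> 1"
      using finite_jump_index[of n] inj by (subst card_le_Suc0_iff_eq[folded One_nat_def]) (auto dest: inj_onD)
    ultimately show ?thesis unfolding l by (subst (1 2) Inv_perm_of_jumps) auto
  qed
  ultimately show ?thesis unfolding good_path_def by blast
qed

text \<open>Chain \<open>j\<close> has \<open>j - 1\<close> jumps; the densities are no longer
  visible. \<open>C_strict\<close> separates the jump times within a chain, \<open>C_neq\<close>
  (absence of atoms) those of different chains.\<close>

locale birth_chains =
  fixes n :: nat and C :: "nat \<Rightarrow> (nat \<Rightarrow> real) measure"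
  assumes prob_space_C: "\<And>j. prob_space (C j)"
    and measurable_C: "\<And>j i. (\<lambda>x. x i) \<in> borel_measurable (C j)"
    and C_strict: "\<And>j. AE x in C j. \<forall>i<j - 1. \<forall>k<i. x k < x i"
    and C_neq: "\<And>j i c. i < j - 1 \<Longrightarrow> AE x in C j. x i \<noteq> c"
    and C_count: "\<And>j t k. 0 \<le> t \<Longrightarrow> k \<le> j - 1 \<Longrightarrow>
      measure (C j) {x\<in>space (C j). card {i\<in>{..<j - 1}. x i \<le> t} = k} = t ^ k / (\<Sum>l<Suc (j - 1). t ^ l)"
    and C_markov: "\<And>j. markov_process (C j) (\<lambda>t x. card {i\<in>{..<j - 1}. x i \<le> t})"
begin

definition N :: "(nat \<Rightarrow> nat \<Rightarrow> real) measure" where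
  "N = PiM {1..n} C"

definition cnt :: "nat \<Rightarrow> real \<Rightarrow> (nat \<Rightarrow> real) \<Rightarrow> nat" where
  "cnt j t x = card {i\<in>{..<j - 1}. x i \<le> t}"

definition X :: "real \<Rightarrow> (nat \<Rightarrow> nat \<Rightarrow> real) \<Rightarrow> nat \<Rightarrow> nat" where
  "X t \<omega> = perm_of_jumps n {\<kappa>\<in>jump_index n. \<omega> (fst \<kappa>) (snd \<kappa>) \<le> t}"

sublocale product_prob_space C
  using prob_space_C
  by (simp add: product_prob_space_def product_prob_space_axioms_def product_sigma_finite_def prob_space_imp_sigma_finite)

lemma X_in_Sn: "X t \<omega> \<in> Sn n"
  by (simp add: X_def perm_of_jumps)

lemma Inv_j_X: "j \<in> {1..n} \<Longrightarrow> Inv_j (X t \<omega>) j = cnt j t (\<omega> j)"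
  unfolding X_def cnt_def
  by (simp add: perm_of_jumps) (auto simp: jump_index_def intro!: arg_cong[of _ _ card])

lemma X_eq_iff: "\<sigma> \<in> Sn n \<Longrightarrow> X t \<omega> = \<sigma> \<longleftrightarrow> (\<forall>j\<in>{1..n}. cnt j t (\<omega> j) = Inv_j \<sigma> j)"
  using Inv_j_inject[OF X_in_Sn[of t \<omega>], of \<sigma>] Inv_j_X[of _ t \<omega>] by auto

lemma measurable_cnt: "cnt j t \<in> measurable (C j) (count_space UNIV)"
proof -
  note measurable_C[measurable]
  show ?thesis unfolding cnt_def by measurable
qed

lemma prob_N:
  assumes "\<And>j. j \<in> {1..n} \<Longrightarrow> {x\<in>space (C j). Q j x} \<in> sets (C j)"
  shows "measure N {\<omega>\<in>space N. \<forall>j\<in>{1..n}. Q j (\<omega> j)} = (\<Prod>j\<in>{1..n}. measure (C j) {x\<in>space (C j). Q j x})"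
    and "{\<omega>\<in>space N. \<forall>j\<in>{1..n}. Q j (\<omega> j)} \<in> sets N"
proof -
  interpret F: finite_product_prob_space C "{1..n}" by standard simp
  have eq: "{\<omega>\<in>space N. \<forall>j\<in>{1..n}. Q j (\<omega> j)} = (\<Pi>\<^sub>E j\<in>{1..n}. {x\<in>space (C j). Q j x})"
    by (auto simp: N_def space_PiM PiE_iff extensional_def)
  show "measure N {\<omega>\<in>space N. \<forall>j\<in>{1..n}. Q j (\<omega> j)} = (\<Prod>j\<in>{1..n}. measure (C j) {x\<in>space (C j). Q j x})"
    unfolding eq unfolding N_def by (rule F.prob_times) (rule assms)
  show "{\<omega>\<in>space N. \<forall>j\<in>{1..n}. Q j (\<omega> j)} \<in> sets N"
    unfolding eq unfolding N_def by (rule sets_PiM_I_finite) (use assms in auto)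
qed

lemma sets_cnt: "{x\<in>space (C j). \<forall>i\<in>I. cnt j (ts i) x = y i} \<in> sets (C j)" if "finite I" for I :: "'i set"
proof -
  have "{x\<in>space (C j). cnt j (ts i) x = y i} \<in> sets (C j)" for i
    using measurable_sets[OF measurable_cnt[of j "ts i"], of "{y i}"] by (simp add: vimage_def Int_def conj_commute)
  then show ?thesis using that by (intro sets.sets_Collect_finite_All) auto
qed

text \<open>Prescribing a permutation is prescribing its code, so the event is a rectangle in the
  product of the chains.\<close>

lemma prob_X:
  fixes I :: "'i set"
  assumes "finite I" "\<And>i. i \<in> I \<Longrightarrow> xs i \<in> Sn n"
  shows "measure N {\<omega>\<in>space N. \<forall>i\<in>I. X (ts i) \<omega> = xs i}
      = (\<Prod>j\<in>{1..n}. measure (C j) {x\<in>space (C j). \<forall>i\<in>I. cnt j (ts i) x = Inv_j (xs i) j})"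
    and "{\<omega>\<in>space N. \<forall>i\<in>I. X (ts i) \<omega> = xs i} \<in> sets N"
proof -
  have "{\<omega>\<in>space N. \<forall>i\<in>I. X (ts i) \<omega> = xs i} = {\<omega>\<in>space N. \<forall>j\<in>{1..n}. \<forall>i\<in>I. cnt j (ts i) (\<omega> j) = Inv_j (xs i) j}"
    using assms X_eq_iff by blast
  then show "measure N {\<omega>\<in>space N. \<forall>i\<in>I. X (ts i) \<omega> = xs i}
      = (\<Prod>j\<in>{1..n}. measure (C j) {x\<in>space (C j). \<forall>i\<in>I. cnt j (ts i) x = Inv_j (xs i) j})"
    "{\<omega>\<in>space N. \<forall>i\<in>I. X (ts i) \<omega> = xs i} \<in> sets N"
    using prob_N[of "\<lambda>j x. \<forall>i\<in>I. cnt j (ts i) x = Inv_j (xs i) j"] sets_cnt[OF assms(1)] by simp_all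
qed

lemma prob_space_N: "prob_space N"
  unfolding N_def by (rule prob_space_PiM) (rule prob_space_C)

lemma X_measurable: "X t \<in> measurable N (count_space (Sn n))"
proof (subst measurable_count_space_eq2[OF finite_Sn], intro conjI ballI)
  show "X t -` {\<sigma>} \<inter> space N \<in> sets N" if "\<sigma> \<in> Sn n" for \<sigma>
    using prob_X(2)[of "{()}" "\<lambda>_. \<sigma>" "\<lambda>_. t"] that by (simp add: vimage_def Int_def conj_commute)
qed (use X_in_Sn in auto)

lemma mallows_X: "mallows_process n N X"
  unfolding mallows_process_def
proof (intro allI impI ballI)
  fix t :: real and \<sigma> assume t: "0 \<le> t" and \<sigma>: "\<sigma> \<in> Sn n"
  have "measure N {\<omega>\<in>space N. X t \<omega> = \<sigma>} = (\<Prod>j\<in>{1..n}. measure (C j) {x\<in>space (C j). cnt j t x = Inv_j \<sigma> j})"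
    using prob_X(1)[of "{()}" "\<lambda>_. \<sigma>" "\<lambda>_. t"] \<sigma> by simp
  also have "\<dots> = (\<Prod>j\<in>{1..n}. t ^ Inv_j \<sigma> j / (\<Sum>l<j. t ^ l))"
  proof (rule prod.cong[OF refl])
    fix j assume j: "j \<in> {1..n}"
    then have "Inv_j \<sigma> j \<le> j - 1" using Inv_j_less[of j \<sigma>] by simp
    then show "measure (C j) {x\<in>space (C j). cnt j t x = Inv_j \<sigma> j} = t ^ Inv_j \<sigma> j / (\<Sum>l<j. t ^ l)"
    proof -
      have "Suc (j - 1) = j" using j by simp
      then show ?thesis
        using C_count[OF t \<open>Inv_j \<sigma> j \<le> j - 1\<close>] by (simp only: cnt_def)
    qed
  qed
  finally show "measure N {\<omega>\<in>space N. X t \<omega> = \<sigma>} = mallows_prob n t \<sigma>"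
    by (simp add: mallows_prob_eq_prod)
qed

text \<open>The Markov identity is multiplicative, so the identities of the independent coordinates
  are multiplied over \<open>j\<close>.\<close>

lemma markov_X: "markov_process N X"
  unfolding markov_process_def
proof (intro allI impI)
  fix m :: nat and ts :: "nat \<Rightarrow> real" and xs :: "nat \<Rightarrow> nat \<Rightarrow> nat"
  assume ts: "0 \<le> ts 0 \<and> (\<forall>i\<le>m. ts i < ts (Suc i))"
  have conv: "(\<forall>i\<in>{..k}. P i) \<longleftrightarrow> (\<forall>i\<le>k. P i)" for k :: nat and P by auto
  let ?E = "\<lambda>I. {\<omega>\<in>space N. \<forall>i\<in>I. X (ts i) \<omega> = xs i}"
  let ?D = "\<lambda>j I. {x\<in>space (C j). \<forall>i\<in>I. cnt j (ts i) x = Inv_j (xs i) j}"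
  have "measure N (?E {..Suc m}) * measure N (?E {m}) = measure N (?E {..m}) * measure N (?E {m, Suc m})"
  proof (cases "\<forall>i\<in>{..Suc m}. xs i \<in> Sn n")
    case True
    have "(\<Prod>j\<in>{1..n}. measure (C j) (?D j {..Suc m})) * (\<Prod>j\<in>{1..n}. measure (C j) (?D j {m}))
        = (\<Prod>j\<in>{1..n}. measure (C j) (?D j {..m})) * (\<Prod>j\<in>{1..n}. measure (C j) (?D j {m, Suc m}))"
      unfolding prod.distrib[symmetric]
    proof (rule prod.cong[OF refl])
      fix j
      show "measure (C j) (?D j {..Suc m}) * measure (C j) (?D j {m}) = measure (C j) (?D j {..m}) * measure (C j) (?D j {m, Suc m})"
        using C_markov[of j, unfolded markov_process_def, rule_format, OF ts, of "\<lambda>i. Inv_j (xs i) j"]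
        by (simp add: cnt_def conv)
    qed
    then show ?thesis using True by (subst (1 2 3 4) prob_X(1)) auto
  next
    case False
    then obtain i where i: "i \<le> Suc m" "xs i \<notin> Sn n" by auto
    have empty: "?E I = {}" if "i \<in> I" for I
    proof (rule equals0I)
      fix \<omega> assume "\<omega> \<in> ?E I"
      then have "X (ts i) \<omega> = xs i" using that by blast
      then show False using i X_in_Sn[of "ts i" \<omega>] by simp
    qed
    \<comment> \<open>Wherever the inadmissible state stands, it empties one event on each side of
      the identity.\<close>
    consider "i < m" | "i = m" | "i = Suc m" using i by linarith
    then show ?thesis
    proof cases
      case 1
      then have "?E {..Suc m} = {}" "?E {..m} = {}" by (intro empty; simp)+
      then show ?thesis by (simp only: measure_empty mult_zero_left)
    next
      case 2
      then have "?E {m} = {}" "?E {..m} = {}" by (intro empty; simp)+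
      then show ?thesis by (simp only: measure_empty mult_zero_left mult_zero_right)
    next
      case 3
      then have "?E {..Suc m} = {}" "?E {m, Suc m} = {}" by (intro empty; simp)+
      then show ?thesis by (simp only: measure_empty mult_zero_left mult_zero_right)
    qed
  qed
  then show "measure N {\<omega>\<in>space N. \<forall>i\<le>Suc m. X (ts i) \<omega> = xs i} * measure N {\<omega>\<in>space N. X (ts m) \<omega> = xs m}
    = measure N {\<omega>\<in>space N. \<forall>i\<le>m. X (ts i) \<omega> = xs i}
      * measure N {\<omega>\<in>space N. X (ts m) \<omega> = xs m \<and> X (ts (Suc m)) \<omega> = xs (Suc m)}"
    by (simp add: conv)
qed

lemma independent_X: "independent_inversions n N X"
proof -
  interpret NP: prob_space N by (rule prob_space_N)
  show ?thesis
  proof (cases "n = 0")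
    case True
    then have empty: "{1..n} = {}" by simp
    show ?thesis
      unfolding independent_inversions_def NP.indep_vars_def NP.indep_sets_def empty by simp
  next
    case False
    have comp: "(\<lambda>\<omega>. \<omega> j) \<in> measurable N (C j)" if "j \<in> {1..n}" for j
      unfolding N_def using that by (rule measurable_component_singleton)
    have "NP.indep_vars C (\<lambda>j \<omega>. \<omega> j) {1..n}"
    proof (subst NP.indep_vars_iff_distr_eq_PiM')
      have "distr N (PiM {1..n} C) (\<lambda>\<omega>. \<lambda>j\<in>{1..n}. \<omega> j) = distr N N (\<lambda>\<omega>. \<omega>)"
        by (rule distr_cong) (auto simp: N_def space_PiM)
      also have "\<dots> = N" by (rule distr_id)
      also have "\<dots> = PiM {1..n} (\<lambda>j. distr N (C j) (\<lambda>\<omega>. \<omega> j))"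
        unfolding N_def by (intro PiM_cong refl distr_PiM_component[symmetric] prob_space_C)
      finally show "distr N (PiM {1..n} C) (\<lambda>\<omega>. \<lambda>j\<in>{1..n}. \<omega> j) = PiM {1..n} (\<lambda>j. distr N (C j) (\<lambda>\<omega>. \<omega> j))" .
    qed (use False comp in auto)
    then have "NP.indep_vars (\<lambda>_. PiM {0::real..} (\<lambda>_. count_space (UNIV :: nat set)))
        (\<lambda>j \<omega>. restrict (\<lambda>t. cnt j t (\<omega> j)) {0..}) {1..n}"
      by (rule NP.indep_vars_compose2) (rule measurable_restrict, rule measurable_cnt)
    moreover have "NP.indep_vars (\<lambda>_. PiM {0::real..} (\<lambda>_. count_space (UNIV :: nat set)))
        (\<lambda>j \<omega>. restrict (\<lambda>t. cnt j t (\<omega> j)) {0..}) {1..n} =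
      NP.indep_vars (\<lambda>_. PiM {0::real..} (\<lambda>_. count_space (UNIV :: nat set)))
        (\<lambda>j \<omega>. restrict (\<lambda>t. Inv_j (X t \<omega>) j) {0..}) {1..n}"
      by (intro NP.indep_vars_cong refl) (simp add: Inv_j_X)
    ultimately show ?thesis by (simp add: independent_inversions_def)
  qed
qed

text \<open>Within a chain the jump times increase strictly. Across chains, with all coordinates
  except \<open>j\<close> fixed, the jump time of chain \<open>j\<close> avoids the given value
  almost surely.\<close>

lemma AE_distinct:
  assumes "(j, i) \<in> jump_index n" "(j', i') \<in> jump_index n" "(j, i) \<noteq> (j', i')"
  shows "AE \<omega> in N. \<omega> j i \<noteq> \<omega> j' i'"
proof -
  have j: "j \<in> {1..n}" "j' \<in> {1..n}" "i < j - 1" "i' < j' - 1"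
    using assms by (auto simp: jump_index_def)
  show ?thesis
  proof (cases "j = j'")
    case True
    then have "i \<noteq> i'" using assms by simp
    have "AE x in C j. x i \<noteq> x i'"
      using C_strict[of j]
    proof eventually_elim
      case (elim x)
      then show ?case using True j \<open>i \<noteq> i'\<close> by (cases i i' rule: linorder_cases) force+
    qed
    then show ?thesis
      unfolding N_def True[symmetric] using j(1) by (intro AE_PiM_component prob_space_C)
  next
    case False
    show ?thesis
      unfolding N_def
    proof (rule AE_PiM_coordinate[of "{1..n}" j])
      have "(\<lambda>\<omega>. \<omega> j i) \<in> borel_measurable (PiM {1..n} C)" if "j \<in> {1..n}" for j i
        using measurable_compose[OF measurable_component_singleton[OF that, of C] measurable_C[where j=j and i=i]] by simp
      note meas = this[OF j(1), of i] this[OF j(2), of i']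
      show "{\<omega>\<in>space (PiM {1..n} C). \<omega> j i \<noteq> \<omega> j' i'} \<in> sets (PiM {1..n} C)"
        by (intro sets.sets_Collect_neg borel_measurable_eq meas)
      show "AE y in C j. (x(j := y)) j i \<noteq> (x(j := y)) j' i'" for x :: "nat \<Rightarrow> nat \<Rightarrow> real"
        using C_neq[OF j(3), of "x j' i'"] by eventually_elim (use False in simp)
    qed (use j in auto)
  qed
qed

lemma good_X: "AE \<omega> in N. good_path n (\<lambda>t. X t \<omega>)"
proof -
  let ?K = "jump_index n"
  have "AE \<omega> in N. \<forall>\<kappa>\<in>?K. \<forall>\<kappa>'\<in>?K. \<kappa> \<noteq> \<kappa>' \<longrightarrow> \<omega> (fst \<kappa>) (snd \<kappa>) \<noteq> \<omega> (fst \<kappa>') (snd \<kappa>')"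
  proof (intro AE_finite_allI finite_jump_index)
    fix \<kappa> \<kappa>' assume "\<kappa> \<in> ?K" "\<kappa>' \<in> ?K"
    then show "AE \<omega> in N. \<kappa> \<noteq> \<kappa>' \<longrightarrow> \<omega> (fst \<kappa>) (snd \<kappa>) \<noteq> \<omega> (fst \<kappa>') (snd \<kappa>')"
      using AE_distinct[of "fst \<kappa>" "snd \<kappa>" "fst \<kappa>'" "snd \<kappa>'"] by (cases "\<kappa> = \<kappa>'") auto
  qed
  then show ?thesis
  proof eventually_elim
    case (elim \<omega>)
    then have "inj_on (\<lambda>\<kappa>. \<omega> (fst \<kappa>) (snd \<kappa>)) ?K" by (auto intro: inj_onI)
    then show ?case unfolding X_def by (rule good_path_perm_of_jumps)
  qed
qed

end

lemma ex_regular_mallows_markov: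
  "\<exists>(M :: (real \<Rightarrow> nat \<Rightarrow> nat) measure) X. regular_mallows_markov n M X"
proof -
  let ?P = "\<lambda>d (N :: (nat \<Rightarrow> real) measure). prob_space N \<and> (\<forall>i. (\<lambda>x. x i) \<in> borel_measurable N) \<and>
    (AE x in N. \<forall>i<d. \<forall>j<i. x j < x i) \<and> (\<forall>i c. i < d \<longrightarrow> (AE x in N. x i \<noteq> c)) \<and>
    (\<forall>t k. 0 \<le> t \<longrightarrow> k \<le> d \<longrightarrow>
      measure N {x\<in>space N. card {i\<in>{..<d}. x i \<le> t} = k} = t ^ k / (\<Sum>l<Suc d. t ^ l)) \<and>
    markov_process N (\<lambda>t x. card {i\<in>{..<d}. x i \<le> t})"
  have "\<forall>d. \<exists>N. ?P d N"
  proof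
    fix d
    show "\<exists>N. ?P d N" by (rule ex_birth_chain[of d]) blast
  qed
  from choice[OF this] obtain C where C: "\<forall>d. ?P d (C d)" ..
  \<comment> \<open>The inversion count at \<open>j\<close> ranges over \<open>{0..j - 1}\<close>,
    hence the shift from \<open>j\<close> to the chain with \<open>j - 1\<close> jumps.\<close>
  interpret birth_chains n "\<lambda>j. C (j - 1)"
  proof (rule birth_chains.intro)
    fix j i k :: nat and t c :: real
    note C' = C[THEN spec, of "j - 1"]
    show "prob_space (C (j - 1))" by (rule C'[THEN conjunct1])
    show "(\<lambda>x. x i) \<in> borel_measurable (C (j - 1))"
      by (rule C'[THEN conjunct2, THEN conjunct1, THEN spec])
    show "AE x in C (j - 1). \<forall>i<j - 1. \<forall>k<i. x k < x i"
      by (rule C'[THEN conjunct2, THEN conjunct2, THEN conjunct1])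
    show "AE x in C (j - 1). x i \<noteq> c" if "i < j - 1"
      by (rule C'[THEN conjunct2, THEN conjunct2, THEN conjunct2, THEN conjunct1, THEN spec, THEN spec, THEN mp, OF that])
    note C'' = C'[THEN conjunct2, THEN conjunct2, THEN conjunct2, THEN conjunct2]
    show "measure (C (j - 1)) {x\<in>space (C (j - 1)). card {i\<in>{..<j - 1}. x i \<le> t} = k} = t ^ k / (\<Sum>l<Suc (j - 1). t ^ l)"
      if "0 \<le> t" "k \<le> j - 1"
      by (rule C''[THEN conjunct1, THEN spec, THEN spec, THEN mp, THEN mp, OF that])
    show "markov_process (C (j - 1)) (\<lambda>t x. card {i\<in>{..<j - 1}. x i \<le> t})"
      by (rule C''[THEN conjunct2])
  qed
  show ?thesis
    by (rule regular_mallows_markov_canonical[OF prob_space_N X_measurable good_X markov_X mallows_X independent_X])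
qed

theorem theorem1:
  fixes n :: nat
  shows "(\<exists>(M :: (real \<Rightarrow> nat \<Rightarrow> nat) measure) X. regular_mallows_markov n M X) \<and>
    (\<forall>(M :: 'a measure) X (M' :: 'b measure) X'.
       regular_mallows_markov n M X \<and> regular_mallows_markov n M' X' \<longrightarrow>
       process_law n M X = process_law n M' X')"
proof (intro conjI allI impI)
  show "\<exists>(M :: (real \<Rightarrow> nat \<Rightarrow> nat) measure) X. regular_mallows_markov n M X"
    by (rule ex_regular_mallows_markov)
  fix M :: "'a measure" and X and M' :: "'b measure" and X'
  assume "regular_mallows_markov n M X \<and> regular_mallows_markov n M' X'"
  then interpret two_regular_mallows n M X M' X'
    by (simp add: two_regular_mallows_def regular_mallows_def)
  show "process_law n M X = process_law n M' X'"
    by (rule process_law_eq)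
qed

end
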